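(* Let $p$ be an odd prime and let $G = G_{\mathbf e}$ be the GGS-group acting on the $p$-regular rooted tree with non-constant defining tuple $\mathbf{e} \in \mathbb F_p^{p-1}$. Let $\mathbf{e'}$ and $\mathbf{e''}$ be the first and second difference tuples of $\mathbf e$. Then, for every integer $n \geq 1$, the index $|G:G^{(n)}|$ is finite and \[ \log_p |G:G^{(n)}| = \begin{cases} p^{n-2}\bigl(p + \operatorname{con}(\mathbf{e'}) + \operatorname{sym}(\mathbf{e''})\bigr) - \frac{p^{n-1}-1}{p-1}\operatorname{sym}(\mathbf{e}) + 1 &\text{ if } n \geq 2,\\ 2 &\text{ if } n = 1. \end{cases} \]
   Context: Let $p$ be an odd prime, $X=\{0,\dots,p-1\}$ (identified with $\mathbb F_p$), and let $X^*$ be the $p$-regular rooted tree whose vertices are the finite words over $X$ (the root is the empty word, and $w$ is joined to $wx$ for $x\in X$). Automorphisms act on the right, $u\mapsto u^g$. The section $g|_u\in\operatorname{Aut}(X^* )$ of $g\in\operatorname{Aut}(X^* )$ at a vertex $u$ is defined by $(uv)^g=u^g v^{g|_u}$ for all words $v$. Let $\operatorname{Stab}(1)$ be the pointwise stabiliser of the first level $X$; the map $\psi:\operatorname{Stab}(1)\to \operatorname{Aut}(X^* )^p$, $g\mapsto (g|_0,\dots,g|_{p-1})$, is an isomorphism. GGS-groups: for a non-constant tuple $\mathbf e=(\mathbf e_1,\dots,\mathbf e_{p-1})\in\mathbb F_p^{p-1}$ (at least two entries differ), the GGS-group $G_{\mathbf e}\le\operatorname{Aut}(X^* )$ with defining tuple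 $\mathbf e$ is the group generated by the rooted automorphism $a$, with $(xv)^a=(x+1 \bmod p)\,v$ for $x \in X$ and $v\in X^*$, and the automorphism $b\in\operatorname{Stab}(1)$ defined recursively by $\psi(b)=(b,a^{\mathbf e_1},\dots,a^{\mathbf e_{p-1}})$ (so $b|_0=b$ and $b|_i=a^{\mathbf e_i}$ for $1\le i\le p-1$). Difference tuples: $\mathbf{e'}=(\mathbf{e'}_2,\dots,\mathbf{e'}_{p-1})\in\mathbb F_p^{p-2}$ with $\mathbf{e'}_i=\mathbf e_{i-1}-\mathbf e_i$, and $\mathbf{e''}=(\mathbf{e''}_3,\dots,\mathbf{e''}_{p-1})\in\mathbb F_p^{p-3}$ with $\mathbf{e''}_i=\mathbf{e'}_{i-1}-\mathbf{e'}_i$ (the empty tuple if $p=3$). For a tuple $\mathbf d$: $\operatorname{sym}(\mathbf d)=1$ if $\mathbf d$ is symmetric (its $i$th entry equals its $i$th-to-last entry for all $i$; the empty tuple is symmetric) and $0$ otherwise; $\operatorname{con}(\mathbf d)=1$ if $\mathbf d$ is constant (all entries equal) and $0$ otherwise. $G^{(n)}$ denotes the $n$th derived subgroup: $G^{(1)}=G'=[G,G]$, $G^{(n+1)}=[G^{(n)},G^{(n)}]$. *)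

theory Defs
  imports Complex_Main "HOL-Algebra.Bij" "HOL-Algebra.Generated_Groups" "HOL-Computational_Algebra.Primes"
begin

section \<open>The regular rooted tree and its automorphism group\<close>

definition words :: "nat \<Rightarrow> nat list set" where
  "words p = lists {0..<p}"

definition tree_adj :: "nat list \<Rightarrow> nat list \<Rightarrow> bool" where
  "tree_adj u v \<longleftrightarrow> (\<exists>x. v = u @ [x] \<or> u = v @ [x])"

definition tree_auts :: "nat \<Rightarrow> (nat list \<Rightarrow> nat list) set" where
  "tree_auts p = {g \<in> Bij (words p). g [] = [] \<and>
     (\<forall>u\<in>words p. \<forall>v\<in>words p. tree_adj (g u) (g v) \<longleftrightarrow> tree_adj u v)}"

text \<open>Automorphisms act on the right: the product of \<open>g\<close> and \<open>h\<close> applies \<open>g\<close> first.\<close>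

definition tree_aut :: "nat \<Rightarrow> (nat list \<Rightarrow> nat list) monoid" where
  "tree_aut p = \<lparr>carrier = tree_auts p,
     monoid.mult = (\<lambda>g h. compose (words p) h g),
     one = (\<lambda>u\<in>words p. u)\<rparr>"

text \<open>For an automorphism \<open>g\<close>, the image of \<open>u @ v\<close> begins with the image of \<open>u\<close>, which has
  the same length as \<open>u\<close>; the section at \<open>u\<close> is what remains
  (lemma \<open>tree_auts_section\<close> below).\<close>

definition tree_section :: "nat \<Rightarrow> (nat list \<Rightarrow> nat list) \<Rightarrow> nat list \<Rightarrow> nat list \<Rightarrow> nat list" where
  "tree_section p g u = (\<lambda>v\<in>words p. drop (length u) (g (u @ v)))"

definition level_one_stab :: "nat \<Rightarrow> (nat list \<Rightarrow> nat list) set" where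
  "level_one_stab p = {g \<in> tree_auts p. \<forall>x<p. g [x] = [x]}"


section \<open>GGS-groups\<close>

text \<open>Tuples over the prime field are functions on the index range that they carry in the
  mathematical notation, with entries represented by the integers in \<open>{0..<p}\<close>; the defining
  tuple is indexed by \<open>{1..p-1}\<close> and its values elsewhere play no role.\<close>

definition ggs_a :: "nat \<Rightarrow> nat list \<Rightarrow> nat list" where
  "ggs_a p = (\<lambda>u\<in>words p. case u of [] \<Rightarrow> [] | x # v \<Rightarrow> ((x + 1) mod p) # v)"

primrec ggs_b_rec :: "nat \<Rightarrow> (nat \<Rightarrow> int) \<Rightarrow> nat list \<Rightarrow> nat list" where
  "ggs_b_rec p e [] = []"
| "ggs_b_rec p e (x # v) =
     x # (if x = 0 then ggs_b_rec p e v else (ggs_a p [^]\<^bsub>tree_aut p\<^esub> e x) v)"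

definition ggs_b :: "nat \<Rightarrow> (nat \<Rightarrow> int) \<Rightarrow> nat list \<Rightarrow> nat list" where
  "ggs_b p e = restrict (ggs_b_rec p e) (words p)"

definition ggs_group :: "nat \<Rightarrow> (nat \<Rightarrow> int) \<Rightarrow> (nat list \<Rightarrow> nat list) monoid" where
  "ggs_group p e = subgroup_generated (tree_aut p) {ggs_a p, ggs_b p e}"


section \<open>Tuples\<close>

text \<open>If \<open>d\<close> is a tuple indexed by \<open>{l..p-1}\<close>, then \<open>diff_tuple p d\<close> is
  its difference tuple, indexed by \<open>{l+1..p-1}\<close>.\<close>

definition diff_tuple :: "nat \<Rightarrow> (nat \<Rightarrow> int) \<Rightarrow> nat \<Rightarrow> int" where
  "diff_tuple p d i = (d (i - 1) - d i) mod int p"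

text \<open>In the following, \<open>d\<close> is a tuple indexed by \<open>{l..m}\<close>, empty if \<open>m < l\<close>.\<close>

definition constant_tuple :: "nat \<Rightarrow> nat \<Rightarrow> (nat \<Rightarrow> int) \<Rightarrow> bool" where
  "constant_tuple l m d \<longleftrightarrow> (\<forall>i\<in>{l..m}. \<forall>j\<in>{l..m}. d i = d j)"

definition symmetric_tuple :: "nat \<Rightarrow> nat \<Rightarrow> (nat \<Rightarrow> int) \<Rightarrow> bool" where
  "symmetric_tuple l m d \<longleftrightarrow> (\<forall>i\<in>{l..m}. d i = d (l + m - i))"

definition tuple_con :: "nat \<Rightarrow> nat \<Rightarrow> (nat \<Rightarrow> int) \<Rightarrow> real" where
  "tuple_con l m d = of_bool (constant_tuple l m d)"

definition tuple_sym :: "nat \<Rightarrow> nat \<Rightarrow> (nat \<Rightarrow> int) \<Rightarrow> real" where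
  "tuple_sym l m d = of_bool (symmetric_tuple l m d)"


section \<open>Basic facts\<close>

lemma words_Nil [simp]: "[] \<in> words p"
  and words_Cons [simp]: "x # v \<in> words p \<longleftrightarrow> x < p \<and> v \<in> words p"
  and words_append [simp]: "u @ v \<in> words p \<longleftrightarrow> u \<in> words p \<and> v \<in> words p"
  by (auto simp: words_def)

lemma tree_auts_bij: "g \<in> tree_auts p \<Longrightarrow> bij_betw g (words p) (words p)"
  and tree_auts_Nil: "g \<in> tree_auts p \<Longrightarrow> g [] = []"
  and tree_auts_ext: "g \<in> tree_auts p \<Longrightarrow> g \<in> extensional (words p)"
  by (auto simp: tree_auts_def Bij_def)

lemma tree_auts_words: "g \<in> tree_auts p \<Longrightarrow> u \<in> words p \<Longrightarrow> g u \<in> words p"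
  using bij_betwE[OF tree_auts_bij] by blast

lemma tree_auts_snoc:
  assumes g: "g \<in> tree_auts p" and "u \<in> words p" "x < p"
  shows "\<exists>y. g (u @ [x]) = g u @ [y]"
  using assms(2,3)
proof (induction u arbitrary: x rule: rev_induct)
  case Nil
  have "tree_adj [] [x]" by (simp add: tree_adj_def)
  then have "tree_adj (g []) (g [x])"
    using g Nil words_Nil[of p] words_Cons[of x "[]" p] unfolding tree_auts_def by blast
  then show ?case using tree_auts_Nil[OF g] by (auto simp: tree_adj_def)
next
  case (snoc z u)
  obtain y where y: "g (u @ [z]) = g u @ [y]" using snoc by auto
  have w: "u \<in> words p" "u @ [z] \<in> words p" "(u @ [z]) @ [x] \<in> words p" using snoc by auto
  have "tree_adj (u @ [z]) ((u @ [z]) @ [x])" by (simp add: tree_adj_def)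
  then have "tree_adj (g (u @ [z])) (g ((u @ [z]) @ [x]))"
    using g w unfolding tree_auts_def by blast
  moreover have "g ((u @ [z]) @ [x]) \<noteq> g u"
    using tree_auts_bij[OF g] w by (auto simp: bij_betw_def dest: inj_onD)
  ultimately show ?case using y by (auto simp: tree_adj_def)
qed

lemma tree_auts_prefix:
  assumes g: "g \<in> tree_auts p" and "u @ v \<in> words p"
  shows "\<exists>w. g (u @ v) = g u @ w \<and> length w = length v"
  using assms(2)
proof (induction v rule: rev_induct)
  case (snoc x v)
  then obtain w where w: "g (u @ v) = g u @ w" "length w = length v" by auto
  obtain y where "g ((u @ v) @ [x]) = g (u @ v) @ [y]"
    using tree_auts_snoc[OF g, of "u @ v" x] snoc by auto
  with w show ?case by auto
qed auto

lemma tree_auts_length: "g \<in> tree_auts p \<Longrightarrow> u \<in> words p \<Longrightarrow> length (g u) = length u"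
  using tree_auts_prefix[of g p "[]" u] tree_auts_Nil by auto

lemma tree_auts_section:
  assumes "g \<in> tree_auts p" "u \<in> words p" "v \<in> words p"
  shows "g (u @ v) = g u @ tree_section p g u v"
  using tree_auts_prefix[of g p u v] tree_auts_length[of g p u] assms
  by (auto simp: tree_section_def)

lemma tree_autsI:
  assumes b: "bij_betw g (words p) (words p)" and e: "g \<in> extensional (words p)"
    and n: "g [] = []"
    and s: "\<And>u x. u \<in> words p \<Longrightarrow> x < p \<Longrightarrow> \<exists>y. g (u @ [x]) = g u @ [y]"
  shows "g \<in> tree_auts p"
proof -
  have *: "\<exists>x. v = u @ [x]" if w: "u \<in> words p" "v \<in> words p" and z: "g v = g u @ [z]" for u v z
  proof (cases v rule: rev_exhaust)
    case Nil
    then show ?thesis using z n by simp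
  next
    case (snoc v' y)
    then obtain y' where "g v = g v' @ [y']" using s[of v' y] w by auto
    then have "g v' = g u" using z by simp
    then have "v' = u" using b w snoc by (auto simp: bij_betw_def dest: inj_onD)
    then show ?thesis using snoc by simp
  qed
  have "tree_adj (g u) (g v) \<longleftrightarrow> tree_adj u v" if "u \<in> words p" "v \<in> words p" for u v
    using *[OF that] *[OF that(2,1)] s that by (fastforce simp: tree_adj_def)
  then show ?thesis using b e n by (simp add: tree_auts_def Bij_def)
qed

lemma group_tree_aut: "group (tree_aut p)"
proof (rule groupI)
  fix g h assume "g \<in> carrier (tree_aut p)" "h \<in> carrier (tree_aut p)"
  then have gh: "g \<in> tree_auts p" "h \<in> tree_auts p" by (auto simp: tree_aut_def)
  have "compose (words p) h g \<in> Bij (words p)"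
    using gh by (auto simp: tree_auts_def compose_Bij)
  moreover have "tree_adj (h (g u)) (h (g v)) \<longleftrightarrow> tree_adj u v"
    if "u \<in> words p" "v \<in> words p" for u v
    using that gh tree_auts_words[OF gh(1)] unfolding tree_auts_def by simp
  ultimately show "g \<otimes>\<^bsub>tree_aut p\<^esub> h \<in> carrier (tree_aut p)"
    using gh by (simp add: tree_aut_def tree_auts_def compose_eq)
next
  show "\<one>\<^bsub>tree_aut p\<^esub> \<in> carrier (tree_aut p)"
    by (auto simp: tree_aut_def tree_auts_def id_Bij)
next
  fix g h k assume "g \<in> carrier (tree_aut p)" "h \<in> carrier (tree_aut p)" "k \<in> carrier (tree_aut p)"
  then show "g \<otimes>\<^bsub>tree_aut p\<^esub> h \<otimes>\<^bsub>tree_aut p\<^esub> k = g \<otimes>\<^bsub>tree_aut p\<^esub> (h \<otimes>\<^bsub>tree_aut p\<^esub> k)"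
    by (auto simp: tree_aut_def compose_def fun_eq_iff tree_auts_words)
next
  fix g assume "g \<in> carrier (tree_aut p)"
  then show "\<one>\<^bsub>tree_aut p\<^esub> \<otimes>\<^bsub>tree_aut p\<^esub> g = g"
    by (auto simp: tree_aut_def compose_def fun_eq_iff dest: tree_auts_ext simp: extensional_def)
next
  fix g assume "g \<in> carrier (tree_aut p)"
  then have g: "g \<in> tree_auts p" by (simp add: tree_aut_def)
  note b = tree_auts_bij[OF g]
  define h where "h = (\<lambda>u\<in>words p. inv_into (words p) g u)"
  have h: "h \<in> Bij (words p)"
    using g unfolding h_def by (auto simp: tree_auts_def restrict_inv_into_Bij)
  have hg: "h (g u) = u" and gh: "g (h u) = u" and hw: "h u \<in> words p" if "u \<in> words p" for u
    using that b tree_auts_words[OF g that]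
    by (auto simp: h_def bij_betw_inv_into_left bij_betw_inv_into_right
        intro: bij_betwE[OF bij_betw_inv_into, rule_format])
  have "tree_adj (h u) (h v) \<longleftrightarrow> tree_adj u v" if "u \<in> words p" "v \<in> words p" for u v
  proof -
    have "tree_adj (g (h u)) (g (h v)) \<longleftrightarrow> tree_adj (h u) (h v)"
      using g hw[OF that(1)] hw[OF that(2)] unfolding tree_auts_def by blast
    then show ?thesis using that gh by simp
  qed
  moreover have "h [] = []" using hg[of "[]"] tree_auts_Nil[OF g] by simp
  ultimately have "h \<in> tree_auts p" using h by (simp add: tree_auts_def)
  moreover have "compose (words p) g h = (\<lambda>u\<in>words p. u)"
    using gh by (auto simp: compose_def fun_eq_iff)
  ultimately show "\<exists>h\<in>carrier (tree_aut p). h \<otimes>\<^bsub>tree_aut p\<^esub> g = \<one>\<^bsub>tree_aut p\<^esub>"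
    by (auto simp: tree_aut_def)
qed

lemma ggs_a_in: "ggs_a p \<in> carrier (tree_aut p)"
proof -
  have w: "ggs_a p u \<in> words p" if "u \<in> words p" for u
    using that by (cases u) (auto simp: ggs_a_def)
  have "inj_on (ggs_a p) (words p)"
  proof (rule inj_onI)
    fix u v assume uv: "u \<in> words p" "v \<in> words p" "ggs_a p u = ggs_a p v"
    then show "u = v"
      by (cases u; cases v) (auto simp: ggs_a_def mod_Suc split: if_splits)
  qed
  moreover have "u \<in> ggs_a p ` words p" if "u \<in> words p" for u
  proof (cases u)
    case Nil
    then show ?thesis by (intro image_eqI[of _ _ "[]"]) (auto simp: ggs_a_def)
  next
    case (Cons x v)
    let ?y = "if x = 0 then p - 1 else x - 1"
    show ?thesis
      using that Cons by (intro image_eqI[of _ _ "?y # v"]) (auto simp: ggs_a_def)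
  qed
  ultimately have "bij_betw (ggs_a p) (words p) (words p)"
    using w by (auto simp: bij_betw_def)
  moreover have "\<exists>y. ggs_a p (u @ [x]) = ggs_a p u @ [y]" if "u \<in> words p" "x < p" for u x
    using that by (cases u) (auto simp: ggs_a_def)
  ultimately show ?thesis
    by (auto simp: tree_aut_def ggs_a_def intro!: tree_autsI)
qed

lemma ggs_a_pow_in: "ggs_a p [^]\<^bsub>tree_aut p\<^esub> (k :: int) \<in> tree_auts p"
  using group.int_pow_closed[OF group_tree_aut ggs_a_in] by (simp add: tree_aut_def)

lemma ggs_b_in: "ggs_b p e \<in> carrier (tree_aut p)"
proof -
  let ?f = "ggs_b_rec p e"
  let ?a = "\<lambda>k. ggs_a p [^]\<^bsub>tree_aut p\<^esub> (k :: int)"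
  have w: "?f u \<in> words p" if "u \<in> words p" for u
    using that by (induction u) (auto simp: tree_auts_words[OF ggs_a_pow_in])
  have i: "u = v" if "u \<in> words p" "v \<in> words p" "?f u = ?f v" for u v
    using that
  proof (induction u arbitrary: v)
    case Nil
    then show ?case by (cases v) auto
  next
    case (Cons x u)
    then obtain v' where v: "v = x # v'" "v' \<in> words p" by (cases v) auto
    show ?case
      using Cons v bij_betw_imp_inj_on[OF tree_auts_bij[OF ggs_a_pow_in]]
      by (cases "x = 0") (auto dest: inj_onD)
  qed
  have s: "\<exists>v\<in>words p. ?f v = u" if "u \<in> words p" for u
    using that
  proof (induction u)
    case Nil
    then show ?case by (intro bexI[of _ "[]"]) auto
  next
    case (Cons x u)
    then obtain v where v: "v \<in> words p" "?f v = u" by auto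
    have "u \<in> ?a (e x) ` words p"
      using Cons bij_betw_imp_surj_on[OF tree_auts_bij[OF ggs_a_pow_in]] by auto
    then obtain v' where v': "v' \<in> words p" "?a (e x) v' = u" by auto
    show ?case
      using Cons v v' by (intro bexI[of _ "x # (if x = 0 then v else v')"]) auto
  qed
  have "inj_on ?f (words p)" using i by (auto intro: inj_onI)
  moreover have "?f ` words p = words p"
    using w s by (force simp: image_iff)
  ultimately have "bij_betw (ggs_b p e) (words p) (words p)"
    by (simp add: bij_betw_def ggs_b_def)
  moreover have "\<exists>y. ?f (u @ [x]) = ?f u @ [y]" if "u \<in> words p" "x < p" for u x
    using that
  proof (induction u)
    case (Cons z u)
    then show ?case using tree_auts_snoc[OF ggs_a_pow_in, of u p x "e z"] by auto
  qed (auto simp: tree_auts_Nil[OF ggs_a_pow_in])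
  ultimately show ?thesis
    by (auto simp: tree_aut_def ggs_b_def intro!: tree_autsI)
qed

lemma carrier_ggs_group: "carrier (ggs_group p e) = generate (tree_aut p) {ggs_a p, ggs_b p e}"
  using ggs_a_in ggs_b_in by (simp add: ggs_group_def carrier_subgroup_generated)

lemma group_ggs_group: "group (ggs_group p e)"
  unfolding ggs_group_def by (rule group.group_subgroup_generated[OF group_tree_aut])

text \<open>The recursive description of \<open>b\<close> by its first level sections.\<close>

lemma ggs_b_stab: "ggs_b p e \<in> level_one_stab p"
  using ggs_b_in[of p e] tree_auts_Nil[OF ggs_a_pow_in, of p]
  by (auto simp: level_one_stab_def tree_aut_def ggs_b_def)

lemma ggs_b_section_zero: "0 < p \<Longrightarrow> tree_section p (ggs_b p e) [0] = ggs_b p e"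
  by (auto simp: tree_section_def ggs_b_def fun_eq_iff restrict_def)

lemma ggs_b_section:
  assumes "i \<in> {1..p-1}"
  shows "tree_section p (ggs_b p e) [i] = ggs_a p [^]\<^bsub>tree_aut p\<^esub> e i"
  using assms tree_auts_ext[OF ggs_a_pow_in, of p "e i"]
  by (auto simp: tree_section_def ggs_b_def fun_eq_iff restrict_def extensional_def)

end

theory Submission
  imports Defs "HOL-Library.Function_Algebras" "HOL-Number_Theory.Number_Theory"
begin

text \<open>Let \<open>S\<close> be the stabilizer of the first level in \<open>G\<close>, generated by the conjugates
  \<open>b\<^sub>j\<close> of \<open>b\<close>. Counting letters modulo \<open>p\<close> gives homomorphisms showing that \<open>G / G'\<close> has order
  \<open>p\<^sup>2\<close>, that \<open>G / S'\<close> is the wreath product of two cyclic groups of order \<open>p\<close>, and that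
  \<open>G' / \<gamma>\<^sub>3(G)\<close> has order \<open>p\<close>. Both \<open>\<psi>(S')\<close> and \<open>\<psi>(G'')\<close> lie between \<open>\<gamma>\<^sub>3(G)\<^sup>p\<close> and \<open>G'\<^sup>p\<close>,
  hence they are determined by their images in \<open>(G' / \<gamma>\<^sub>3(G))\<^sup>p\<close>, which are cyclic codes, that is,
  ideals of \<open>\<bbbF>\<^sub>p[x] / (x - 1)\<^sup>p\<close>. Such an ideal is determined by its codimension, which is read
  off from the moments \<open>\<Sum> i\<^sup>s w\<^sub>i\<close> of its elements: for \<open>\<psi>(S')\<close> it is \<open>sym(e)\<close>, and for \<open>\<psi>(G'')\<close>
  it is \<open>con(e') + sym(e'')\<close>. Finally \<open>G' / \<gamma>\<^sub>3(G)\<close> is cyclic, so \<open>G'' = [G', \<gamma>\<^sub>3(G)]\<close>, which yields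
  \<open>\<psi>(G''') = (G'')\<^sup>p\<close> and inductively \<open>\<psi>(G\<^sup>(\<^sup>n\<^sup>+\<^sup>1\<^sup>)) = (G\<^sup>(\<^sup>n\<^sup>))\<^sup>p\<close> for \<open>n \<ge> 2\<close>.\<close>

section \<open>Additively written groups\<close>

text \<open>For \<open>g\<close>, \<open>h\<close> in \<open>S\<close> with letter counts u and w,
  the s-th moment of the classes of the sections of [g, h] is the bilinear form in u and w with
  matrix i^s E(i - k) - k^s E(k - i). On G' the letter counts sum to 0, so the form vanishes there
  as soon as the matrix has the shape A(i) + B(k); commutators of elements b_j - b_(j+1) show that
  nothing weaker suffices. For s = 0 the shape means that the odd part of E is linear, which is
  sym(e''); for s = 1, given this, that E is affine off the multiples of p, which is con(e'); for s
  = 2, given both, it is impossible, since the slope would vanish and e would be constant. Hence the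
  codimension con(e') + sym(e''). On all of S the sums are arbitrary, so for s = 0 the matrix itself
  must vanish, which is sym(e). The rest is counting: |G : S'| = p^(p+1), |G : G'| = p^2 and |G'^p :
  psi(S')| = p^sym(e) give, for n >= 2, log |G : G^(n+1)| = p log |G : G^(n)| - p + 1 - sym(e).
  Iterating the last term produces the geometric sum.\<close>

definition additive :: "'a::group_add monoid" where
  "additive = \<lparr>carrier = UNIV, monoid.mult = (+), one = 0\<rparr>"

lemma additive_simps [simp]:
  "carrier (additive :: 'a::group_add monoid) = UNIV"
  "x \<otimes>\<^bsub>additive\<^esub> y = x + y" "\<one>\<^bsub>additive\<^esub> = (0 :: 'a)" for x y :: "'a::group_add"
  by (simp_all add: additive_def)

interpretation additive: group "additive :: 'a::group_add monoid"
  by (rule groupI) (auto simp: add.assoc intro: left_minus)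

text \<open>Rewriting with these brings a word in a non-abelian group to its freely reduced form, so
  that commutator identities are settled by \<open>simp only\<close>.\<close>

lemmas group_cancel_simps = diff_conv_add_uminus minus_add add.assoc minus_add_cancel
  add_minus_cancel left_minus right_minus minus_minus minus_zero add_0_left add_0_right

lemma inv_additive [simp]: "inv\<^bsub>additive\<^esub> x = - (x :: 'a::group_add)"
  by (rule additive.inv_equality) auto

abbreviation subgrp :: "'a::group_add set \<Rightarrow> bool" where
  "subgrp H \<equiv> subgroup H additive"

lemma subgrp_iff: "subgrp H \<longleftrightarrow> 0 \<in> H \<and> (\<forall>x\<in>H. \<forall>y\<in>H. x - y \<in> H)"
proof
  assume "subgrp H"
  then interpret subgroup H additive .
  show "0 \<in> H \<and> (\<forall>x\<in>H. \<forall>y\<in>H. x - y \<in> H)"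
    using one_closed m_closed m_inv_closed
    by (metis additive_simps(2,3) inv_additive diff_conv_add_uminus)
next
  assume H: "0 \<in> H \<and> (\<forall>x\<in>H. \<forall>y\<in>H. x - y \<in> H)"
  then have m: "- x \<in> H" if "x \<in> H" for x using that by (metis diff_0)
  then have "x + y \<in> H" if "x \<in> H" "y \<in> H" for x y
    using that H by (metis diff_minus_eq_add)
  with H m show "subgrp H" by unfold_locales auto
qed

lemma subgrpI: "0 \<in> H \<Longrightarrow> (\<And>x y. x \<in> H \<Longrightarrow> y \<in> H \<Longrightarrow> x - y \<in> H) \<Longrightarrow> subgrp H"
  by (simp add: subgrp_iff)

lemma subgrp_0: "subgrp H \<Longrightarrow> 0 \<in> H"
  and subgrp_diff: "subgrp H \<Longrightarrow> x \<in> H \<Longrightarrow> y \<in> H \<Longrightarrow> x - y \<in> H"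
  and subgrp_minus: "subgrp H \<Longrightarrow> x \<in> H \<Longrightarrow> - x \<in> H"
  and subgrp_add: "subgrp H \<Longrightarrow> x \<in> H \<Longrightarrow> y \<in> H \<Longrightarrow> x + y \<in> H"
  using subgrp_iff[of H] subgroup.m_closed[of H additive x y] subgroup.m_inv_closed[of H additive x]
  by auto

lemmas subgrp_closed = subgrp_0 subgrp_diff subgrp_minus subgrp_add

lemma subgrp_Int: "subgrp H \<Longrightarrow> subgrp K \<Longrightarrow> subgrp (H \<inter> K)"
  by (simp add: subgrp_iff)

lemma subgrp_sum_list: "subgrp H \<Longrightarrow> set xs \<subseteq> H \<Longrightarrow> sum_list xs \<in> H"
  by (induction xs) (auto simp: subgrp_closed)

section \<open>Integer multiples, that is, powers in multiplicative notation\<close>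

definition zm :: "int \<Rightarrow> 'a::group_add \<Rightarrow> 'a" where
  "zm k x = x [^]\<^bsub>additive\<^esub> k"

lemma zm_0 [simp]: "zm 0 x = 0" and zm_1 [simp]: "zm 1 x = x" and zm_zero [simp]: "zm k 0 = 0"
  and zm_add: "zm (i + j) x = zm i x + zm j x"
  and zm_minus: "zm (- k) x = - zm k x"
  and zm_mult: "zm (i * j) x = zm j (zm i x)"
  and zm_minus_right: "zm k (- x) = - zm k x"
  using additive.int_pow_one[of k] additive.int_pow_1[of x] additive.int_pow_mult[of x i j]
    additive.int_pow_neg[of x k] additive.int_pow_pow[of x i j] additive.int_pow_inv[of x k]
  by (simp_all add: zm_def)

lemma zm_diff: "zm (i - j) x = zm i x - zm j x"
  using zm_add[of i "- j" x] by (simp add: zm_minus)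

lemma zm_commute: "zm i x + zm j x = zm j x + zm i x"
  by (metis add.commute zm_add)

lemma zm_of_nat: "zm (int n) x = sum_list (replicate n x)"
  by (induction n) (simp_all add: zm_add)

lemma zm_in: "subgrp H \<Longrightarrow> x \<in> H \<Longrightarrow> zm k x \<in> H"
  using additive.int_pow_closed subgroup.subset
  by (metis (no_types, lifting) abs_of_nonneg int_cases2 subgrp_minus zm_minus zm_of_nat
      subgrp_sum_list
      set_replicate_conv_if empty_subsetI insert_subset)

lemma zm_hom:
  assumes "\<And>x y. x \<in> H \<Longrightarrow> y \<in> H \<Longrightarrow> f (x + y) = f x + f y" "subgrp H" "x \<in> H"
  shows "f (zm k x) = zm k (f x)"
proof -
  have 0: "f 0 = 0" using assms(1)[of 0 0] subgrp_0[OF assms(2)]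
    by (metis add_0_right add_left_cancel)
  have n: "f (zm (int n) x) = zm (int n) (f x)" for n
    by (induction n) (simp_all add: zm_add 0 assms zm_in)
  have m: "f (- y) = - f y" if "y \<in> H" for y
    using assms(1)[of "- y" y] that subgrp_minus[OF assms(2)] 0 by (simp add: eq_neg_iff_add_eq_0)
  show ?thesis
    by (cases k rule: int_cases2) (simp_all add: n m zm_minus zm_in assms)
qed

lemma zm_conj: "- y + zm k x + y = zm k (- y + x + y)"
  using zm_hom[of UNIV "\<lambda>x. - y + x + y" x k] by (simp add: subgrp_iff add.assoc)

lemma zm_cong:
  assumes "zm p x = 0" "[i = j] (mod p)"
  shows "zm i x = zm j x"
proof -
  obtain k where "i = j + p * k" using assms(2) by (metis cong_iff_lin cong_sym)
  then show ?thesis using assms(1) by (simp add: zm_add zm_mult)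
qed

lemma zm_inverse:
  assumes "prime p" "\<not> int p dvd k" "zm (int p) x = 0"
  obtains l where "zm l (zm k x) = x"
proof -
  have "coprime k (int p)"
    using assms by (metis coprime_commute prime_imp_coprime prime_int_nat_transfer nat_int of_nat_0_le_iff)
  then obtain l where "[k * l = 1] (mod int p)" using cong_solve_coprime_int by blast
  from zm_cong[OF assms(3) this] show ?thesis by (intro that[of l]) (simp add: zm_mult)
qed

section \<open>Commutators, derived subgroups and normality\<close>

definition cm :: "'a::group_add \<Rightarrow> 'a \<Rightarrow> 'a" where
  "cm x y = x + y - x - y"

lemma cm_zero [simp]: "cm 0 x = 0" "cm x 0 = 0" and cm_self [simp]: "cm x x = 0"
  by (simp_all add: cm_def)

lemma minus_cm: "- cm x y = cm y x"
  by (simp only: cm_def group_cancel_simps)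

lemma cm_zm_zm [simp]: "cm (zm i x) (zm j x) = 0"
  unfolding cm_def zm_commute[of i x j] by (simp only: group_cancel_simps)

lemma cm_in: "subgrp H \<Longrightarrow> x \<in> H \<Longrightarrow> y \<in> H \<Longrightarrow> cm x y \<in> H"
  by (simp add: cm_def subgrp_closed)

abbreviation der :: "'a::group_add set \<Rightarrow> 'a set" where
  "der \<equiv> derived additive"

lemma subgrp_der: "subgrp (der H)"
  by (simp add: additive.derived_is_subgroup)

lemma cm_in_der: "x \<in> H \<Longrightarrow> y \<in> H \<Longrightarrow> cm x y \<in> der H"
  unfolding derived_def by (rule generate.incl) (auto simp: cm_def simp del: add_uminus_conv_diff simp: diff_conv_add_uminus)

lemma der_subsetI:
  assumes "subgrp K" "\<And>x y. x \<in> H \<Longrightarrow> y \<in> H \<Longrightarrow> cm x y \<in> K"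
  shows "der H \<subseteq> K"
  unfolding derived_def using assms
  by (intro additive.generate_subgroup_incl) (auto simp: cm_def simp del: add_uminus_conv_diff
      simp: diff_conv_add_uminus)

lemma der_mono: "H \<subseteq> K \<Longrightarrow> der H \<subseteq> der K"
  by (intro der_subsetI subgrp_der cm_in_der) auto

lemma der_subset: "subgrp H \<Longrightarrow> der H \<subseteq> H"
  by (intro der_subsetI cm_in)

definition normalized :: "'a::group_add set \<Rightarrow> 'a set \<Rightarrow> bool" where
  "normalized G N \<longleftrightarrow> subgrp N \<and> (\<forall>g\<in>G. \<forall>x\<in>N. - g + x + g \<in> N)"

lemma normalizedD: "normalized G N \<Longrightarrow> subgrp N" "normalized G N \<Longrightarrow> g \<in> G \<Longrightarrow> x \<in> N \<Longrightarrow> - g + x + g \<in> N"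
  by (simp_all add: normalized_def)

lemma normalized_conj': "normalized G N \<Longrightarrow> subgrp G \<Longrightarrow> g \<in> G \<Longrightarrow> x \<in> N \<Longrightarrow> g + x - g \<in> N"
  using normalizedD(2)[of G N "- g" x] by (simp add: subgrp_closed)

lemma normalized_cm:
  assumes "normalized G N" "subgrp G" "g \<in> G" "x \<in> N"
  shows "cm g x \<in> N" "cm x g \<in> N"
proof -
  show 1: "cm g x \<in> N"
    unfolding cm_def using normalized_conj'[OF assms] subgrp_diff[OF normalizedD(1)[OF assms(1)]] assms(4) by blast
  then show "cm x g \<in> N" using subgrp_minus[OF normalizedD(1)[OF assms(1)] 1]
    by (simp add: minus_cm)
qed

lemma normalized_der:
  assumes "normalized G N" "subgrp G"
  shows "normalized G (der N)"
  unfolding normalized_def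
proof (intro conjI ballI subgrp_der)
  fix g x assume g: "g \<in> G" and x: "x \<in> der N"
  have "der N \<subseteq> {x. - g + x + g \<in> der N}"
  proof (rule der_subsetI)
    show "subgrp {x. - g + x + g \<in> der N}"
    proof (rule subgrpI)
      fix x y assume "x \<in> {x. - g + x + g \<in> der N}" "y \<in> {x. - g + x + g \<in> der N}"
      then have "(- g + x + g) - (- g + y + g) \<in> der N" by (simp add: subgrp_diff[OF subgrp_der])
      then show "x - y \<in> {x. - g + x + g \<in> der N}"
        by (simp only: mem_Collect_eq group_cancel_simps)
    qed (simp add: subgrp_0 subgrp_der)
    fix x y assume "x \<in> N" "y \<in> N"
    then have "cm (- g + x + g) (- g + y + g) \<in> der N"
      using assms g by (intro cm_in_der normalizedD(2)) auto
    then show "cm x y \<in> {x. - g + x + g \<in> der N}"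
      by (simp only: mem_Collect_eq cm_def group_cancel_simps)
  qed
  with x show "- g + x + g \<in> der N" by blast
qed

text \<open>Quotient groups are avoided: this set stands for the centralizer of \<open>y\<close>
  modulo \<open>N\<close>. It is closed because [u - v, y] is the conjugate of [y, v] by u - v, plus
  [u, y].\<close>

lemma subgrp_centralizer:
  assumes N: "normalized G N" and G: "subgrp G"
  shows "subgrp {x \<in> G. cm x y \<in> N}"
proof (rule subgrpI)
  fix u v assume "u \<in> {x \<in> G. cm x y \<in> N}" "v \<in> {x \<in> G. cm x y \<in> N}"
  then have u: "u \<in> G" "cm u y \<in> N" and v: "v \<in> G" "cm v y \<in> N" by auto
  note s = normalizedD(1)[OF N]
  have "(u - v) + cm y v - (u - v) + cm u y \<in> N"
    using u v by (intro subgrp_add[OF s] normalized_conj'[OF N G] subgrp_diff[OF G])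
      (auto simp: minus_cm[of v y, symmetric] subgrp_minus[OF s])
  also have "(u - v) + cm y v - (u - v) + cm u y = cm (u - v) y"
    by (simp only: cm_def group_cancel_simps)
  finally show "u - v \<in> {x \<in> G. cm x y \<in> N}" using u v G by (simp add: subgrp_diff)
qed (simp add: subgrp_0 G normalizedD(1)[OF N])

lemma cm_swap_in: "subgrp N \<Longrightarrow> cm x y \<in> N \<longleftrightarrow> cm y x \<in> N"
  by (metis minus_cm subgrp_minus)

abbreviation gen :: "'a::group_add set \<Rightarrow> 'a set" where
  "gen \<equiv> generate additive"

lemma gen_subset: "subgrp H \<Longrightarrow> X \<subseteq> H \<Longrightarrow> gen X \<subseteq> H"
  by (simp add: additive.generate_subgroup_incl)

lemma subgrp_gen: "subgrp (gen X)"
  by (simp add: additive.generate_is_subgroup)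

lemma commute_mod_gen:
  assumes N: "normalized (gen X) N" and "y \<in> gen X" and X: "\<And>x. x \<in> X \<Longrightarrow> cm x y \<in> N"
    and g: "g \<in> gen X"
  shows "cm g y \<in> N"
proof -
  have "gen X \<subseteq> {x \<in> gen X. cm x y \<in> N}"
    by (rule gen_subset[OF subgrp_centralizer[OF N subgrp_gen]]) (auto intro: X generate.incl)
  with g show ?thesis by blast
qed

text \<open>\<open>commute_mod_gen\<close> passes from generators to arbitrary elements in one
  argument of the commutator at a time.\<close>

lemma der_gen_subset:
  assumes N: "normalized (gen X) N" and X: "\<And>x y. x \<in> X \<Longrightarrow> y \<in> X \<Longrightarrow> cm x y \<in> N"
  shows "der (gen X) \<subseteq> N"
proof (rule der_subsetI[OF normalizedD(1)[OF N]])
  fix g h assume g: "g \<in> gen X" and h: "h \<in> gen X"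
  have "cm x h \<in> N" if "x \<in> X" for x
    using commute_mod_gen[OF N _ _ h, of x] X that cm_swap_in[OF normalizedD(1)[OF N]]
    by (metis generate.incl)
  then show "cm g h \<in> N" by (rule commute_mod_gen[OF N h _ g])
qed

text \<open>The value is 0 if the index is infinite.\<close>

definition index :: "'a::group_add set \<Rightarrow> 'a set \<Rightarrow> nat" where
  "index H K = card ((\<lambda>h. (\<lambda>k. k + h) ` K) ` H)"

lemma coset_eq_iff:
  fixes x y :: "'a::group_add"
  assumes K: "subgrp K"
  shows "(\<lambda>k. k + x) ` K = (\<lambda>k. k + y) ` K \<longleftrightarrow> x - y \<in> K"
proof
  assume e: "(\<lambda>k. k + x) ` K = (\<lambda>k. k + y) ` K"
  have "0 + x \<in> (\<lambda>k. k + x) ` K" using subgrp_0[OF K] by blast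
  then obtain k where "k \<in> K" "x = k + y" unfolding e by auto
  then show "x - y \<in> K" by simp
next
  have *: "(\<lambda>k. k + x) ` K \<subseteq> (\<lambda>k. k + y) ` K" if "x - y \<in> K" for x y :: 'a
  proof
    fix z assume "z \<in> (\<lambda>k. k + x) ` K"
    then obtain k where "k \<in> K" "z = k + x" by auto
    then show "z \<in> (\<lambda>k. k + y) ` K"
      using subgrp_add[OF K _ that, of k] by (intro image_eqI[of _ _
          "k + (x - y)"]) (simp_all add: add.assoc)
  qed
  assume "x - y \<in> K"
  moreover from this have "y - x \<in> K" using subgrp_minus[OF K] by force
  ultimately show "(\<lambda>k. k + x) ` K = (\<lambda>k. k + y) ` K" using * by blast
qed

lemma card_image_eq_if:
  assumes "\<And>x y. x \<in> A \<Longrightarrow> y \<in> A \<Longrightarrow> f x = f y \<longleftrightarrow> g x = g y"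
  shows "card (f ` A) = card (g ` A)"
proof (rule bij_betw_same_card)
  have *: "inv_into A f (f x) \<in> A" "f (inv_into A f (f x)) = f x" if "x \<in> A" for x
    using that by (auto intro: inv_into_into f_inv_into_f)
  then have "g (inv_into A f (f x)) = g x" if "x \<in> A" for x using that assms by blast
  then show "bij_betw (\<lambda>y. g (inv_into A f y)) (f ` A) (g ` A)"
    using assms by (auto simp: bij_betw_def inj_on_def image_image)
qed

text \<open>The tool for most of the index computations: find an invariant \<open>f\<close> whose
  fibres are the cosets, then count its values.\<close>

lemma index_eq_card:
  assumes "subgrp K" "\<And>x y. x \<in> H \<Longrightarrow> y \<in> H \<Longrightarrow> f x = f y \<longleftrightarrow> x - y \<in> K"
  shows "index H K = card (f ` H)"
  unfolding index_def by (rule card_image_eq_if) (simp add: assms coset_eq_iff)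

lemma index_image:
  assumes "subgrp H" "subgrp K" "K \<subseteq> H"
    and f: "\<And>x y. x \<in> H \<Longrightarrow> y \<in> H \<Longrightarrow> f (x + y) = f x + f y"
    and k: "\<And>x. x \<in> H \<Longrightarrow> f x = 0 \<Longrightarrow> x \<in> K"
  shows "index (f ` H) (f ` K) = index H K"
proof -
  have d: "f (x - y) = f x - f y" if "x \<in> H" "y \<in> H" for x y
    using f[of "x - y" y] that assms(1) by (simp add: subgrp_diff eq_diff_eq)
  have fK: "subgrp (f ` K)"
  proof (rule subgrpI)
    show "0 \<in> f ` K" using d[of 0 0] subgrp_0[OF assms(1)] subgrp_0[OF assms(2)] by force
  next
    fix x y assume "x \<in> f ` K" "y \<in> f ` K"
    then obtain u v where "x = f u" "y = f v" "u \<in> K" "v \<in> K" by blast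
    then show "x - y \<in> f ` K"
      using d[of u v] assms(3) subgrp_diff[OF assms(2), of u v] by (metis imageI subsetD)
  qed
  have "f x - f y \<in> f ` K \<longleftrightarrow> x - y \<in> K" if xy: "x \<in> H" "y \<in> H" for x y
  proof
    assume "f x - f y \<in> f ` K"
    then obtain z where z: "z \<in> K" "f (x - y) = f z" using d xy by auto
    then have "f ((x - y) - z) = 0"
      using d[of "x - y" z] xy assms(1,3) by (auto simp: subgrp_diff)
    then have "(x - y) - z \<in> K" using k[of "(x - y) - z"] xy z assms(1,3)
      by (auto simp: subgrp_diff)
    then show "x - y \<in> K" using subgrp_add[OF assms(2) _ z(1)] by force
  qed (use d xy in \<open>auto simp flip: d\<close>)
  then have "index H K = card ((\<lambda>x. (\<lambda>k. k + f x) ` f ` K) ` H)"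
    using assms(2) by (intro index_eq_card) (simp_all add: coset_eq_iff[OF fK])
  then show ?thesis by (simp add: index_def image_image)
qed

lemma index_mult:
  assumes G: "subgrp G" and H: "subgrp H" and K: "subgrp K" and "K \<subseteq> H" "H \<subseteq> G"
  shows "index G K = index G H * index H K"
proof -
  let ?c = "\<lambda>K (h::'a). (\<lambda>k. k + h) ` K"
  \<comment> \<open>\<open>r\<close> chooses a representative of each coset of \<open>H\<close>; an
    element is then encoded by its coset of \<open>H\<close> and the coset of \<open>K\<close>
    containing its remainder.\<close>
  define r where "r C = (SOME x. x \<in> G \<and> ?c H x = C)" for C
  have r: "r (?c H x) \<in> G" "x - r (?c H x) \<in> H" if "x \<in> G" for x
  proof -
    have "r (?c H x) \<in> G \<and> ?c H (r (?c H x)) = ?c H x"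
      unfolding r_def by (rule someI[of _ x]) (use that in simp)
    then show "r (?c H x) \<in> G" "x - r (?c H x) \<in> H" using coset_eq_iff[OF H] by metis+
  qed
  let ?f = "\<lambda>x. (?c H x, ?c K (x - r (?c H x)))"
  have "?f x = ?f y \<longleftrightarrow> x - y \<in> K" if "x \<in> G" "y \<in> G" for x y
  proof
    assume e: "?f x = ?f y"
    define t where "t = r (?c H x)"
    have "t = r (?c H y)" using e by (simp add: t_def)
    moreover have "?c K (x - r (?c H x)) = ?c K (y - r (?c H y))" using e unfolding prod.inject
      by (elim conjE)
    ultimately have "?c K (x - t) = ?c K (y - t)" unfolding t_def by simp
    then have "(x - t) - (y - t) \<in> K" by (simp only: coset_eq_iff[OF K])
    then show "x - y \<in> K" by (simp only: group_cancel_simps)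
  next
    assume k: "x - y \<in> K"
    then have e: "?c H x = ?c H y" using assms coset_eq_iff[OF H] by blast
    have "(x - r (?c H y)) - (y - r (?c H y)) \<in> K"
      using k by (simp only: group_cancel_simps)
    then show "?f x = ?f y" by (simp only: e prod.inject simp_thms coset_eq_iff[OF K])
  qed
  then have "index G K = card (?f ` G)" by (rule index_eq_card[OF K])
  also have "?f ` G = (?c H ` G) \<times> (?c K ` H)"
  proof
    show "?f ` G \<subseteq> (?c H ` G) \<times> (?c K ` H)" using r by auto
    show "(?c H ` G) \<times> (?c K ` H) \<subseteq> ?f ` G"
    proof (clarify)
      fix x h assume x: "x \<in> G" and h: "h \<in> H"
      define t where "t = r (?c H x)"
      have t: "t \<in> G" "x - t \<in> H" using r[OF x] by (auto simp: t_def)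
      have "h + t \<in> G" using h t assms by (auto simp: subgrp_add)
      moreover have "?c H (h + t) = ?c H x"
      proof -
        have "h - (x - t) \<in> H" by (rule subgrp_diff[OF H h t(2)])
        then have "(h + t) - x \<in> H" by (simp only: group_cancel_simps)
        then show ?thesis using coset_eq_iff[OF H] by blast
      qed
      ultimately show "(?c H x, ?c K h) \<in> ?f ` G"
        by (intro image_eqI[of _ _ "h + t"]) (simp_all add: t_def)
    qed
  qed
  finally show ?thesis by (simp add: card_cartesian_product index_def)
qed

section \<open>Cyclic codes over the prime field\<close>

text \<open>A word of length p over the prime field is an integer function on all integers, periodic
  up to congruence, so that shifts need no reduction of indices.\<close>

definition periodic :: "nat \<Rightarrow> (int \<Rightarrow> int) \<Rightarrow> bool" where
  "periodic p w \<longleftrightarrow> (\<forall>i. [w (i + int p) = w i] (mod int p))"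

lemma periodicD: "periodic p w \<Longrightarrow> [w (i + int p) = w i] (mod int p)"
  by (simp add: periodic_def)

lemma periodic_shift: "periodic p w \<Longrightarrow> periodic p (\<lambda>i. w (i + k))"
  unfolding periodic_def by (metis add.assoc add.commute)

lemma periodic_id: "periodic p (\<lambda>i. i)"
  and periodic_const: "periodic p (\<lambda>i. c)"
  and periodic_add: "periodic p v \<Longrightarrow> periodic p w \<Longrightarrow> periodic p (\<lambda>i. v i + w i)"
  and periodic_diff: "periodic p v \<Longrightarrow> periodic p w \<Longrightarrow> periodic p (\<lambda>i. v i - w i)"
  and periodic_mult: "periodic p v \<Longrightarrow> periodic p w \<Longrightarrow> periodic p (\<lambda>i. v i * w i)"
  by (auto simp: periodic_def cong_add cong_diff cong_mult) (simp add: cong_def)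

lemmas periodic_intros = periodic_id periodic_const periodic_add periodic_diff periodic_mult

lemma periodic_power: "periodic p w \<Longrightarrow> periodic p (\<lambda>i. w i ^ n)"
  by (auto simp: periodic_def cong_pow)

lemma periodic_mod:
  assumes "periodic p w"
  shows "[w (i mod int p) = w i] (mod int p)"
proof -
  have "[w (j + int p * k) = w j] (mod int p)" for j k
  proof (induction k rule: int_induct[of _ 0])
    case (step1 k)
    then show ?case using periodicD[OF assms, of "j + int p * k"]
      by (simp add: algebra_simps) (metis cong_trans)
  next
    case (step2 k)
    then show ?case using periodicD[OF assms, of "j + int p * (k - 1)"]
      by (simp add: algebra_simps) (metis cong_trans cong_sym)
  qed simp
  from cong_sym[OF this[of "i mod int p" "i div int p"]] show ?thesis by (simp add: add.commute)
qed

lemma sum_cyclic_shift: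
  assumes "periodic p f" "p > 0"
  shows "[(\<Sum>i\<in>{0..<int p}. f (i + k)) = (\<Sum>i\<in>{0..<int p}. f i)] (mod int p)"
proof -
  have 1: "[(\<Sum>i\<in>{0..<int p}. f (i + 1)) = (\<Sum>i\<in>{0..<int p}. f i)] (mod int p)"
    if f: "periodic p f" for f :: "int \<Rightarrow> int"
  proof -
    have "(\<Sum>i\<in>{0..<int p}. f (i + 1)) = (\<Sum>i\<in>{1..<int p + 1}. f i)"
      by (rule sum.reindex_bij_witness[of _ "\<lambda>i. i - 1" "\<lambda>i. i + 1"]) auto
    also have "{1..<int p + 1} = insert (int p) ({0..<int p} - {0})" using assms by auto
    also have "sum f \<dots> = f (int p) + ((\<Sum>i\<in>{0..<int p}. f i) - f 0)"
      using assms by (subst sum.insert) (auto simp: sum_diff1)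
    also have "[\<dots> = f 0 + ((\<Sum>i\<in>{0..<int p}. f i) - f 0)] (mod int p)"
      using periodicD[OF f, of 0] by (intro cong_add cong_refl) simp
    finally show ?thesis by simp
  qed
  show ?thesis
  proof (induction k rule: int_induct[of _ 0])
    case (step1 k)
    then show ?case using 1[OF periodic_shift[OF assms(1), of k]]
      by (simp add: algebra_simps) (metis cong_trans)
  next
    case (step2 k)
    have "[(\<Sum>i\<in>{0..<int p}. f (i + (k - 1))) = (\<Sum>i\<in>{0..<int p}. f (i + k))] (mod int p)"
      using cong_sym[OF 1[OF periodic_shift[OF assms(1), of "k - 1"]]] by (simp add: algebra_simps)
    then show ?case using step2(2) by (rule cong_trans)
  qed simp
qed

text \<open>For s <= p, the moments 0, ..., s - 1 of \<open>w\<close> vanish modulo p iff the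
  polynomial with coefficients \<open>w\<close> is divisible by (x - 1)^s.\<close>

definition moment :: "nat \<Rightarrow> nat \<Rightarrow> (int \<Rightarrow> int) \<Rightarrow> int" where
  "moment p s w = (\<Sum>i\<in>{0..<int p}. i ^ s * w i)"

lemma moment_cong:
  "(\<And>i. [v i = w i] (mod int p)) \<Longrightarrow> [moment p s v = moment p s w] (mod int p)"
  unfolding moment_def by (intro cong_sum cong_mult cong_refl)

lemma moment_lin: "moment p s (\<lambda>i. x * v i + y * w i) = x * moment p s v + y * moment p s w"
  by (simp add: moment_def sum.distrib sum_distrib_left algebra_simps)

text \<open>On words this is multiplication by x^(-1) - 1, which is x - 1 up to a unit.\<close>

definition fdiff :: "(int \<Rightarrow> int) \<Rightarrow> int \<Rightarrow> int" where
  "fdiff w i = w (i + 1) - w i"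

lemma fdiff_pow_cong:
  assumes "\<And>i. [v i = w i] (mod m)"
  shows "[(fdiff ^^ n) v i = (fdiff ^^ n) w i] (mod m)"
  using assms by (induction n arbitrary: i) (auto simp: fdiff_def intro!: cong_diff)

lemma fdiff_pow_lin: "(fdiff ^^ n) (\<lambda>i. x * v i + y * w i) i = x * (fdiff ^^ n) v i + y * (fdiff ^^ n) w i"
  by (induction n arbitrary: i) (auto simp: fdiff_def algebra_simps)

lemma fdiff_newton: "w (i + int n) = (\<Sum>j\<le>n. int (n choose j) * (fdiff ^^ j) w i)"
proof (induction n arbitrary: i)
  case (Suc n)
  have "w (i + int (Suc n)) = w ((i + 1) + int n)" by (simp add: algebra_simps)
  also have "\<dots> = (\<Sum>j\<le>n. int (n choose j) * (fdiff ^^ j) w (i + 1))" by (rule Suc)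
  also have "\<dots> = (\<Sum>j\<le>n. int (n choose j) * (fdiff ^^ j) w i)
      + (\<Sum>j\<le>n. int (n choose j) * (fdiff ^^ Suc j) w i)"
    by (simp add: fdiff_def algebra_simps flip: sum.distrib)
  also have "(\<Sum>j\<le>n. int (n choose j) * (fdiff ^^ j) w i)
      = (\<Sum>j\<le>Suc n. int (n choose j) * (fdiff ^^ j) w i)" by simp
  also have "\<dots> = w i + (\<Sum>j\<le>n. int (n choose Suc j) * (fdiff ^^ Suc j) w i)"
    by (subst sum.atMost_Suc_shift) simp
  also have "w i + (\<Sum>j\<le>n. int (n choose Suc j) * (fdiff ^^ Suc j) w i)
      + (\<Sum>j\<le>n. int (n choose j) * (fdiff ^^ Suc j) w i)
      = w i + (\<Sum>j\<le>n. int (Suc n choose Suc j) * (fdiff ^^ Suc j) w i)"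
    by (simp add: algebra_simps del: funpow.simps flip: sum.distrib)
  also have "\<dots> = (\<Sum>j\<le>Suc n. int (Suc n choose j) * (fdiff ^^ j) w i)"
    unfolding sum.atMost_Suc_shift[of _ n] by simp
  finally show ?case .
qed simp

text \<open>In characteristic p, (y - 1)^p = y^p - 1, and the shift by p is trivial: the inner
  binomial coefficients in Newton's formula are divisible by p.\<close>

lemma fdiff_pow_prime:
  assumes p: "prime p" and w: "periodic p w"
  shows "[(fdiff ^^ p) w i = 0] (mod int p)"
proof -
  obtain q where q: "p = Suc q" "q > 0" using prime_gt_1_nat[OF p] by (cases p) auto
  let ?f = "\<lambda>j. int (p choose j) * (fdiff ^^ j) w i"
  have "int p dvd ?f (Suc j)" if "j < q" for j
  proof (rule dvd_mult2)
    have "p dvd (p choose Suc j)" using that q p by (intro dvd_choose_prime) auto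
    then show "int p dvd int (p choose Suc j)" by (simp only: int_dvd_int_iff)
  qed
  then have "int p dvd (\<Sum>j<q. ?f (Suc j))" by (intro dvd_sum) auto
  moreover have "w (i + int p) = (\<Sum>j\<le>Suc q. ?f j)" unfolding fdiff_newton[of w i p] using q by simp
  then have "w (i + int p) = w i + (\<Sum>j<q. ?f (Suc j)) + (fdiff ^^ p) w i"
    using q by (subst (asm) sum.atMost_Suc_shift, subst (asm) lessThan_Suc_atMost[symmetric])
      (simp del: funpow.simps binomial_Suc_Suc add: funpow_0)
  ultimately have "[(fdiff ^^ p) w i = w (i + int p) - w i] (mod int p)"
    by (simp add: cong_iff_dvd_diff)
  moreover have "[w (i + int p) - w i = 0] (mod int p)"
    using periodicD[OF w, of i] by (simp add: cong_diff_iff_cong_0)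
  ultimately show ?thesis by (rule cong_trans)
qed

text \<open>Partial sums over one period give a primitive. The only doubtful place is the jump from
  p - 1 back to 0, where the total sum has to vanish.\<close>

lemma fdiff_surj:
  assumes w: "periodic p w" and 0: "[moment p 0 w = 0] (mod int p)" and p: "p > 0"
  obtains u where "periodic p u" "\<And>i. [fdiff u i = w i] (mod int p)"
proof
  define u where "u i = (\<Sum>j\<in>{0..<i mod int p}. w j)" for i
  show "periodic p u" by (simp add: periodic_def u_def)
  show "[fdiff u i = w i] (mod int p)" for i
  proof (cases "i mod int p + 1 < int p")
    case True
    then have "(i + 1) mod int p = i mod int p + 1"
      using p by (metis mod_add_left_eq mod_pos_pos_trivial pos_mod_sign add_nonneg_nonneg
          of_nat_0_less_iff zero_le_one)
    moreover have "{0..<i mod int p + 1} = insert (i mod int p) {0..<i mod int p}"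
      using p by auto
    ultimately have "fdiff u i = w (i mod int p)" by (simp add: fdiff_def u_def)
    then show ?thesis using periodic_mod[OF w] by simp
  next
    case False
    then have i: "i mod int p = int p - 1" using p pos_mod_bound[of "int p" i] by linarith
    then have "(i + 1) mod int p = 0"
      by (metis diff_add_cancel mod_add_left_eq mod_self)
    moreover have "(\<Sum>j\<in>{0..<int p}. w j) = w (int p - 1) + (\<Sum>j\<in>{0..<int p - 1}. w j)"
    proof -
      have "{0..<int p} = insert (int p - 1) {0..<int p - 1}" using p by auto
      then show ?thesis by simp
    qed
    ultimately have "fdiff u i = w (int p - 1) - moment p 0 w"
      by (simp add: fdiff_def u_def i moment_def)
    moreover have "[w (int p - 1) = w i] (mod int p)" using periodic_mod[OF w, of i] i by simp
    ultimately show ?thesis using cong_diff[OF _ 0, of "w (int p - 1)" "w i"] by simp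
  qed
qed

text \<open>Summation by parts: the cyclic sum of i^s (u(i + 1) - u(i)) is that of ((i - 1)^s - i^s)
  u(i), which involves lower moments only.\<close>

lemma moment_fdiff:
  assumes u: "periodic p u" and p: "p > 0"
  shows "[moment p 0 (fdiff u) = 0] (mod int p)"
    and "[moment p 1 (fdiff u) = - moment p 0 u] (mod int p)"
    and "[moment p 2 (fdiff u) = moment p 0 u - 2 * moment p 1 u] (mod int p)"
proof -
  have *: "[moment p s (fdiff u) = (\<Sum>i\<in>{0..<int p}. ((i - 1) ^ s - i ^ s) * u i)] (mod int p)" for s
  proof -
    have "[(\<Sum>i\<in>{0..<int p}. (i + 1 - 1) ^ s * u (i + 1)) = (\<Sum>i\<in>{0..<int p}. (i - 1) ^ s
        * u i)] (mod int p)"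
      by (rule sum_cyclic_shift[of p "\<lambda>i. (i - 1) ^ s * u i"])
        (intro periodic_mult u periodic_power periodic_diff periodic_id periodic_const p)+
    then have "[moment p s (fdiff u) = (\<Sum>i\<in>{0..<int p}. (i - 1) ^ s * u i)
        - (\<Sum>i\<in>{0..<int p}. i ^ s * u i)] (mod int p)"
      by (simp add: moment_def fdiff_def right_diff_distrib sum_subtractf cong_diff)
    then show ?thesis by (simp add: left_diff_distrib sum_subtractf)
  qed
  show "[moment p 0 (fdiff u) = 0] (mod int p)" using *[of 0] by simp
  show "[moment p 1 (fdiff u) = - moment p 0 u] (mod int p)"
    using *[of 1] by (simp add: moment_def sum_negf)
  have "(\<Sum>i\<in>{0..<int p}. ((i - 1) ^ 2 - i ^ 2) * u i) = moment p 0 u - 2 * moment p 1 u"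
    by (simp add: moment_def power2_eq_square sum_distrib_left algebra_simps flip: sum.distrib
        sum_subtractf)
  then show "[moment p 2 (fdiff u) = moment p 0 u - 2 * moment p 1 u] (mod int p)" using *[of 2]
    by simp
qed

text \<open>Entries are integers, so it is the last clause that makes \<open>V\<close> a subspace
  over the prime field; closure under the shift makes it an ideal.\<close>

definition cyclic_code :: "nat \<Rightarrow> (int \<Rightarrow> int) set \<Rightarrow> bool" where
  "cyclic_code p V \<longleftrightarrow> (\<lambda>i. 0) \<in> V \<and>
     (\<forall>v\<in>V. \<forall>w\<in>V. \<forall>x y. (\<lambda>i. x * v i + y * w i) \<in> V) \<and>
     (\<forall>v\<in>V. (\<lambda>i. v (i + 1)) \<in> V) \<and>
     (\<forall>v\<in>V. \<forall>w. (\<forall>i. [v i = w i] (mod int p)) \<longrightarrow> w \<in> V)"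

lemma cyclic_code_lin: "cyclic_code p V \<Longrightarrow> v \<in> V \<Longrightarrow> w \<in> V \<Longrightarrow> (\<lambda>i. x * v i + y * w i) \<in> V"
  and cyclic_code_shift: "cyclic_code p V \<Longrightarrow> v \<in> V \<Longrightarrow> (\<lambda>i. v (i + 1)) \<in> V"
  and cyclic_code_cong: "cyclic_code p V \<Longrightarrow> v \<in> V \<Longrightarrow> (\<And>i. [v i = w i] (mod int p)) \<Longrightarrow> w \<in> V"
  and cyclic_code_zero: "cyclic_code p V \<Longrightarrow> (\<lambda>i. 0) \<in> V"
  unfolding cyclic_code_def by blast+

lemma cyclic_code_fdiff: "cyclic_code p V \<Longrightarrow> v \<in> V \<Longrightarrow> fdiff v \<in> V"
  using cyclic_code_lin[of p V "\<lambda>i. v (i + 1)" v 1 "-1"] cyclic_code_shift[of p V v]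
  by (simp add: fdiff_def[abs_def])

lemma cyclic_code_fdiff_pow: "cyclic_code p V \<Longrightarrow> v \<in> V \<Longrightarrow> (fdiff ^^ n) v \<in> V"
  by (induction n) (auto simp: cyclic_code_fdiff)

text \<open>The ideal quotient of \<open>V\<close> by x - 1; passing to it lowers the order of
  vanishing by one.\<close>

lemma cyclic_code_vimage_fdiff:
  assumes V: "cyclic_code p V"
  shows "cyclic_code p {u. fdiff u \<in> V}"
  unfolding cyclic_code_def mem_Collect_eq
proof (intro conjI ballI allI impI)
  show "fdiff (\<lambda>i. 0) \<in> V" using cyclic_code_zero[OF V] by (simp add: fdiff_def[abs_def])
  fix v w x y assume v: "v \<in> {u. fdiff u \<in> V}"
  show "fdiff (\<lambda>i. x * v i + y * w i) \<in> V" if w: "w \<in> {u. fdiff u \<in> V}"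
    using cyclic_code_lin[OF V, of "fdiff v" "fdiff w" x y] v w
    by (simp add: fdiff_def[abs_def] algebra_simps)
  show "fdiff (\<lambda>i. v (i + 1)) \<in> V"
    using cyclic_code_shift[OF V, of "fdiff v"] v by (simp add: fdiff_def[abs_def] algebra_simps)
  show "fdiff w \<in> V" if "\<forall>i. [v i = w i] (mod int p)"
    by (rule cyclic_code_cong[OF V, of "fdiff v"]) (use v that in \<open>auto simp: fdiff_def intro!: cong_diff\<close>)
qed

lemma cong_solve:
  assumes "prime p" "\<not> [s = 0] (mod int p)"
  obtains x where "[x * s = t] (mod int p)"
proof -
  have "coprime s (int p)"
    using assms by (metis cong_0_iff coprime_commute prime_imp_coprime prime_int_nat_transfer nat_int of_nat_0_le_iff)
  then obtain x where "[s * x = 1] (mod int p)" using cong_solve_coprime_int by blast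
  from cong_mult[OF this cong_refl[of t]] show ?thesis by (intro that[of
      "x * t"]) (simp add: algebra_simps)
qed

text \<open>Codes are ideals of \<open>\<bbbF>\<^sub>p[x]/(x - 1)\<^sup>p\<close>, hence they are determined by the
  order of vanishing at 1.\<close>

lemma cyclic_code_full:
  assumes p: "prime p" and V: "cyclic_code p V" and v: "v \<in> V" "periodic p v"
    and v0: "\<not> [moment p 0 v = 0] (mod int p)" and w: "periodic p w"
  shows "w \<in> V"
proof -
  have p0: "p > 0" using p prime_gt_0_nat by blast
  \<comment> \<open>For n = 0 this is nilpotency of \<open>fdiff\<close>, for n = p it is the claim.
    In the step, subtracting a multiple of \<open>v\<close> makes the sum of \<open>w\<close> zero,
    and a primitive of the result is handled by induction.\<close>
  have "(fdiff ^^ (p - n)) w \<in> V" if "n \<le> p" "periodic p w" for n :: nat and w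
    using that
  proof (induction n arbitrary: w)
    case 0
    then show ?case
      using cyclic_code_cong[OF V cyclic_code_zero[OF V]] fdiff_pow_prime[OF p]
      by (simp add: cong_sym)
  next
    case (Suc n)
    obtain x where x: "[x * moment p 0 v = moment p 0 w] (mod int p)"
      using cong_solve[OF p v0] by blast
    let ?d = "\<lambda>i. 1 * w i + (- x) * v i"
    have "periodic p ?d" by (intro periodic_intros Suc v)
    moreover have "[moment p 0 ?d = 0] (mod int p)"
      using x unfolding moment_lin by (simp add: cong_diff_iff_cong_0 cong_sym)
    ultimately obtain u where u: "periodic p u" "\<And>i. [fdiff u i = ?d i] (mod int p)"
      using fdiff_surj p0 by blast
    have e: "p - n = Suc (p - Suc n)" using Suc by simp
    have "(fdiff ^^ (p - Suc n)) (fdiff u) \<in> V"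
      using Suc.IH[OF _ u(1)] Suc.prems(1) unfolding e funpow_Suc_right by simp
    then have "(fdiff ^^ (p - Suc n)) ?d \<in> V"
      by (rule cyclic_code_cong[OF V]) (rule fdiff_pow_cong[OF u(2)])
    from cyclic_code_lin[OF V this cyclic_code_fdiff_pow[OF V v(1), of "p - Suc n"], of 1 x]
    show ?case using fdiff_pow_lin[of "p - Suc n" 1 w "- x" v] by simp
  qed
  from this[of p w] w show ?thesis by simp
qed

text \<open>A primitive of \<open>v\<close> has sum - \<open>moment p 1 v\<close>, which is nonzero,
  so \<open>cyclic_code_full\<close> applies to primitives and the ideal quotient.\<close>

lemma cyclic_code_moment_1:
  assumes p: "prime p" and V: "cyclic_code p V" and v: "v \<in> V" "periodic p v"
    and v0: "[moment p 0 v = 0] (mod int p)" and v1: "\<not> [moment p 1 v = 0] (mod int p)"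
    and w: "periodic p w" and w0: "[moment p 0 w = 0] (mod int p)"
  shows "w \<in> V"
proof -
  have p0: "p > 0" using p prime_gt_0_nat by blast
  obtain t where t: "periodic p t" "\<And>i. [fdiff t i = v i] (mod int p)"
    using fdiff_surj[OF v(2) v0 p0] by blast
  obtain u where u: "periodic p u" "\<And>i. [fdiff u i = w i] (mod int p)"
    using fdiff_surj[OF w w0 p0] by blast
  have "[moment p 1 v = - moment p 0 t] (mod int p)"
    by (rule cong_trans[OF cong_sym[OF moment_cong[OF t(2)]] moment_fdiff(2)[OF t(1) p0]])
  then have "\<not> [moment p 0 t = 0] (mod int p)" using v1
    by (auto simp: cong_0_iff dest: cong_dvd_iff)
  moreover have "t \<in> {u. fdiff u \<in> V}" using cyclic_code_cong[OF V v(1)] t(2)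
    by (simp add: cong_sym)
  ultimately have "u \<in> {u. fdiff u \<in> V}"
    using cyclic_code_full[OF p cyclic_code_vimage_fdiff[OF V]] t u by blast
  then show ?thesis using cyclic_code_cong[OF V] u by blast
qed

text \<open>A primitive t of \<open>v\<close> has sum 0 because the first moment of \<open>v\<close>
  vanishes; then the second moment of \<open>v\<close> is -2 times the first moment of t, and
  \<open>cyclic_code_moment_1\<close> applies to primitives.\<close>

lemma cyclic_code_moment_2:
  assumes p: "prime p" "odd p" and V: "cyclic_code p V" and v: "v \<in> V" "periodic p v"
    and v0: "[moment p 0 v = 0] (mod int p)" and v1: "[moment p 1 v = 0] (mod int p)"
    and v2: "\<not> [moment p 2 v = 0] (mod int p)"
    and w: "periodic p w" and w0: "[moment p 0 w = 0] (mod int p)" and w1: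
        "[moment p 1 w = 0] (mod int p)"
  shows "w \<in> V"
proof -
  have p0: "p > 0" using p prime_gt_0_nat by blast
  have *: "[moment p 0 u = 0] (mod int p)"
    if "periodic p u" "\<And>i. [fdiff u i = w i] (mod int p)" "[moment p 1 w = 0] (mod int p)" for u w
  proof -
    have "[moment p 1 w = - moment p 0 u] (mod int p)"
      by (rule cong_trans[OF cong_sym[OF moment_cong[OF that(2)]] moment_fdiff(2)[OF that(1) p0]])
    then show ?thesis using that(3) by (auto simp: cong_0_iff dest: cong_dvd_iff)
  qed
  obtain t where t: "periodic p t" "\<And>i. [fdiff t i = v i] (mod int p)"
    using fdiff_surj[OF v(2) v0 p0] by blast
  obtain u where u: "periodic p u" "\<And>i. [fdiff u i = w i] (mod int p)"
    using fdiff_surj[OF w w0 p0] by blast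
  note t0 = *[OF t v1]
  have "[moment p 2 v = moment p 0 t - 2 * moment p 1 t] (mod int p)"
    by (rule cong_trans[OF cong_sym[OF moment_cong[OF t(2)]] moment_fdiff(3)[OF t(1) p0]])
  then have "\<not> [moment p 1 t = 0] (mod int p)" using v2 t0
    by (metis cong_0_iff cong_dvd_iff dvd_diff dvd_mult)
  moreover have "t \<in> {u. fdiff u \<in> V}" using cyclic_code_cong[OF V v(1)] t(2)
    by (simp add: cong_sym)
  ultimately have "u \<in> {u. fdiff u \<in> V}"
    using cyclic_code_moment_1[OF p(1) cyclic_code_vimage_fdiff[OF V]] t u t0 *[OF u w1] by blast
  then show ?thesis using cyclic_code_cong[OF V] u by blast
qed

section \<open>Words, exponents and the first derived subgroups\<close>

text \<open>An abstract stand-in for the tree: \<open>St\<close> consists of elements stabilizing the first level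
  and \<open>sec g i\<close> is the section of \<open>g\<close> at the letter \<open>i mod p\<close>. The group is written
  additively, so that \<open>zm k x\<close> is a power and \<open>bb j\<close> below is the conjugate of \<open>b\<close> by \<open>a\<^sup>j\<close>.
  \<open>E\<close> is the defining tuple, extended periodically with value 0 at the multiples of \<open>p\<close>.\<close>

locale ggs =
  fixes p :: nat and E :: "int \<Rightarrow> int" and a b :: "'g::group_add"
    and St :: "'g set" and sec :: "'g \<Rightarrow> int \<Rightarrow> 'g"
  assumes prime_p: "prime p" and odd_p: "odd p"
    and E_periodic: "E (i + int p) = E i" and E_0: "E 0 = 0"
    and E_nonconst: "\<exists>i j. \<not> int p dvd i \<and> \<not> int p dvd j \<and> \<not> [E i = E j] (mod int p)"
    and subgrp_St: "subgrp St"
    and sec_add: "g \<in> St \<Longrightarrow> h \<in> St \<Longrightarrow> sec (g + h) i = sec g i + sec h i"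
    and sec_periodic: "sec g (i + int p) = sec g i"
    and sec_eq_0: "g \<in> St \<Longrightarrow> (\<And>i. sec g i = 0) \<Longrightarrow> g = 0"
    and St_conj_a: "g \<in> St \<Longrightarrow> - a + g + a \<in> St"
    and sec_conj_a: "g \<in> St \<Longrightarrow> sec (- a + g + a) (i + 1) = sec g i"
    and zm_a_St: "zm k a \<in> St \<longleftrightarrow> int p dvd k" and zm_p_a: "zm (int p) a = 0"
    and b_St: "b \<in> St" and zm_p_b: "zm (int p) b = 0"
    and sec_b: "sec b i = (if int p dvd i then b else zm (E i) a)"
begin

abbreviation cong_p :: "int \<Rightarrow> int \<Rightarrow> bool" (infix "\<simeq>" 50) where
  "x \<simeq> y \<equiv> [x = y] (mod int p)"

abbreviation Zp :: "int set" where "Zp \<equiv> {0..<int p}"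

section \<open>Residues modulo p and elementary properties of sections\<close>

lemma p_gt_2: "p > 2" using prime_p odd_p prime_gt_1_nat[of p] by (cases "p = 2") auto

lemma p_pos: "p > 0" using p_gt_2 by simp

lemma prime_int_p: "prime (int p)" using prime_p by simp

lemma not_dvd_1: "\<not> int p dvd 1" using p_gt_2 by simp

lemma not_dvd_2: "\<not> int p dvd 2" using p_gt_2 zdvd_imp_le[of "int p" 2] by linarith

lemma int_periodic_exact:
  fixes f :: "int \<Rightarrow> 'a"
  assumes "\<And>i. f (i + int p) = f i" "i \<simeq> j"
  shows "f i = f j"
proof -
  have *: "f (j + int p * k) = f j" for k
  proof (induction k rule: int_induct[of _ 0])
    case (step1 k)
    then show ?case using assms(1)[of "j + int p * k"] by (simp add: algebra_simps)
  next
    case (step2 k)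
    then show ?case using assms(1)[of "j + int p * (k - 1)"] by (simp add: algebra_simps)
  qed simp
  obtain k where "i = j + int p * k" using assms(2) by (metis cong_iff_lin cong_sym)
  then show ?thesis using * by simp
qed

lemma E_cong: "i \<simeq> j \<Longrightarrow> E i = E j"
  by (rule int_periodic_exact[of E, OF E_periodic])

lemma sec_cong: "i \<simeq> j \<Longrightarrow> sec g i = sec g j"
  by (rule int_periodic_exact[of "sec g", OF sec_periodic])

lemma zm_a_cong: "i \<simeq> j \<Longrightarrow> zm i a = zm j a"
  by (rule zm_cong[OF zm_p_a])

lemma zm_a_eq_0: "zm k a = 0 \<longleftrightarrow> int p dvd k"
  using zm_a_St[of k] zm_a_cong[of k 0] subgrp_0[OF subgrp_St] by (auto simp: cong_0_iff)

lemma sec_0 [simp]: "sec 0 i = 0"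
  using sec_add[of 0 0 i] subgrp_0[OF subgrp_St] by (metis add_0_right add_left_cancel)

lemma sec_minus: "g \<in> St \<Longrightarrow> sec (- g) i = - sec g i"
  using sec_add[of "- g" g i] subgrp_minus[OF subgrp_St] by (simp add: eq_neg_iff_add_eq_0)

lemma sec_diff: "g \<in> St \<Longrightarrow> h \<in> St \<Longrightarrow> sec (g - h) i = sec g i - sec h i"
  using sec_add[of g "- h" i] sec_minus[of h i] subgrp_minus[OF subgrp_St, of h] by simp

lemma sec_zm: "g \<in> St \<Longrightarrow> sec (zm k g) i = zm k (sec g i)"
  by (rule zm_hom[OF sec_add subgrp_St])

lemma sec_cm: "g \<in> St \<Longrightarrow> h \<in> St \<Longrightarrow> sec (cm g h) i = cm (sec g i) (sec h i)"
  by (simp add: cm_def sec_add sec_diff subgrp_closed[OF subgrp_St])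

lemma zm_b_eq_0: "zm k b = 0 \<longleftrightarrow> int p dvd k"
proof
  assume k: "zm k b = 0"
  obtain i where i: "\<not> int p dvd i" "\<not> int p dvd E i"
    using E_nonconst by (metis cong_0_iff cong_trans cong_sym)
  have "zm (E i * k) a = 0" using sec_zm[OF b_St, of k i] k i by (simp add: sec_b zm_mult)
  then show "int p dvd k" using i prime_int_p by (simp add: zm_a_eq_0 prime_dvd_mult_iff)
next
  assume "int p dvd k" then show "zm k b = 0" using zm_cong[OF zm_p_b, of k 0]
    by (simp add: cong_0_iff)
qed

lemma conj_zm_a:
  assumes "g \<in> St"
  shows "- zm k a + g + zm k a \<in> St" and "sec (- zm k a + g + zm k a) i = sec g (i - k)"
proof -
  have n: "- zm (int n) a + g + zm (int n) a \<in> St \<and>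
     (\<forall>i. sec (- zm (int n) a + g + zm (int n) a) i = sec g (i - int n))" for n
  proof (induction n)
    case (Suc n)
    let ?g = "- zm (int n) a + g + zm (int n) a"
    have "- zm (int (Suc n)) a + g + zm (int (Suc n)) a = - a + ?g + a"
      using zm_add[of "int n" 1 a] by (simp only: of_nat_Suc add.commute[of 1] zm_1 group_cancel_simps)
    moreover have "sec (- a + ?g + a) i = sec g (i - int (Suc n))" for i
      using sec_conj_a[of ?g "i - 1"] Suc by (simp add: algebra_simps)
    ultimately show ?case using Suc St_conj_a[of ?g] by simp
  qed (use assms in simp)
  \<comment> \<open>A negative \<open>k\<close> is replaced by its nonnegative residue, to which the
    induction over natural numbers applies.\<close>
  define m where "m = nat (k mod int p)"
  have m: "int m \<simeq> k" using p_pos by (simp add: m_def)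
  have "zm k a = zm (int m) a" by (rule zm_a_cong[OF cong_sym[OF m]])
  moreover have "sec g (i - int m) = sec g (i - k)" for i
    by (rule sec_cong) (intro cong_diff cong_refl m)
  ultimately show "- zm k a + g + zm k a \<in> St" "sec (- zm k a + g + zm k a) i = sec g (i - k)"
    using n[of m] by auto
qed

definition bb :: "int \<Rightarrow> 'g" where
  "bb j = - zm j a + b + zm j a"

lemma bb_0 [simp]: "bb 0 = b" by (simp add: bb_def)

lemma bb_St: "bb j \<in> St"
  unfolding bb_def by (rule conj_zm_a[OF b_St])

lemma sec_bb: "sec (bb j) i = (if int p dvd i - j then b else zm (E (i - j)) a)"
  unfolding bb_def conj_zm_a(2)[OF b_St] by (rule sec_b)

lemma bb_cong: "i \<simeq> j \<Longrightarrow> bb i = bb j"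
  unfolding bb_def using zm_a_cong by metis

lemma bb_conj: "- zm k a + bb j + zm k a = bb (j + k)"
  by (simp only: bb_def zm_add group_cancel_simps)

lemma zm_p_bb: "zm (int p) (bb j) = 0"
  unfolding bb_def using zm_conj[of "zm j a" "int p" b] by (simp add: zm_p_b)

text \<open>Only positive letters occur, which is enough because p b_j = 0; the length of a word is
  therefore its exponent sum in b.\<close>

definition ev :: "int list \<Rightarrow> 'g" where
  "ev js = sum_list (map bb js)"

lemma ev_simps [simp]: "ev [] = 0" "ev (j # js) = bb j + ev js" "ev (js @ ks) = ev js + ev ks"
  by (simp_all add: ev_def)

lemma ev_replicate: "ev (replicate n j) = zm (int n) (bb j)"
  by (simp add: ev_def zm_of_nat)

lemma ev_St: "ev js \<in> St"
  by (induction js) (simp_all add: subgrp_closed[OF subgrp_St] bb_St)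

lemma ev_push: "zm m a + ev js = ev (map (\<lambda>j. j - m) js) + zm m a"
proof (induction js)
  case (Cons j js)
  have "bb (j - m) = zm m a + bb j - zm m a" using bb_conj[of "- m" j] by (simp add: zm_minus)
  then have "zm m a + bb j = bb (j - m) + zm m a" by simp
  then have "zm m a + ev (j # js) = bb (j - m) + (zm m a + ev js)"
    by (simp add: add.assoc[symmetric])
  with Cons show ?case by (simp add: add.assoc)
qed simp

lemma ev_minus: "\<exists>ks. ev ks = - ev js \<and> int p dvd int (length js) + int (length ks)"
proof (induction js)
  case (Cons j js)
  then obtain ks where ks: "ev ks = - ev js" "int p dvd int (length js) + int (length ks)" by blast
  have "zm (int p) (bb j) = zm (int (p - 1)) (bb j) + bb j"
    using p_pos zm_add[of "int (p - 1)" 1 "bb j"] by (simp add: of_nat_diff)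
  then have "zm (int (p - 1)) (bb j) = - bb j" using zm_p_bb by (simp add: eq_neg_iff_add_eq_0)
  moreover have "int (length (j # js)) + int (length (ks @ replicate (p - 1) j))
      = int (length js) + int (length ks) + int p" using p_pos by simp
  ultimately show ?case
    using ks by (intro exI[of _ "ks @ replicate (p - 1) j"]) (simp only: ev_simps ev_replicate minus_add, simp)
qed (rule exI[of _ "[]"], simp)

text \<open>A letter b_j contributes b to the section at i if j = i modulo p, and a power of a
  otherwise. Moving the powers of a to the right changes the indices of the letters but not their
  number.\<close>

lemma sec_ev: "\<exists>ks t. sec (ev js) i = ev ks + zm t a \<and> length ks = length (filter (\<lambda>j. int p dvd i - j) js)"
proof (induction js)
  case (Cons j js)
  then obtain ks t where ks: "sec (ev js) i = ev ks + zm t a"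
    "length ks = length (filter (\<lambda>j. int p dvd i - j) js)" by blast
  have s: "sec (ev (j # js)) i = sec (bb j) i + (ev ks + zm t a)"
    using ks by (simp add: sec_add bb_St ev_St)
  show ?case
  proof (cases "int p dvd i - j")
    case True
    then have "sec (ev (j # js)) i = ev (0 # ks) + zm t a" unfolding s
      by (simp add: sec_bb add.assoc)
    moreover have "length (0 # ks) = length (filter (\<lambda>j. int p dvd i - j) (j # js))"
      using True ks by simp
    ultimately show ?thesis by blast
  next
    case False
    let ?m = "E (i - j)"
    have "sec (ev (j # js)) i = zm ?m a + ev ks + zm t a"
      unfolding s using False by (simp add: sec_bb add.assoc)
    then have "sec (ev (j # js)) i = ev (map (\<lambda>j. j - ?m) ks) + zm (?m + t) a"
      by (simp only: ev_push zm_add add.assoc)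
    moreover have "length (map (\<lambda>j. j - ?m) ks) = length (filter (\<lambda>j. int p dvd i - j) (j # js))"
      using False ks by simp
    ultimately show ?thesis by blast
  qed
next
  case Nil
  show ?case by (intro exI[of _ "[]"] exI[of _ 0]) simp
qed

lemma sum_residue_counts:
  "(\<Sum>i\<in>Zp. length (filter (\<lambda>j. int p dvd i - j) js)) = length js"
proof (induction js)
  case (Cons j js)
  have "{i \<in> Zp. int p dvd i - j} = {j mod int p}"
    using p_pos by (auto simp flip: mod_eq_dvd_iff)
  then have "(\<Sum>i\<in>Zp. of_bool (int p dvd i - j) :: nat) = 1"
    by (simp add: of_bool_def sum.If_cases Int_def)
  moreover have "(\<Sum>i\<in>Zp. length (filter (\<lambda>j. int p dvd i - j) (j # js)))
     = (\<Sum>i\<in>Zp. of_bool (int p dvd i - j)) + (\<Sum>i\<in>Zp. length (filter (\<lambda>j. int p dvd i - j) js))"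
    unfolding sum.distrib[symmetric] by (intro sum.cong) auto
  ultimately show ?case using Cons by simp
qed simp

text \<open>The sections of a shortest counterexample would be shorter, unless all its letters are
  the same \<open>b\<^sub>j\<close>.\<close>

lemma ev_eq_0_length: "ev js = 0 \<Longrightarrow> p dvd length js"
proof (induction "length js" arbitrary: js rule: less_induct)
  case less
  let ?f = "\<lambda>i. filter (\<lambda>j. int p dvd i - j) js"
  show ?case
  proof (cases "\<forall>i. length (?f i) < length js")
    case True
    have "p dvd length (?f i)" for i
    proof -
      obtain ks t where ks: "sec (ev js) i = ev ks + zm t a" "length ks = length (?f i)"
        using sec_ev by blast
      then have e: "ev ks + zm t a = 0" using less by simp
      then have "zm t a = - ev ks" by (metis add.inverse_unique)
      then have "zm t a \<in> St" by (simp add: ev_St subgrp_minus[OF subgrp_St])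
      then have "zm t a = 0" by (simp add: zm_a_St zm_a_eq_0)
      then have "ev ks = 0" using e by simp
      then show ?thesis using less(1)[of ks] ks True by metis
    qed
    then have "p dvd (\<Sum>i\<in>Zp. length (?f i))" by (intro dvd_sum)
    then show ?thesis by (simp add: sum_residue_counts)
  next
    case False
    then obtain i where "length (?f i) = length js"
      by (metis length_filter_le le_neq_implies_less)
    then have "\<forall>j\<in>set js. int p dvd i - j" using length_filter_less by (metis nat_neq_iff)
    then have "\<forall>j\<in>set js. bb j = bb i" by (metis bb_cong cong_iff_dvd_diff)
    then have "map bb js = replicate (length js) (bb i)"
      by (metis (no_types, lifting) map_cong map_replicate_const)
    then have "zm (int (length js)) (bb i) = 0" using less(2) by (simp add: ev_def zm_of_nat)
    then have "- zm i a + zm (int (length js)) b + zm i a = 0" unfolding bb_def zm_conj .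
    then have "zm (int (length js)) b = 0"
      by (metis add.assoc add.right_neutral add_eq_0_iff add_minus_cancel diff_0
          diff_conv_add_uminus
          minus_add_cancel neg_eq_iff_add_eq_0)
    then show ?thesis by (simp add: zm_b_eq_0)
  qed
qed

lemma ev_unique:
  assumes "ev js + zm i a = ev ks + zm k a"
  shows "i \<simeq> k" "int (length js) \<simeq> int (length ks)"
proof -
  obtain ls where ls: "ev ls = - ev ks" "int p dvd int (length ks) + int (length ls)"
    using ev_minus by blast
  have "ev ls + ev js + zm i a = zm k a" using assms ls by (simp add: add.assoc)
  then have e: "ev (ls @ js) = zm (k - i) a" by (simp add: zm_diff eq_diff_eq)
  then have d: "int p dvd k - i" using ev_St zm_a_St by metis
  then show "i \<simeq> k" by (simp add: cong_iff_dvd_diff dvd_diff_commute)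
  have "ev (ls @ js) = 0" using d e by (simp add: zm_a_eq_0)
  then have "int p dvd int (length ls) + int (length js)"
    using ev_eq_0_length[of "ls @ js"] by (metis int_dvd_int_iff length_append of_nat_add)
  then have "int p dvd (int (length ls) + int (length js)) - (int (length ks) + int (length ls))"
    using ls(2) by (rule dvd_diff)
  then show "int (length js) \<simeq> int (length ks)" by (simp add: cong_iff_dvd_diff)
qed

section \<open>The group and the exponents of its two generators\<close>

definition G :: "'g set" where "G = gen {a, b}"

lemma subgrp_G: "subgrp G" unfolding G_def by (rule subgrp_gen)

lemma a_G: "a \<in> G" and b_G: "b \<in> G" unfolding G_def by (auto intro: generate.incl)

lemmas G_closed = subgrp_closed[OF subgrp_G] a_G b_G zm_in[OF subgrp_G] cm_in[OF subgrp_G]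

lemma bb_G: "bb j \<in> G" by (simp add: bb_def G_closed)

lemma ev_G: "ev js \<in> G" by (induction js) (simp_all add: bb_G G_closed)

lemma G_cases:
  assumes "g \<in> G"
  obtains js i where "g = ev js + zm i a"
proof -
  let ?H = "{g. \<exists>js i. g = ev js + zm i a}"
  have "subgrp ?H"
  proof (rule subgrpI)
    show "0 \<in> ?H" by (auto intro!: exI[of _ "[]"] exI[of _ 0])
    fix x y assume "x \<in> ?H" "y \<in> ?H"
    then obtain js i ks k where x: "x = ev js + zm i a" and y: "y = ev ks + zm k a" by blast
    obtain ls where "ev ls = - ev ks" using ev_minus by blast
    then have "x - y = ev js + (zm (i - k) a + ev ls)"
      unfolding x y zm_diff by (simp only: group_cancel_simps)
    also have "\<dots> = ev (js @ map (\<lambda>j. j - (i - k)) ls) + zm (i - k) a"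
      by (simp only: ev_push ev_simps add.assoc)
    finally show "x - y \<in> ?H" by blast
  qed
  moreover have "a \<in> ?H" by (auto intro!: exI[of _ "[]"] exI[of _ 1])
  moreover have "b \<in> ?H" by (auto intro!: exI[of _ "[0]"] exI[of _ 0])
  ultimately have "G \<subseteq> ?H" unfolding G_def by (intro gen_subset) auto
  with assms that show ?thesis by blast
qed

text \<open>The exponents of \<open>a\<close> and \<open>b\<close>, meaningful modulo \<open>p\<close> and on \<open>G\<close> only.\<close>

definition alpha :: "'g \<Rightarrow> int" where "alpha g = (SOME i. \<exists>js. g = ev js + zm i a)"

definition beta :: "'g \<Rightarrow> int" where "beta g = int (length (SOME js. \<exists>i. g = ev js + zm i a))"

lemma alpha_ev: "alpha (ev js + zm i a) \<simeq> i"
proof -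
  let ?i = "alpha (ev js + zm i a)"
  have "\<exists>ks. ev js + zm i a = ev ks + zm ?i a" unfolding alpha_def by (rule someI[of _ i]) blast
  then show ?thesis using ev_unique(1) cong_sym by blast
qed

lemma beta_ev: "beta (ev js + zm i a) \<simeq> int (length js)"
proof -
  let ?js = "SOME ks. \<exists>k. ev js + zm i a = ev ks + zm k a"
  have "\<exists>k. ev js + zm i a = ev ?js + zm k a" by (rule someI[of _ js]) blast
  then show ?thesis using ev_unique(2) cong_sym unfolding beta_def by blast
qed

lemma alpha_beta_add:
  assumes "x \<in> G" "y \<in> G"
  shows "alpha (x + y) \<simeq> alpha x + alpha y" "beta (x + y) \<simeq> beta x + beta y"
proof -
  obtain js i where x: "x = ev js + zm i a" using G_cases assms by blast
  obtain ks k where y: "y = ev ks + zm k a" using G_cases assms by blast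
  have xy: "x + y = ev (js @ map (\<lambda>j. j - i) ks) + zm (i + k) a"
    unfolding x y ev_simps zm_add using ev_push[of i ks]
    by (simp add: add.assoc) (simp flip: add.assoc)
  have "alpha (x + y) \<simeq> i + k" unfolding xy by (rule alpha_ev)
  moreover have "alpha x + alpha y \<simeq> i + k" unfolding x y by (intro cong_add alpha_ev)
  ultimately show "alpha (x + y) \<simeq> alpha x + alpha y" by (metis cong_trans cong_sym)
  have "beta (x + y) \<simeq> int (length js) + int (length ks)"
    unfolding xy using beta_ev[of "js @ map (\<lambda>j. j - i) ks" "i + k"] by simp
  moreover have "beta x + beta y \<simeq> int (length js) + int (length ks)"
    unfolding x y by (intro cong_add beta_ev)
  ultimately show "beta (x + y) \<simeq> beta x + beta y" by (metis cong_trans cong_sym)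
qed

text \<open>A homomorphism to the integers modulo p, given by integer representatives of its
  values.\<close>

definition hom_mod :: "'g set \<Rightarrow> ('g \<Rightarrow> int) \<Rightarrow> bool" where
  "hom_mod H f \<longleftrightarrow> subgrp H \<and> (\<forall>x\<in>H. \<forall>y\<in>H. f (x + y) \<simeq> f x + f y)"

lemma hom_mod_add: "hom_mod H f \<Longrightarrow> x \<in> H \<Longrightarrow> y \<in> H \<Longrightarrow> f (x + y) \<simeq> f x + f y"
  by (simp add: hom_mod_def)

lemma hom_mod_0: "hom_mod H f \<Longrightarrow> f 0 \<simeq> 0"
  using hom_mod_add[of H f 0 0] subgrp_0[of H] by (simp add: hom_mod_def cong_iff_dvd_diff)

lemma hom_mod_diff:
  assumes "hom_mod H f" "x \<in> H" "y \<in> H"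
  shows "f (x - y) \<simeq> f x - f y"
proof -
  have "f (x - y + y) \<simeq> f (x - y) + f y"
    using assms by (intro hom_mod_add[OF assms(1)]) (auto simp: hom_mod_def subgrp_diff)
  then have "f x - f y \<simeq> f (x - y)" using cong_diff[OF _ cong_refl[of "f y"]] by fastforce
  then show ?thesis by (rule cong_sym)
qed

lemma hom_mod_minus: "hom_mod H f \<Longrightarrow> x \<in> H \<Longrightarrow> f (- x) \<simeq> - f x"
proof -
  assume f: "hom_mod H f" and x: "x \<in> H"
  then have "f (0 - x) \<simeq> f 0 - f x"
    by (intro hom_mod_diff) (auto simp: hom_mod_def subgrp_0)
  also have "f 0 - f x \<simeq> 0 - f x" by (intro cong_diff cong_refl hom_mod_0[OF f])
  finally show ?thesis by simp
qed

lemma hom_mod_cm: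
  assumes f: "hom_mod H f" and x: "x \<in> H" and y: "y \<in> H"
  shows "f (cm x y) \<simeq> 0"
proof -
  have H: "subgrp H" using f by (simp add: hom_mod_def)
  have "f (cm x y) \<simeq> f (x + y - x) - f y"
    unfolding cm_def using x y by (intro hom_mod_diff[OF f] subgrp_closed[OF H])
  also have "f (x + y - x) - f y \<simeq> f (x + y) - f x - f y"
    using x y by (intro cong_diff cong_refl hom_mod_diff[OF f] subgrp_closed[OF H])
  also have "f (x + y) - f x - f y \<simeq> f x + f y - f x - f y"
    using x y by (intro cong_diff cong_refl hom_mod_add[OF f])
  finally show ?thesis by simp
qed

lemma hom_mod_zm:
  assumes f: "hom_mod H f" and x: "x \<in> H"
  shows "f (zm k x) \<simeq> k * f x"
proof -
  have H: "subgrp H" using f by (simp add: hom_mod_def)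
  have n: "f (zm (int n) x) \<simeq> int n * f x" for n
  proof (induction n)
    case (Suc n)
    have "f (x + zm (int n) x) \<simeq> f x + f (zm (int n) x)"
      by (intro hom_mod_add[OF f] zm_in[OF H] x)
    also have "f x + f (zm (int n) x) \<simeq> f x + int n * f x"
      by (intro cong_add cong_refl Suc)
    finally show ?case by (simp add: zm_add algebra_simps)
  qed (use hom_mod_0[OF f] in simp)
  show ?thesis
  proof (cases k rule: int_cases2)
    case (nonpos m)
    have "f (zm k x) \<simeq> - f (zm (int m) x)"
      unfolding nonpos zm_minus by (intro hom_mod_minus[OF f] zm_in[OF H] x)
    also have "- f (zm (int m) x) \<simeq> - (int m * f x)" by (intro cong_uminus n)
    finally show ?thesis by (simp add: nonpos)
  qed (use n in simp)
qed

lemma hom_mod_sum: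
  assumes "\<And>i. i \<in> I \<Longrightarrow> hom_mod H (f i)" "subgrp H"
  shows "hom_mod H (\<lambda>g. \<Sum>i\<in>I. c i * f i g)"
  unfolding hom_mod_def
proof (intro conjI ballI assms(2))
  fix x y assume xy: "x \<in> H" "y \<in> H"
  have "(\<Sum>i\<in>I. c i * f i (x + y)) \<simeq> (\<Sum>i\<in>I. c i * (f i x + f i y))"
    using xy assms by (intro cong_sum cong_mult cong_refl hom_mod_add)
  then show "(\<Sum>i\<in>I. c i * f i (x + y)) \<simeq> (\<Sum>i\<in>I. c i * f i x) + (\<Sum>i\<in>I. c i * f i y)"
    by (simp add: ring_distribs sum.distrib)
qed

lemma subgrp_hom_mod_ker: "hom_mod H f \<Longrightarrow> subgrp {x \<in> H. f x \<simeq> 0}"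
proof (rule subgrpI)
  assume f: "hom_mod H f"
  then have H: "subgrp H" by (simp add: hom_mod_def)
  show "0 \<in> {x \<in> H. f x \<simeq> 0}" using f H by (simp add: hom_mod_0 subgrp_0)
  fix x y assume "x \<in> {x \<in> H. f x \<simeq> 0}" "y \<in> {x \<in> H. f x \<simeq> 0}"
  then show "x - y \<in> {x \<in> H. f x \<simeq> 0}"
    using hom_mod_diff[OF f, of x y] cong_diff[of "f x" 0 "int p" "f y" 0] H
    by (auto simp: subgrp_diff dest: cong_trans)
qed

lemma hom_mod_subset: "hom_mod H f \<Longrightarrow> K \<subseteq> H \<Longrightarrow> subgrp K \<Longrightarrow> hom_mod K f"
  by (auto simp: hom_mod_def)

lemma hom_mod_alpha: "hom_mod G alpha" and hom_mod_beta: "hom_mod G beta"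
  by (auto simp: hom_mod_def subgrp_G alpha_beta_add)

lemma alpha_a: "alpha (zm k a) \<simeq> k" and beta_a: "beta (zm k a) \<simeq> 0"
  and alpha_bb: "alpha (bb j) \<simeq> 0" and beta_bb: "beta (bb j) \<simeq> 1"
  using alpha_ev[of "[]" k] beta_ev[of "[]" k] alpha_ev[of "[j]" 0] beta_ev[of "[j]" 0] by simp_all

section \<open>The stabilizer of the first level and the commutator subgroup of G\<close>

definition S :: "'g set" where "S = range ev"

lemma S_alpha: "g \<in> S \<longleftrightarrow> g \<in> G \<and> alpha g \<simeq> 0"
proof
  assume "g \<in> S"
  then obtain js where "g = ev js" by (auto simp: S_def)
  then show "g \<in> G \<and> alpha g \<simeq> 0" using alpha_ev[of js 0] ev_G by simp
next
  assume g: "g \<in> G \<and> alpha g \<simeq> 0"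
  then obtain js i where e: "g = ev js + zm i a" using G_cases by blast
  then have "i \<simeq> 0" using g alpha_ev[of js i] by (metis cong_trans cong_sym)
  then have "g = ev js" using zm_a_eq_0[of i] by (simp add: e cong_0_iff)
  then show "g \<in> S" by (simp add: S_def)
qed

lemma S_St: "g \<in> S \<Longrightarrow> g \<in> St" and S_G: "g \<in> S \<Longrightarrow> g \<in> G"
  by (auto simp: S_def ev_St ev_G)

lemma subgrp_S: "subgrp S"
proof -
  have "S = {x \<in> G. alpha x \<simeq> 0}" using S_alpha by blast
  then show ?thesis using subgrp_hom_mod_ker[OF hom_mod_alpha] by simp
qed

lemma bb_S: "bb j \<in> S" by (auto simp: S_def intro!: image_eqI[of _ _ "[j]"])

lemmas S_closed = subgrp_closed[OF subgrp_S] bb_S zm_in[OF subgrp_S] cm_in[OF subgrp_S]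

lemma normalized_S: "normalized G S"
  unfolding normalized_def
proof (intro conjI subgrp_S ballI)
  fix g x assume g: "g \<in> G" and x: "x \<in> S"
  then have "x \<in> G" by (rule_tac S_G)
  have "alpha (cm (- g) x) \<simeq> 0"
    using g \<open>x \<in> G\<close> by (intro hom_mod_cm[OF hom_mod_alpha] G_closed)
  then have "cm (- g) x \<in> S" using g \<open>x \<in> G\<close> by (simp add: S_alpha G_closed)
  then have "cm (- g) x + x \<in> S" using x by (rule subgrp_add[OF subgrp_S])
  then show "- g + x + g \<in> S" by (simp add: cm_def)
qed

lemma normalized_G: "normalized G G" by (simp add: normalized_def G_closed subgrp_G)

lemma sec_G: "g \<in> S \<Longrightarrow> sec g i \<in> G"
proof -
  assume "g \<in> S"
  then obtain js where "g = ev js" by (auto simp: S_def)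
  then obtain ks t where "sec g i = ev ks + zm t a" using sec_ev by blast
  then show ?thesis by (simp add: ev_G G_closed)
qed

lemma der_G_iff: "g \<in> der G \<longleftrightarrow> g \<in> G \<and> alpha g \<simeq> 0 \<and> beta g \<simeq> 0"
proof
  assume "g \<in> der G"
  moreover have "der G \<subseteq> {x \<in> G. alpha x \<simeq> 0} \<inter> {x \<in> G. beta x \<simeq> 0}"
    by (intro der_subsetI subgrp_Int subgrp_hom_mod_ker hom_mod_alpha hom_mod_beta)
      (auto intro: hom_mod_cm[OF hom_mod_alpha] hom_mod_cm[OF hom_mod_beta] G_closed)
  ultimately show "g \<in> G \<and> alpha g \<simeq> 0 \<and> beta g \<simeq> 0" by blast
next
  assume g: "g \<in> G \<and> alpha g \<simeq> 0 \<and> beta g \<simeq> 0"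
  then obtain js where js: "g = ev js" using S_alpha[of g] by (auto simp: S_def)
  have "int (length js) \<simeq> 0" using beta_ev[of js 0] g js
    by (metis add_0_right cong_sym cong_trans zm_0)
  then have z: "zm (int (length js)) b = 0" by (simp add: zm_b_eq_0 cong_0_iff)
  have n: "normalized G (der G)" by (rule normalized_der[OF normalized_G subgrp_G])
  \<comment> \<open>Modulo G' every letter equals b, so a word is determined by its length.\<close>
  have "ev js - zm (int (length js)) b \<in> der G" for js
  proof (induction js)
    case Nil then show ?case by (simp add: subgrp_0 subgrp_der)
  next
    case (Cons j js)
    let ?d = "ev js - zm (int (length js)) b"
    have "cm (- zm j a) b + (b + ?d - b) \<in> der G"
      by (intro subgrp_add[OF subgrp_der] cm_in_der normalized_conj'[OF n subgrp_G] Cons b_G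
          G_closed)
    also have "cm (- zm j a) b + (b + ?d - b) = ev (j # js) - (b + zm (int (length js)) b)"
      unfolding ev_simps cm_def bb_def by (simp only: group_cancel_simps)
    also have "b + zm (int (length js)) b = zm (int (length (j # js))) b" by (simp add: zm_add)
    finally show ?case .
  qed
  from this[of js] show "g \<in> der G" by (simp add: js z)
qed

lemma normalized_der_G: "normalized G (der G)" by (rule normalized_der[OF normalized_G subgrp_G])

lemma der_G_S: "g \<in> der G \<Longrightarrow> g \<in> S" by (simp add: der_G_iff S_alpha)

lemma der_G_G: "g \<in> der G \<Longrightarrow> g \<in> G" by (simp add: der_G_iff)

text \<open>By \<open>kappa_ev\<close> this is, modulo p, the number of letters b_k with k = j
  modulo p in any word for \<open>g\<close>. Defining it through sections makes it independent of
  the word.\<close>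

definition kappa :: "'g \<Rightarrow> int \<Rightarrow> int" where "kappa g j = beta (sec g j)"

lemma kappa_periodic: "kappa g (i + int p) = kappa g i" by (simp add: kappa_def sec_periodic)

lemma periodic_kappa: "periodic p (kappa g)" by (simp add: periodic_def kappa_periodic)

lemma hom_mod_sec: "hom_mod G f \<Longrightarrow> hom_mod S (\<lambda>g. f (sec g i))"
  by (auto simp: hom_mod_def subgrp_S sec_add S_St sec_G)

lemma hom_mod_kappa: "hom_mod S (\<lambda>g. kappa g j)"
  unfolding kappa_def by (rule hom_mod_sec[OF hom_mod_beta])

lemma kappa_bb: "kappa (bb k) j \<simeq> of_bool (int p dvd j - k)"
  using beta_bb[of 0] beta_a by (simp add: kappa_def sec_bb)

lemma hom_mod_S_eq:
  assumes f: "hom_mod S f" and h: "hom_mod S h" and e: "\<And>j. f (bb j) \<simeq> h (bb j)"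
    and g: "g \<in> S"
  shows "f g \<simeq> h g"
proof -
  have "f (ev js) \<simeq> h (ev js)" for js
  proof (induction js)
    case Nil then show ?case using hom_mod_0[OF f] hom_mod_0[OF h]
      by simp (metis cong_trans cong_sym)
  next
    case (Cons j js)
    have s: "ev js \<in> S" by (simp add: S_def)
    have "f (ev (j # js)) \<simeq> f (bb j) + f (ev js)" using hom_mod_add[OF f bb_S s] by simp
    also have "f (bb j) + f (ev js) \<simeq> h (bb j) + h (ev js)" by (intro cong_add Cons e)
    also have "h (bb j) + h (ev js) \<simeq> h (ev (j # js))"
      using hom_mod_add[OF h bb_S s] by (simp add: cong_sym)
    finally show ?case .
  qed
  then show ?thesis using g by (auto simp: S_def)
qed

lemma sum_delta_mod:
  assumes "\<And>i. f (i + int p) = f i"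
  shows "(\<Sum>j\<in>Zp. f j * of_bool (int p dvd j - k)) = (f k :: int)"
proof -
  have "(\<Sum>j\<in>Zp. f j * of_bool (int p dvd j - k)) = (\<Sum>j\<in>{k mod int p}. f j)"
    using p_pos by (intro sum.mono_neutral_cong_right) (auto simp flip: mod_eq_dvd_iff)
  also have "\<dots> = f k" using int_periodic_exact[of f, OF assms, where i = "k mod int p" and j = k]
    by simp
  finally show ?thesis .
qed

lemma beta_kappa:
  assumes "g \<in> S" shows "beta g \<simeq> moment p 0 (kappa g)"
proof -
  have "beta g \<simeq> (\<Sum>j\<in>Zp. 1 * kappa g j)"
  proof (rule hom_mod_S_eq[OF _ _ _ assms])
    show "hom_mod S beta" by (rule hom_mod_subset[OF hom_mod_beta _ subgrp_S]) (auto simp: S_G)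
    show "hom_mod S (\<lambda>g. \<Sum>j\<in>Zp. 1 * kappa g j)" by (intro hom_mod_sum hom_mod_kappa subgrp_S)
    fix j
    have "(\<Sum>i\<in>Zp. 1 * kappa (bb j) i) \<simeq> (\<Sum>i\<in>Zp. 1 * of_bool (int p dvd i - j))"
      by (intro cong_sum cong_mult cong_refl kappa_bb)
    also have "(\<Sum>i\<in>Zp. 1 * of_bool (int p dvd i - j)) = (1::int)" by (rule sum_delta_mod) simp
    finally show "beta (bb j) \<simeq> (\<Sum>i\<in>Zp. 1 * kappa (bb j) i)"
      using beta_bb[of j] by (metis cong_trans cong_sym)
  qed
  then show ?thesis by (simp add: moment_def)
qed

text \<open>The letter b_k contributes the exponent E(i - k) of a at coordinate i, whence a cyclic
  convolution; the convention E(0) = 0 covers the letter that contributes b instead.\<close>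

lemma alpha_sec:
  assumes "g \<in> S" shows "alpha (sec g i) \<simeq> (\<Sum>k\<in>Zp. E (i - k) * kappa g k)"
proof (rule hom_mod_S_eq[OF _ _ _ assms])
  show "hom_mod S (\<lambda>g. alpha (sec g i))" by (rule hom_mod_sec[OF hom_mod_alpha])
  show "hom_mod S (\<lambda>g. \<Sum>k\<in>Zp. E (i - k) * kappa g k)" by (intro hom_mod_sum hom_mod_kappa subgrp_S)
  fix j
  have "(\<Sum>k\<in>Zp. E (i - k) * kappa (bb j) k) \<simeq> (\<Sum>k\<in>Zp. E (i - k) * of_bool (int p dvd k - j))"
    by (intro cong_sum cong_mult cong_refl kappa_bb)
  also have "(\<Sum>k\<in>Zp. E (i - k) * of_bool (int p dvd k - j)) = E (i - j)"
  proof (rule sum_delta_mod)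
    fix k show "E (i - (k + int p)) = E (i - k)"
      by (rule E_cong) (simp add: cong_iff_dvd_diff)
  qed
  finally have 1: "(\<Sum>k\<in>Zp. E (i - k) * kappa (bb j) k) \<simeq> E (i - j)" .
  have "alpha (sec (bb j) i) \<simeq> E (i - j)"
  proof (cases "int p dvd i - j")
    case True
    then have "E (i - j) = 0" using E_cong[of "i - j" 0] E_0 by (simp add: cong_0_iff)
    then show ?thesis using alpha_bb[of 0] True by (simp add: sec_bb)
  next
    case False then show ?thesis using alpha_a by (simp add: sec_bb)
  qed
  then show "alpha (sec (bb j) i) \<simeq> (\<Sum>k\<in>Zp. E (i - k) * kappa (bb j) k)"
    using 1 by (metis cong_trans cong_sym)
qed

lemma kappa_ev: "kappa (ev js) j \<simeq> int (length (filter (\<lambda>k. int p dvd j - k) js))"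
proof (induction js)
  case Nil then show ?case using hom_mod_0[OF hom_mod_kappa] by simp
next
  case (Cons k js)
  have "kappa (ev (k # js)) j \<simeq> kappa (bb k) j + kappa (ev js) j"
    using hom_mod_add[OF hom_mod_kappa bb_S, of "ev js" k j] by (simp add: S_def)
  also have "kappa (bb k) j + kappa (ev js) j
      \<simeq> of_bool (int p dvd j - k) + int (length (filter (\<lambda>k. int p dvd j - k) js))"
    by (intro cong_add Cons kappa_bb)
  finally show ?case by (auto simp: add.commute split: if_splits)
qed

text \<open>Letters commute modulo S', so all occurrences of one letter can be collected in
  front.\<close>

lemma ev_filter:
  assumes N: "normalized S N" "der S \<subseteq> N" and P: "\<And>k. P k \<Longrightarrow> bb k = bb j"
  shows "ev js - (zm (int (length (filter P js))) (bb j) + ev (filter (\<lambda>k. \<not> P k) js)) \<in> N"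
proof (induction js)
  case Nil then show ?case by (simp add: subgrp_0 normalizedD(1)[OF N(1)])
next
  case (Cons k js)
  let ?z = "zm (int (length (filter P js))) (bb j)" and ?f = "ev (filter (\<lambda>k. \<not> P k) js)"
  have c: "bb k + (ev js - (?z + ?f)) - bb k \<in> N"
    by (intro normalized_conj'[OF N(1) subgrp_S] Cons bb_S)
  show ?case
  proof (cases "P k")
    case True
    have "bb k + (ev js - (?z + ?f)) - bb k = ev (k # js) - (bb k + ?z + ?f)"
      by (simp only: ev_simps group_cancel_simps)
    then show ?thesis using c True P by (simp add: zm_add)
  next
    case False
    have "cm (bb k) ?z \<in> N" using N(2) by (intro subsetD[OF N(2)] cm_in_der S_closed)
    then have "bb k + (ev js - (?z + ?f)) - bb k + cm (bb k) ?z \<in> N"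
      by (intro subgrp_add[OF normalizedD(1)[OF N(1)]] c)
    also have "bb k + (ev js - (?z + ?f)) - bb k + cm (bb k) ?z = ev (k # js) - (?z + (bb k + ?f))"
      by (simp only: ev_simps cm_def group_cancel_simps)
    finally show ?thesis using False by simp
  qed
qed

lemma kappa_der_S: "g \<in> der S \<Longrightarrow> kappa g j \<simeq> 0"
proof -
  have "der S \<subseteq> {x \<in> S. kappa x j \<simeq> 0}"
    by (intro der_subsetI subgrp_hom_mod_ker hom_mod_kappa)
      (auto intro: hom_mod_cm[OF hom_mod_kappa] S_closed)
  then show "g \<in> der S \<Longrightarrow> kappa g j \<simeq> 0" by blast
qed

text \<open>The letters form a basis of S / S' over the prime field. If all letter counts are 0
  modulo p, then deleting every occurrence of the first letter does not change the class modulo S'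
  and leaves a shorter word.\<close>

lemma der_S_iff: "g \<in> der S \<longleftrightarrow> g \<in> S \<and> (\<forall>j. kappa g j \<simeq> 0)"
proof
  assume "g \<in> der S"
  then show "g \<in> S \<and> (\<forall>j. kappa g j \<simeq> 0)"
    using der_subset[OF subgrp_S] kappa_der_S by blast
next
  assume g: "g \<in> S \<and> (\<forall>j. kappa g j \<simeq> 0)"
  have n: "normalized S (der S)" by (rule normalized_der) (auto simp: normalized_def S_closed subgrp_S)
  have "ev js \<in> der S" if "\<forall>j. kappa (ev js) j \<simeq> 0" for js
    using that
  proof (induction "length js" arbitrary: js rule: less_induct)
    case less
    show ?case
    proof (cases js)
      case Nil then show ?thesis by (simp add: subgrp_0 subgrp_der)
    next
      case (Cons j js')
      let ?P = "\<lambda>k. int p dvd j - k"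
      let ?n = "int (length (filter ?P js))"
      let ?f = "filter (\<lambda>k. \<not> ?P k) js"
      have "bb k = bb j" if "?P k" for k using that by (metis bb_cong cong_iff_dvd_diff)
      then have d: "ev js - (zm ?n (bb j) + ev ?f) \<in> der S" by (rule ev_filter[OF n order_refl])
      have "?n \<simeq> 0" using less(2) kappa_ev[of js j] by (metis cong_sym cong_trans)
      then have d: "ev js - ev ?f \<in> der S" using d zm_cong[OF zm_p_bb, of ?n 0 j] by simp
      have "kappa (ev ?f) k \<simeq> 0" for k
      proof -
        have "kappa (ev js) k - kappa (ev ?f) k \<simeq> kappa (ev js - ev ?f) k"
          by (rule cong_sym, rule hom_mod_diff[OF hom_mod_kappa]) (simp_all add: S_def)
        also have "kappa (ev js - ev ?f) k \<simeq> 0" by (rule kappa_der_S[OF d])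
        finally have "kappa (ev js) k \<simeq> kappa (ev ?f) k" by (simp add: cong_diff_iff_cong_0)
        then show ?thesis using less(2) by (metis cong_sym cong_trans)
      qed
      moreover have "length ?f < length js" using Cons
        by (simp add: length_filter_le le_imp_less_Suc)
      ultimately have "ev ?f \<in> der S" using less(1) by blast
      then have "ev js - ev ?f + ev ?f \<in> der S" by (rule subgrp_add[OF subgrp_der d])
      then show ?thesis by simp
    qed
  qed
  then show "g \<in> der S" using g by (auto simp: S_def)
qed

lemma der_S_S: "g \<in> der S \<Longrightarrow> g \<in> S" by (simp add: der_S_iff)

lemma der_S_der_G: "der S \<subseteq> der G"
  by (rule der_mono) (auto simp: S_G)

lemma normalized_der_S: "normalized G (der S)" by (rule normalized_der[OF normalized_S subgrp_G])

lemma sec_der_S: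
  assumes "g \<in> der S"
  shows "sec g i \<in> der G"
proof -
  have "(\<Sum>k\<in>Zp. E (i - k) * kappa g k) \<simeq> (\<Sum>k\<in>Zp. E (i - k) * 0)"
    using assms by (intro cong_sum cong_mult cong_refl) (simp add: der_S_iff)
  then have "alpha (sec g i) \<simeq> 0"
    using alpha_sec[of g i] assms by (auto simp: der_S_iff intro: cong_trans)
  then show ?thesis using assms by (simp add: der_G_iff der_S_iff sec_G kappa_def)
qed

lemma kappa_conj: "g \<in> S \<Longrightarrow> kappa (- zm k a + g + zm k a) j = kappa g (j - k)"
  by (simp add: kappa_def conj_zm_a S_St)

text \<open>On \<open>der G\<close>, this is the exponent of the central generator of the Heisenberg quotient of
  \<open>G\<close>; by \<open>T_cm\<close> its kernel there contains \<open>[G', G]\<close>, and by \<open>gamma3_subset\<close> it equals \<open>[G', G]\<close>.\<close>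

definition T :: "'g \<Rightarrow> int" where "T g = moment p 1 (kappa g)"

lemma hom_mod_T: "hom_mod S T"
proof -
  have "hom_mod S (\<lambda>g. \<Sum>j\<in>Zp. j * kappa g j)"
    by (rule hom_mod_sum[OF hom_mod_kappa subgrp_S])
  then show ?thesis by (simp add: T_def[abs_def] moment_def)
qed

text \<open>Conjugation shifts the letter counts, and a shift by k adds k times their sum to the
  first moment.\<close>

lemma T_conj:
  assumes g: "g \<in> S"
  shows "T (- zm k a + g + zm k a) \<simeq> T g + k * beta g"
proof -
  have "T (- zm k a + g + zm k a) = (\<Sum>j\<in>Zp. j * kappa g (j - k))"
    by (simp add: T_def moment_def kappa_conj g)
  also have "\<dots> \<simeq> (\<Sum>j\<in>Zp. (j + k) * kappa g (j + k - k))"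
    by (rule cong_sym, rule sum_cyclic_shift[of p "\<lambda>j. j * kappa g (j - k)"])
      (use p_pos periodic_shift[OF periodic_kappa[of g], of "- k"] in \<open>auto intro: periodic_intros\<close>)
  also have "(\<Sum>j\<in>Zp. (j + k) * kappa g (j + k - k)) = T g + k * moment p 0 (kappa g)"
    by (simp add: T_def moment_def algebra_simps sum.distrib sum_distrib_left)
  also have "\<dots> \<simeq> T g + k * beta g"
    by (intro cong_add cong_mult cong_refl cong_sym[OF beta_kappa[OF g]])
  finally show ?thesis .
qed

text \<open>With x = s + i a and y = t + k a, the commutator is s + t' - s' - t for conjugates t',
  s' of t, s by multiples of a. \<open>T\<close> is additive on these elements of S, and
  \<open>T_conj\<close> supplies the difference.\<close>

lemma T_cm:
  assumes "x \<in> G" "y \<in> G"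
  shows "T (cm x y) \<simeq> alpha y * beta x - alpha x * beta y"
proof -
  obtain js i where x: "x = ev js + zm i a" using G_cases assms by blast
  obtain ks k where y: "y = ev ks + zm k a" using G_cases assms by blast
  let ?s = "ev js" and ?t = "ev ks"
  have s: "?s \<in> S" "?t \<in> S" by (simp_all add: S_def)
  let ?t' = "- zm (- i) a + ?t + zm (- i) a" and ?s' = "- zm (- k) a + ?s + zm (- k) a"
  have s': "?t' \<in> S" "?s' \<in> S" by (intro normalizedD(2)[OF normalized_S] G_closed s)+
  have c: "?s + zm i a + (?t + zm k a) - (?s + zm i a) - (?t + zm k a) = ?s + ?t' - ?s' - ?t"
  proof -
    have "zm i a + ?t + zm k a - zm i a = zm i a + ?t - zm i a + zm k a"
      using zm_commute[of k a "- i"] by (simp add: add.assoc zm_minus diff_conv_add_uminus del: add_uminus_conv_diff)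
    then have "?s + (zm i a + ?t + zm k a - zm i a) - ?s - (?t + zm k a)
      = ?s + (zm i a + ?t - zm i a + zm k a) - ?s - (?t + zm k a)" by simp
    then show ?thesis by (simp only: zm_minus group_cancel_simps)
  qed
  have "T (?s + ?t' - ?s' - ?t) \<simeq> T (?s + ?t' - ?s') - T ?t"
    by (intro hom_mod_diff[OF hom_mod_T] S_closed s s')
  also have "T (?s + ?t' - ?s') - T ?t \<simeq> T (?s + ?t') - T ?s' - T ?t"
    by (intro cong_diff cong_refl hom_mod_diff[OF hom_mod_T] S_closed s s')
  also have "T (?s + ?t') - T ?s' - T ?t \<simeq> T ?s + T ?t' - T ?s' - T ?t"
    by (intro cong_diff cong_refl hom_mod_add[OF hom_mod_T] S_closed s s')
  also have "T ?s + T ?t' - T ?s' - T ?t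
      \<simeq> T ?s + (T ?t + (- i) * beta ?t) - (T ?s + (- k) * beta ?s) - T ?t"
    by (intro cong_diff cong_add cong_refl T_conj s)
  also have "T ?s + (T ?t + (- i) * beta ?t) - (T ?s + (- k) * beta ?s) - T ?t = k * beta ?s - i
      * beta ?t"
    by simp
  also have "\<dots> \<simeq> alpha y * beta x - alpha x * beta y"
  proof (intro cong_diff cong_mult)
    show "k \<simeq> alpha y" "i \<simeq> alpha x" unfolding x y by (rule cong_sym, rule alpha_ev)+
    show "beta ?s \<simeq> beta x" "beta ?t \<simeq> beta y"
      unfolding x y using beta_ev[of js 0] beta_ev[of js i] beta_ev[of ks 0] beta_ev[of ks k]
      by (simp_all) (metis cong_trans cong_sym)+
  qed
  finally show ?thesis unfolding cm_def[of x y] unfolding x y c .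
qed

definition gamma3 :: "'g set" where "gamma3 = {g \<in> der G. T g \<simeq> 0}"

lemma hom_mod_T_der_G: "hom_mod (der G) T"
  by (rule hom_mod_subset[OF hom_mod_T _ subgrp_der]) (auto simp: der_G_S)

lemma subgrp_gamma3: "subgrp gamma3"
  unfolding gamma3_def by (rule subgrp_hom_mod_ker[OF hom_mod_T_der_G])

lemma T_cm_der_G: "x \<in> der G \<Longrightarrow> y \<in> G \<Longrightarrow> T (cm x y) \<simeq> 0"
proof -
  assume x: "x \<in> der G" and y: "y \<in> G"
  have "alpha y * beta x - alpha x * beta y \<simeq> alpha y * 0 - 0 * beta y"
    using x by (intro cong_diff cong_mult cong_refl) (simp_all add: der_G_iff)
  then show ?thesis using T_cm[OF der_G_G[OF x] y] by (auto intro: cong_trans)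
qed

lemma cm_in_gamma3: "x \<in> der G \<Longrightarrow> y \<in> G \<Longrightarrow> cm x y \<in> gamma3"
  unfolding gamma3_def using T_cm_der_G normalized_cm(2)[OF normalized_der_G subgrp_G, of y x]
  by simp

lemma normalized_gamma3: "normalized G gamma3"
  unfolding normalized_def
proof (intro conjI ballI subgrp_gamma3)
  fix g x assume g: "g \<in> G" and x: "x \<in> gamma3"
  have "x + cm (- x) (- g) \<in> gamma3"
    using x g by (intro subgrp_add[OF subgrp_gamma3] cm_in_gamma3 subgrp_minus[OF subgrp_der]
        G_closed)
      (auto simp: gamma3_def)
  also have "x + cm (- x) (- g) = - g + x + g" by (simp only: cm_def group_cancel_simps)
  finally show "- g + x + g \<in> gamma3" .
qed

lemma T_c: "T (cm b a) \<simeq> 1"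
proof -
  have "alpha a * beta b - alpha b * beta a \<simeq> 1 * 1 - 0 * 0"
    using alpha_a[of 1] beta_a[of 1] alpha_bb[of 0] beta_bb[of 0]
    by (intro cong_diff cong_mult) simp_all
  then show ?thesis using T_cm[OF b_G a_G] by (auto intro: cong_trans)
qed

lemma c_der_G: "cm b a \<in> der G" by (intro cm_in_der a_G b_G)

lemma der_G_subsetI:
  assumes N: "normalized G N" and c: "cm b a \<in> N"
  shows "der G \<subseteq> N"
  unfolding G_def
proof (rule der_gen_subset)
  show "normalized (gen {a, b}) N" using N by (simp add: G_def)
  have "cm a b \<in> N" using subgrp_minus[OF normalizedD(1)[OF N] c] by (simp only: minus_cm)
  then show "cm x y \<in> N" if "x \<in> {a, b}" "y \<in> {a, b}" for x y
    using that c subgrp_0[OF normalizedD(1)[OF N]] by (elim insertE emptyE) (simp_all only: cm_self)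
qed

lemma der_G_decomp:
  assumes g: "g \<in> der G"
  shows "g - zm (T g) (cm b a) \<in> gamma3"
proof -
  have "T (g - zm (T g) (cm b a)) \<simeq> T g - T (zm (T g) (cm b a))"
    by (intro hom_mod_diff[OF hom_mod_T_der_G] g zm_in[OF subgrp_der] c_der_G)
  also have "T g - T (zm (T g) (cm b a)) \<simeq> T g - T g * T (cm b a)"
    by (intro cong_diff cong_refl hom_mod_zm[OF hom_mod_T_der_G] c_der_G)
  also have "T g - T g * T (cm b a) \<simeq> T g - T g * 1"
    by (intro cong_diff cong_mult cong_refl T_c)
  finally show ?thesis
    unfolding gamma3_def by (simp add: subgrp_diff[OF subgrp_der] g zm_in[OF subgrp_der] c_der_G)
qed

text \<open>If \<open>c = [b, a]\<close> is central modulo \<open>N\<close>, then the commutator subgroup is generated by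
  \<open>c\<close> modulo \<open>N\<close>, and \<open>p c = [b, p a] = 0\<close> modulo \<open>N\<close>.\<close>

lemma gamma3_subset:
  assumes N0: "normalized G N0" and ca0: "cm (cm b a) a \<in> N0" and cb0: "cm (cm b a) b \<in> N0"
  shows "gamma3 \<subseteq> N0"
proof -
  let ?c = "cm b a"
  \<comment> \<open>Intersecting with \<open>gamma3\<close> forces \<open>T\<close> to vanish on
    \<open>N\<close>, so that the coefficient of c in an element of the subgroup below can be read
    off by \<open>T\<close>.\<close>
  define N where "N = N0 \<inter> gamma3"
  have N: "normalized G N" using N0 normalized_gamma3
    by (auto simp: N_def normalized_def subgrp_Int)
  note N' = normalizedD(1)[OF N]
  have ca: "cm ?c a \<in> N" and cb: "cm ?c b \<in> N"
    using ca0 cb0 cm_in_gamma3[OF c_der_G a_G] cm_in_gamma3[OF c_der_G b_G] by (simp_all add: N_def)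
  have cen: "cm g ?c \<in> N" if "g \<in> G" for g
  proof (rule commute_mod_gen[OF N[unfolded G_def] _ _ that[unfolded G_def]])
    show "?c \<in> gen {a, b}" using der_G_G[OF c_der_G] by (simp add: G_def)
    show "cm x ?c \<in> N" if "x \<in> {a, b}" for x
      using ca cb cm_swap_in[OF N', of ?c] that by blast
  qed
  let ?H = "{x. \<exists>k. \<exists>n\<in>N. x = zm k ?c + n}"
  have H: "subgrp ?H"
  proof (rule subgrpI)
    show "0 \<in> ?H" using subgrp_0[OF N'] by (auto intro!: exI[of _ 0])
    fix x y assume "x \<in> ?H" "y \<in> ?H"
    then obtain k n l m where x: "x = zm k ?c + n" "n \<in> N" and y: "y = zm l ?c + m" "m \<in> N" by blast
    have "zm l ?c + (n - m) - zm l ?c \<in> N"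
      using x y by (intro normalized_conj'[OF N subgrp_G] subgrp_diff[OF N'] G_closed)
    moreover have "x - y = zm (k - l) ?c + (zm l ?c + (n - m) - zm l ?c)"
      unfolding x y zm_diff by (simp only: group_cancel_simps)
    ultimately show "x - y \<in> ?H" by blast
  qed
  have NH: "N \<subseteq> ?H" by (auto intro!: exI[of _ 0])
  have cH: "?c \<in> ?H" using subgrp_0[OF N'] by (auto intro!: exI[of _ 1] bexI[of _ 0])
  have "normalized G ?H"
    unfolding normalized_def
  proof (intro conjI H ballI)
    fix g x assume g: "g \<in> G" and "x \<in> ?H"
    then obtain k n where x: "x = zm k ?c + n" "n \<in> N" by blast
    have "?c \<in> {x \<in> G. cm x (- g) \<in> N}"
      using cen[of "- g"] g cm_swap_in[OF N'] by (simp add: G_closed)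
    then have "cm (- ?c) (- g) \<in> N"
      using subgrp_minus[OF subgrp_centralizer[OF N subgrp_G]] by blast
    then have "?c + cm (- ?c) (- g) \<in> ?H" using NH cH by (intro subgrp_add[OF H]) auto
    then have "- g + ?c + g \<in> ?H" by (simp only: cm_def group_cancel_simps)
    moreover have "- g + n + g \<in> ?H" using NH normalizedD(2)[OF N g] x by auto
    ultimately have "zm k (- g + ?c + g) + (- g + n + g) \<in> ?H"
      by (rule subgrp_add[OF H zm_in[OF H]])
    also have "zm k (- g + ?c + g) + (- g + n + g) = - g + x + g"
      unfolding zm_conj[symmetric] x by (simp only: group_cancel_simps)
    finally show "- g + x + g \<in> ?H" .
  qed
  then have derH: "der G \<subseteq> ?H" by (rule der_G_subsetI[OF _ cH])
  have "cm b (zm (int n) a) - zm (int n) ?c \<in> N" for n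
  proof (induction n)
    case 0 then show ?case by (simp add: subgrp_0[OF N'])
  next
    case (Suc n)
    let ?y = "zm (int n) a" let ?d = "cm b ?y"
    have "?d \<in> {x \<in> G. cm x a \<in> N}"
    proof -
      note C = subgrp_centralizer[OF N subgrp_G, of a]
      have "?d - zm (int n) ?c \<in> {x \<in> G. cm x a \<in> N}"
        using Suc normalized_cm[OF N subgrp_G a_G Suc] by (simp add: G_closed)
      moreover have "zm (int n) ?c \<in> {x \<in> G. cm x a \<in> N}"
        by (rule zm_in[OF C]) (simp add: ca G_closed)
      ultimately show ?thesis using subgrp_add[OF C] by force
    qed
    then have "cm a ?d \<in> N" using cm_swap_in[OF N'] by blast
    then have "?c + (cm a ?d + (?d - zm (int n) ?c)) - ?c \<in> N"
      by (intro normalized_conj'[OF N subgrp_G] subgrp_add[OF N'] Suc G_closed)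
    moreover have "cm b (a + ?y) - (?c + zm (int n) ?c) = ?c + (cm a ?d + (?d - zm (int n) ?c)) - ?c"
      unfolding cm_def[of a ?d] unfolding cm_def[of b "a + ?y"] unfolding cm_def[of b ?y]
        diff_conv_add_uminus minus_add cm_def[of b a] by (simp only: group_cancel_simps)
    ultimately show ?case by (simp add: zm_add)
  qed
  from this[of p] have pc: "zm (int p) ?c \<in> N"
    using subgrp_minus[OF N'] by (force simp: zm_p_a)
  show "gamma3 \<subseteq> N0"
  proof
    fix g assume g: "g \<in> gamma3"
    then have "g \<in> ?H" using derH by (auto simp: gamma3_def)
    then obtain k n where x: "g = zm k ?c + n" "n \<in> N" by blast
    have nd: "n \<in> der G" "T n \<simeq> 0" using x by (auto simp: N_def gamma3_def)
    have "T g \<simeq> T (zm k ?c) + T n"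
      unfolding x by (intro hom_mod_add[OF hom_mod_T_der_G] zm_in[OF subgrp_der] c_der_G nd)
    also have "T (zm k ?c) + T n \<simeq> k * T ?c + 0"
      by (intro cong_add hom_mod_zm[OF hom_mod_T_der_G] c_der_G nd)
    also have "k * T ?c + 0 \<simeq> k * 1 + 0" by (intro cong_add cong_mult cong_refl T_c)
    finally have "k \<simeq> 0" using g by (simp add: gamma3_def) (metis cong_sym cong_trans)
    then obtain l where "k = int p * l" by (auto simp: cong_0_iff)
    then have "zm k ?c \<in> N" using zm_in[OF N' pc] by (simp add: zm_mult)
    then have "g \<in> N" using x by (auto intro: subgrp_add[OF N'])
    then show "g \<in> N0" by (simp add: N_def)
  qed
qed

section \<open>Branching\<close>

definition single :: "int \<Rightarrow> 'g \<Rightarrow> int \<Rightarrow> 'g" where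
  "single i x = (\<lambda>j. if int p dvd j - i then x else 0)"

lemma single_cong: "i \<simeq> k \<Longrightarrow> single i = single k"
  unfolding single_def by (intro ext) (metis cong_iff_dvd_diff dvd_diff_commute cong_trans cong_sym)

text \<open>For normal \<open>H\<close> the choice of coordinate is immaterial, and K <=
  \<open>coord0 H\<close> yields K^p <= psi(H) by \<open>coord0_all\<close>.\<close>

definition coord0 :: "'g set \<Rightarrow> 'g set" where
  "coord0 H = {x. \<exists>g\<in>H. sec g = single 0 x}"

lemma subgrp_coord0:
  assumes "subgrp H" "H \<subseteq> S"
  shows "subgrp (coord0 H)"
proof (rule subgrpI)
  show "0 \<in> coord0 H" unfolding coord0_def using subgrp_0[OF assms(1)]
    by (auto simp: single_def fun_eq_iff intro!: bexI[of _ 0])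
  fix x y assume "x \<in> coord0 H" "y \<in> coord0 H"
  then obtain g h where "g \<in> H" "sec g = single 0 x" "h \<in> H" "sec h = single 0 y"
    by (auto simp: coord0_def)
  then show "x - y \<in> coord0 H"
    using assms subgrp_diff[OF assms(1), of g h] sec_diff[of g h] S_St
    unfolding coord0_def by (auto simp: single_def fun_eq_iff subset_iff intro!: bexI[of _ "g - h"])
qed

lemma a_in_if_power_in:
  assumes H: "subgrp H" and "zm k a \<in> H" "\<not> int p dvd k"
  shows "a \<in> H"
  using assms zm_inverse[OF prime_p assms(3) zm_p_a] zm_in[OF H assms(2)] by metis

lemma E_nonzero: "\<exists>i. \<not> int p dvd i \<and> \<not> int p dvd E i"
  using E_nonconst by (metis cong_0_iff cong_trans cong_sym)

text \<open>b is its own section at 0, and a nontrivial power of a is the section at 0 of some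
  conjugate. This allows conjugation by any element of G inside one coordinate, as
  \<open>normalized_coord0\<close> requires.\<close>

lemma sec_surj:
  assumes "y \<in> G"
  shows "\<exists>s\<in>S. sec s 0 = y"
proof -
  let ?H = "(\<lambda>s. sec s 0) ` S"
  have H: "subgrp ?H"
  proof (rule subgrpI)
    show "0 \<in> ?H" using subgrp_0[OF subgrp_S] by force
    fix x y assume "x \<in> ?H" "y \<in> ?H"
    then obtain g h where "g \<in> S" "x = sec g 0" "h \<in> S" "y = sec h 0" by blast
    then show "x - y \<in> ?H"
      using subgrp_diff[OF subgrp_S, of g h] by (intro image_eqI[of _ _
          "g - h"]) (simp_all add: sec_diff S_St)
  qed
  have "b \<in> ?H" using bb_S[of 0] by (intro image_eqI[of _ _ "bb 0"]) (simp_all add: sec_b)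
  moreover obtain i where "\<not> int p dvd i" "\<not> int p dvd E i" using E_nonzero by blast
  then have "zm (E i) a \<in> ?H" "\<not> int p dvd E i"
    using bb_S[of "- i"] by (auto simp: sec_bb intro!: image_eqI[of _ _ "bb (- i)"])
  then have "a \<in> ?H" by (rule a_in_if_power_in[OF H])
  ultimately have "G \<subseteq> ?H" unfolding G_def by (intro gen_subset H) auto
  with assms show ?thesis by auto
qed

lemma normalized_coord0:
  assumes "normalized G H" "H \<subseteq> S"
  shows "normalized G (coord0 H)"
  unfolding normalized_def
proof (intro conjI ballI subgrp_coord0 normalizedD(1)[OF assms(1)] assms(2))
  fix y x assume "y \<in> G" "x \<in> coord0 H"
  obtain s where s: "s \<in> S" "sec s 0 = y" using sec_surj[OF \<open>y \<in> G\<close>] by blast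
  obtain g where g: "g \<in> H" "sec g = single 0 x" using \<open>x \<in> coord0 H\<close> by (auto simp: coord0_def)
  have St: "s \<in> St" "- s \<in> St" "g \<in> St"
    using s g assms by (auto simp: S_St subgrp_minus[OF subgrp_St])
  have "sec (- s + g + s) i = single 0 (- y + x + y) i" for i
  proof -
    have "sec (- s + g + s) i = - sec s i + sec g i + sec s i"
      by (simp add: sec_add sec_minus St subgrp_add[OF subgrp_St])
    then show ?thesis using g s sec_cong[of i 0 s] by (auto simp: single_def cong_0_iff)
  qed
  moreover have "- s + g + s \<in> H" using normalizedD(2)[OF assms(1) S_G[OF s(1)] g(1)] .
  ultimately show "- y + x + y \<in> coord0 H" unfolding coord0_def by blast
qed

lemma coord0_single:
  assumes H: "normalized G H" "H \<subseteq> S" and x: "x \<in> coord0 H"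
  shows "\<exists>g\<in>H. sec g = single i x"
proof -
  obtain g where g: "g \<in> H" "sec g = single 0 x" using x by (auto simp: coord0_def)
  have "sec (- zm i a + g + zm i a) = single i x"
    using g H by (auto simp: conj_zm_a S_St subset_iff single_def)
  then show ?thesis using normalizedD(2)[OF H(1) zm_in[OF subgrp_G a_G] g(1), of i] by blast
qed

lemma coord0_all:
  assumes H: "normalized G H" "H \<subseteq> S" and x: "\<And>i. x i \<in> coord0 H" and per: "\<And>i. x (i + int p) = x i"
  shows "\<exists>g\<in>H. sec g = x"
proof -
  have "\<exists>g\<in>H. sec g = (\<lambda>i. if i mod int p < int n then x i else 0)" if "n \<le> p" for n
    using that
  proof (induction n)
    case 0
    then show ?case using p_pos subgrp_0[OF normalizedD(1)[OF H(1)]]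
      by (intro bexI[of _ 0]) (simp_all add: fun_eq_iff pos_mod_sign leD)
  next
    case (Suc n)
    then obtain g where g: "g \<in> H" "sec g = (\<lambda>i. if i mod int p < int n then x i else 0)" by auto
    obtain h where h: "h \<in> H" "sec h = single (int n) (x (int n))" using coord0_single[OF H x]
      by blast
    have n: "int n mod int p = int n" using Suc.prems by simp
    have "sec (g + h) i = (if i mod int p < int (Suc n) then x i else 0)" for i
    proof -
      have "sec (g + h) i = sec g i + sec h i" using g h H by (intro sec_add) (auto simp: S_St)
      moreover have "int p dvd i - int n \<longleftrightarrow> i mod int p = int n"
        using n by (metis mod_eq_dvd_iff)
      moreover have "x (int n) = x i" if "i mod int p = int n"
        using that n by (intro int_periodic_exact[of x, OF per]) (simp add: cong_def)
      ultimately show ?thesis by (auto simp: g h single_def)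
    qed
    moreover have "g + h \<in> H" using g h by (intro subgrp_add[OF normalizedD(1)[OF H(1)]])
    ultimately show ?case by blast
  qed
  from this[of p] show ?thesis using p_pos by simp
qed

text \<open>Both sections are powers of a away from i and i + m, hence commute there. At each of
  these two coordinates one section is a power of b and the other a power of a; their order is
  opposite, hence the minus sign.\<close>

lemma sec_cm_bb:
  assumes m: "\<not> int p dvd m"
  shows "sec (cm (zm u (bb i)) (zm v (bb (i + m)))) =
     single i (cm (zm u b) (zm (E (- m) * v) a)) - single (i + m) (cm (zm v b) (zm (E m * u) a))"
proof
  fix j
  let ?g = "cm (zm u (bb i)) (zm v (bb (i + m)))"
  have *: "sec ?g j = cm (zm u (sec (bb i) j)) (zm v (sec (bb (i + m)) j))"
    by (simp add: sec_cm sec_zm bb_St zm_in[OF subgrp_St])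
  consider "int p dvd j - i" "\<not> int p dvd j - (i + m)" | "\<not> int p dvd j - i" "int p dvd j - (i + m)"
    | "\<not> int p dvd j - i" "\<not> int p dvd j - (i + m)"
    using m dvd_diff[of "int p" "j - i" "j - (i + m)"] by fastforce
  then show "sec ?g j = (single i (cm (zm u b) (zm (E (- m) * v) a)) - single (i
      + m) (cm (zm v b) (zm (E m * u) a))) j"
  proof cases
    case 1
    then have "E (j - (i + m)) = E (- m)" by (intro E_cong) (simp add: cong_iff_dvd_diff)
    then show ?thesis using 1 unfolding * by (simp add: sec_bb single_def zm_mult)
  next
    case 2
    then have "E (j - i) = E m" by (intro E_cong) (simp add: cong_iff_dvd_diff algebra_simps)
    then show ?thesis using 2 unfolding * by (simp add: sec_bb single_def zm_mult minus_cm)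
  next
    case 3
    then show ?thesis unfolding * by (simp add: sec_bb single_def zm_mult[symmetric])
  qed
qed

lemma sec_zero_fun: "sec 0 = 0" by (simp add: fun_eq_iff)

lemma sec_add_fun: "g \<in> St \<Longrightarrow> h \<in> St \<Longrightarrow> sec (g + h) = sec g + sec h"
  by (simp add: fun_eq_iff sec_add)

lemma single_diff: "single i x - single i y = single i (x - y)" and single_zero [simp]:
    "single i 0 = 0"
  by (auto simp: single_def fun_eq_iff)

lemma der_S_subset_S: "der S \<subseteq> S" by (auto simp: der_S_S)

section \<open>Filling a single coordinate with G' from S', for non-symmetric exponents\<close>

lemma E_nonsym_wlog:
  assumes "\<not> (\<forall>m. E m \<simeq> E (- m))"
  obtains m where "\<not> int p dvd m" "\<not> E m \<simeq> E (- m)" "\<not> int p dvd E (- m)"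
proof -
  obtain m where m: "\<not> E m \<simeq> E (- m)" using assms by blast
  then have d: "\<not> int p dvd m" using E_cong[of m 0] E_cong[of "- m" 0] by (auto simp: cong_0_iff)
  show ?thesis
  proof (cases "int p dvd E (- m)")
    case True
    then have "\<not> int p dvd E m" using m by (metis cong_0_iff cong_sym cong_trans)
    then show ?thesis using m d by (intro that[of "- m"]) (auto dest: cong_sym)
  qed (use m d that in blast)
qed

text \<open>The difference is a conjugate of [-b, (w - v) a]. So b commutes with a nontrivial
  multiple of a modulo \<open>coord0 (der S)\<close>, hence with a itself.\<close>

lemma der_G_subset_coord0_if:
  assumes "cm b (zm v a) - cm b (zm w a) \<in> coord0 (der S)" "\<not> v \<simeq> w"
  shows "der G \<subseteq> coord0 (der S)"
proof -
  let ?N = "coord0 (der S)"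
  have N: "normalized G ?N" by (rule normalized_coord0[OF normalized_der_S der_S_subset_S])
  note N' = normalizedD(1)[OF N]
  have "cm b (zm v a) - cm b (zm w a) = (b + zm v a) + cm (- b) (zm (w - v) a) - (b + zm v a)"
  proof -
    have "zm (w - v) a = - zm v a + zm w a" "- zm (w - v) a = - zm w a + zm v a"
      using zm_add[of "- v" w a] zm_add[of "- w" v a] zm_minus[of "w - v" a]
      by (simp_all add: zm_minus[of v] zm_minus[of w])
    then show ?thesis unfolding cm_def diff_conv_add_uminus
      by (simp only: group_cancel_simps)
  qed
  then have "- (b + zm v a) + (cm b (zm v a) - cm b (zm w a)) + (b + zm v a) = cm (- b) (zm (w
      - v) a)"
    by (simp only: group_cancel_simps)
  then have "cm (- b) (zm (w - v) a) \<in> ?N"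
    using normalizedD(2)[OF N, of "b + zm v a" "cm b (zm v a) - cm b (zm w a)"] assms(1)
    by (simp add: G_closed)
  then have "- b \<in> {x \<in> G. cm x (zm (w - v) a) \<in> ?N}" by (simp add: G_closed)
  then have "- (- b) \<in> {x \<in> G. cm x (zm (w - v) a) \<in> ?N}"
    by (rule subgrp_minus[OF subgrp_centralizer[OF N subgrp_G]])
  then have "zm (w - v) a \<in> {x \<in> G. cm x b \<in> ?N}" using cm_swap_in[OF N'] by (simp add: G_closed)
  moreover have "\<not> int p dvd w - v" using assms(2) cong_sym
    by (auto simp: cong_iff_dvd_diff dvd_diff_commute)
  ultimately have "a \<in> {x \<in> G. cm x b \<in> ?N}"
    by (rule a_in_if_power_in[OF subgrp_centralizer[OF N subgrp_G]])
  then have "cm a b \<in> ?N" "cm b a \<in> ?N" using cm_swap_in[OF N'] by auto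
  then show ?thesis
    by (intro der_G_subsetI[OF N])
qed

text \<open>For non-symmetric \<open>E\<close>, the elements \<open>[u b\<^sub>i, v b\<^sub>i\<^sub>+\<^sub>m]\<close>, each supported on two
  coordinates, are chained around the cycle of length \<open>p\<close> such that everything cancels
  except at the starting coordinate.\<close>

lemma der_G_subset_coord0:
  assumes "\<not> (\<forall>m. E m \<simeq> E (- m))"
  shows "der G \<subseteq> coord0 (der S)"
proof -
  obtain m where m: "\<not> int p dvd m" "\<not> E m \<simeq> E (- m)" "\<not> int p dvd E (- m)"
    using E_nonsym_wlog[OF assms] .
  let ?X = "\<lambda>u v. cm (zm u b) (zm v a)"
  have comm: "cm (zm u (bb i)) (zm v (bb k)) \<in> der S" for u v i k by (intro cm_in_der S_closed)
  show ?thesis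
  proof (cases "int p dvd E m")
    case True
    then have "zm (E m * 1) a = 0" by (simp add: zm_a_eq_0)
    then have "sec (cm (zm 1 (bb 0)) (zm 1 (bb (0 + m)))) = single 0 (cm b (zm (E (- m)) a))"
      unfolding sec_cm_bb[OF m(1)] by simp
    then have "cm b (zm (E (- m)) a) \<in> coord0 (der S)" unfolding coord0_def using comm by blast
    then show ?thesis
      by (intro der_G_subset_coord0_if[of "E (- m)" 0]) (use m in \<open>simp_all add: cong_0_iff\<close>)
  next
    case False
    \<comment> \<open>\<open>r\<close> is the ratio E(m) / E(-m), invertible because the case E(m) =
      0, where one commutator already suffices, has been split off.\<close>
    obtain r where r: "r * E (- m) \<simeq> E m" using cong_solve[OF prime_p] m by (metis cong_0_iff)
    define k where "k = (p - 1) div 2"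
    have p: "p = 2 * k + 1" using odd_p by (auto simp: k_def elim: oddE)
    have r0: "\<not> int p dvd r" using r False by (metis cong_dvd_iff dvd_mult2)
    \<comment> \<open>Cancellation between neighbours requires u(t + 2) = r u(t), so even and odd t
      carry separate geometric progressions. The offset \<open>k\<close> on odd t makes u(p) = r^(p
      - 1) = 1 = u(0), so both surviving terms have first entry b.\<close>
    define u where "u t = r ^ (t div 2 + (if odd t then k else 0))" for t
    have u: "E m * u t \<simeq> E (- m) * u (t + 2)" for t
    proof -
      have "E m * u t \<simeq> (r * E (- m)) * u t" by (intro cong_mult cong_refl cong_sym[OF r])
      then show ?thesis by (simp add: u_def algebra_simps)
    qed
    have chain: "\<exists>g\<in>der S. sec g = single 0 (?X (u 0) (E (- m) * u 1))
       - single (int t * m) (?X (u t) (E (- m) * u (t + 1)))" for t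
    proof (induction t)
      case 0
      show ?case using subgrp_0[OF subgrp_der] by (intro bexI[of _ 0]) (simp_all add: sec_zero_fun)
    next
      case (Suc t)
      then obtain g where g: "g \<in> der S" "sec g = single 0 (?X (u 0) (E (- m) * u 1))
       - single (int t * m) (?X (u t) (E (- m) * u (t + 1)))" by blast
      let ?h = "cm (zm (u t) (bb (int t * m))) (zm (u (t + 1)) (bb (int t * m + m)))"
      have "zm (E m * u t) a = zm (E (- m) * u (t + 2)) a" by (rule zm_a_cong[OF u])
      then have h: "sec ?h = single (int t * m) (?X (u t) (E (- m) * u (t + 1)))
        - single (int t * m + m) (?X (u (t + 1)) (E (- m) * u (t + 2)))"
        unfolding sec_cm_bb[OF m(1)] by simp
      have "sec (g + ?h) = sec g + sec ?h"
        using g(1) comm by (intro sec_add_fun) (auto simp: der_S_S S_St)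
      also have "\<dots> = single 0 (?X (u 0) (E (- m) * u 1)) - single (int t * m + m) (?X (u (t
          + 1)) (E (- m) * u (t + 2)))"
        unfolding g h by (simp only: group_cancel_simps)
      finally have "sec (g + ?h) = single 0 (?X (u 0) (E (- m) * u 1))
         - single (int (Suc t) * m) (?X (u (Suc t)) (E (- m) * u (Suc t + 1)))"
        by (simp add: distrib_right add.commute[of m])
      moreover have "g + ?h \<in> der S" by (rule subgrp_add[OF subgrp_der g(1) comm])
      ultimately show ?case by blast
    qed
    have "single (int p * m) = single 0" by (rule single_cong) (simp add: cong_0_iff)
    then have "\<exists>g\<in>der S. sec g = single 0 (?X (u 0) (E (- m) * u 1) - ?X (u p) (E (- m) * u (p
        + 1)))"
      using chain[of p] by (simp only: single_diff)
    then have "?X (u 0) (E (- m) * u 1) - ?X (u p) (E (- m) * u (p + 1)) \<in> coord0 (der S)"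
      unfolding coord0_def by blast
    moreover have "?X (u 0) (E (- m) * u 1) = cm b (zm (E (- m) * r ^ k) a)" by (simp add: u_def)
    moreover have "?X (u p) (E (- m) * u (p + 1)) = cm b (zm (E m * r ^ k) a)"
    proof -
      have "u p \<simeq> 1"
      proof -
        have "coprime r (int p)"
          using prime_imp_coprime[OF prime_int_p r0] by (rule coprime_commute[THEN iffD1])
        then have "r ^ totient p \<simeq> 1"
          using residues.euler_theorem[of "int p" r] p_gt_2 by (simp add: residues_def)
        moreover have "p div 2 + k = p - 1" using p by simp
        ultimately show ?thesis using odd_p prime_p by (simp add: u_def totient_prime)
      qed
      then have "zm (u p) b = zm 1 b" by (rule zm_cong[OF zm_p_b])
      moreover have "u (p + 1) = r * r ^ k" unfolding u_def using p by simp
      then have "E (- m) * u (p + 1) \<simeq> E m * r ^ k"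
        using cong_mult[OF r cong_refl[of "r ^ k"]] by (simp add: algebra_simps)
      then have "zm (E (- m) * u (p + 1)) a = zm (E m * r ^ k) a" by (rule zm_a_cong)
      ultimately show ?thesis by simp
    qed
    moreover have "\<not> E (- m) * r ^ k \<simeq> E m * r ^ k"
    proof
      assume "E (- m) * r ^ k \<simeq> E m * r ^ k"
      then have "int p dvd (E (- m) - E m) * r ^ k"
        by (simp add: cong_iff_dvd_diff left_diff_distrib)
      then show False
        using m(2) r0 prime_dvd_power[OF prime_int_p] prime_dvd_mult_iff[OF prime_int_p]
        by (metis cong_iff_dvd_diff cong_sym)
    qed
    ultimately show ?thesis by (intro der_G_subset_coord0_if) simp_all
  qed
qed

section \<open>Filling a single coordinate with \<open>gamma3\<close> from G''\<close>

abbreviation D2 :: "'g set" where "D2 \<equiv> der (der G)"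

lemma D2_subset_der_S: "D2 \<subseteq> der S" by (rule der_mono) (auto simp: der_G_S)

lemma D2_S: "D2 \<subseteq> S" using D2_subset_der_S der_S_subset_S by blast

lemma normalized_D2: "normalized G D2" by (rule normalized_der[OF normalized_der_G subgrp_G])

lemma coord0_D2_cm:
  assumes "g \<in> der G" "s \<in> der G" "\<And>i. \<not> int p dvd i \<Longrightarrow> sec g i = 0 \<or> sec s i = 0"
  shows "cm (sec g 0) (sec s 0) \<in> coord0 D2"
proof -
  have "sec (cm g s) i = single 0 (cm (sec g 0) (sec s 0)) i" for i
    using assms(3)[of i] sec_cong[of i 0 g] sec_cong[of i 0 s] assms(1,2)
    by (auto simp: sec_cm der_G_S S_St single_def cong_0_iff)
  then show ?thesis using cm_in_der[OF assms(1,2)] unfolding coord0_def by blast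
qed

lemma bb_diff_der_G: "bb i - bb j \<in> der G"
proof -
  have "alpha (bb i - bb j) \<simeq> alpha (bb i) - alpha (bb j)"
    "beta (bb i - bb j) \<simeq> beta (bb i) - beta (bb j)"
    by (intro hom_mod_diff[OF hom_mod_alpha] hom_mod_diff[OF hom_mod_beta] bb_G)+
  moreover have "alpha (bb i) - alpha (bb j) \<simeq> 0 - 0" "beta (bb i) - beta (bb j) \<simeq> 1 - 1"
    by (intro cong_diff alpha_bb beta_bb)+
  ultimately show ?thesis using bb_G G_closed(2) by (auto simp: der_G_iff intro: cong_trans)
qed

lemma sec_bb_diff: "sec (bb i - bb j) k = sec (bb i) k - sec (bb j) k"
  by (simp add: sec_diff bb_St)

text \<open>The two hypotheses make [b, i a] commute with a and b, so it is central modulo N =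
  \<open>coord0 D2\<close>. To get from i a to a, read this as: b and i a commute modulo the
  preimage of the centre; then so do b and a, and [b, a] is central modulo N.\<close>

lemma gamma3_subset_coord0_if:
  assumes i: "\<not> int p dvd i" and r: "\<not> int p dvd r"
    and 1: "cm (cm b (zm i a)) (zm r a) \<in> coord0 D2"
    and 2: "cm (cm b (zm i a)) (b + zm s a) \<in> coord0 D2"
  shows "gamma3 \<subseteq> coord0 D2"
proof -
  let ?N = "coord0 D2" and ?x = "cm b (zm i a)"
  have N: "normalized G ?N" by (rule normalized_coord0[OF normalized_D2 D2_S])
  note N' = normalizedD(1)[OF N]
  let ?C = "{y \<in> G. cm y ?x \<in> ?N}"
  have C: "subgrp ?C" by (rule subgrp_centralizer[OF N subgrp_G])
  have "zm r a \<in> ?C" "b + zm s a \<in> ?C" using 1 2 cm_swap_in[OF N'] by (auto simp: G_closed)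
  moreover from this have a: "a \<in> ?C" using a_in_if_power_in[OF C _ r] by blast
  ultimately have "b + zm s a - zm s a \<in> ?C" by (intro subgrp_diff[OF C] zm_in[OF C])
  then have b: "b \<in> ?C" by simp
  \<comment> \<open>The preimage in G of the centre modulo \<open>coord0 D2\<close>.\<close>
  define Z where "Z = {x \<in> G. \<forall>y\<in>G. cm x y \<in> ?N}"
  have Z': "subgrp Z"
  proof (rule subgrpI)
    show "0 \<in> Z" using subgrp_0[OF N'] by (simp add: Z_def G_closed)
    show "x - y \<in> Z" if "x \<in> Z" "y \<in> Z" for x y
      using that subgrp_diff[OF subgrp_centralizer[OF N subgrp_G]] unfolding Z_def by blast
  qed
  have Z: "normalized G Z"
    unfolding normalized_def
  proof (intro conjI Z' ballI)
    show "- g + x + g \<in> Z" if g: "g \<in> G" and x: "x \<in> Z" for g x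
    proof -
      have "cm (- x) (- g) \<in> ?N"
        using x g subgrp_minus[OF subgrp_centralizer[OF N subgrp_G], of x "- g"]
        unfolding Z_def by (simp add: G_closed)
      then have "cm (- x) (- g) \<in> Z"
        using x g normalized_cm(2)[OF N subgrp_G] unfolding Z_def by (simp add: G_closed)
      with x have "x + cm (- x) (- g) \<in> Z" by (rule subgrp_add[OF Z'])
      also have "x + cm (- x) (- g) = - g + x + g" by (simp only: cm_def group_cancel_simps)
      finally show ?thesis .
    qed
  qed
  have "G \<subseteq> ?C" unfolding G_def using a b gen_subset[OF C, of "{a, b}"] by (simp add: G_def)
  then have "?x \<in> Z" using cm_swap_in[OF N'] by (auto simp: Z_def G_closed)
  then have "zm i a \<in> {y \<in> G. cm y b \<in> Z}" using cm_swap_in[OF normalizedD(1)[OF Z]]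
    by (auto simp: G_closed)
  then have "a \<in> {y \<in> G. cm y b \<in> Z}"
    by (rule a_in_if_power_in[OF subgrp_centralizer[OF Z subgrp_G] _ i])
  then have "cm b a \<in> Z" using cm_swap_in[OF normalizedD(1)[OF Z]] by blast
  then show ?thesis by (intro gamma3_subset[OF N]) (auto simp: Z_def a_G b_G)
qed

text \<open>Here [b, a] occurs alone at coordinate 0, so the other coordinates of its partners do
  not matter. Differences of letters supply the partners, and non-constancy makes one of their
  sections a nontrivial power of a.\<close>

lemma gamma3_subset_coord0_nonsym:
  assumes "\<not> (\<forall>m. E m \<simeq> E (- m))"
  shows "gamma3 \<subseteq> coord0 D2"
proof -
  have "cm b a \<in> coord0 (der S)" using der_G_subset_coord0[OF assms] c_der_G by blast
  then obtain g where g: "g \<in> der G" "sec g = single 0 (cm b a)"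
    using der_S_der_G by (auto simp: coord0_def)
  have g0: "sec g 0 = cm b a" "\<And>i. \<not> int p dvd i \<Longrightarrow> sec g i = 0" using g(2)
    by (simp_all add: single_def)
  obtain i j where ij: "\<not> int p dvd i" "\<not> int p dvd j" "\<not> E i \<simeq> E j" using E_nonconst by blast
  have "cm (cm b (zm 1 a)) (zm (E i - E j) a) \<in> coord0 D2"
    using coord0_D2_cm[OF g(1) bb_diff_der_G[of "- i" "- j"]] ij g0
    by (simp add: sec_bb_diff sec_bb zm_diff)
  moreover have "cm (cm b (zm 1 a)) (b + zm (- E i) a) \<in> coord0 D2"
    using coord0_D2_cm[OF g(1) bb_diff_der_G[of 0 "- i"]] ij g0
    by (simp add: sec_bb_diff sec_bb zm_minus del: bb_0)
  moreover have "\<not> int p dvd E i - E j" using ij by (simp add: cong_iff_dvd_diff)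
  ultimately show ?thesis using not_dvd_1 by (intro gamma3_subset_coord0_if[of 1])
qed

text \<open>For symmetric E, [b, a] cannot occur alone in psi(S'), as the \<open>T\<close>-values of
  sections must sum to 0. Instead [b_0, b_m] is used, supported on 0 and m, with partners trivial at
  m: by symmetry b_j and b_(2m-j) have equal sections at m, and so have b_0 and b_(2m).\<close>

lemma gamma3_subset_coord0_sym:
  assumes sym: "\<And>m. E m \<simeq> E (- m)"
  shows "gamma3 \<subseteq> coord0 D2"
proof -
  have zE: "zm (E i) a = zm (E (- i)) a" for i by (rule zm_a_cong[OF sym])
  obtain m where m: "\<not> int p dvd m" "\<not> int p dvd E m" using E_nonzero by blast
  have m2: "\<not> int p dvd 2 * m" using m not_dvd_2 prime_int_p by (simp add: prime_dvd_mult_iff)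
  let ?g = "cm (zm 1 (bb 0)) (zm 1 (bb (0 + m)))"
  have "?g \<in> der S" by (intro cm_in_der S_closed)
  then have g: "?g \<in> der G" using der_S_der_G by blast
  have s0: "sec ?g 0 = cm b (zm (E (- m)) a)"
    unfolding sec_cm_bb[OF m(1)] using m(1) by (simp add: single_def)
  have si: "sec ?g i = 0" if "\<not> int p dvd i" "\<not> int p dvd i - m" for i
    unfolding sec_cm_bb[OF m(1)] using that by (simp add: single_def)
  have cm_s: "cm (cm b (zm (E (- m)) a)) (sec s 0) \<in> coord0 D2" if "s \<in> der G" "sec s m = 0" for s
    using coord0_D2_cm[OF g that(1)] si that(2) sec_cong[of _ m s] s0 by (metis cong_iff_dvd_diff)
  \<comment> \<open>Otherwise E would be constant along 2m, 4m, ..., (p - 1) 2m, which are all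
    nonzero residues. At the excluded index j = m the equality holds by symmetry.\<close>
  have "\<exists>j. \<not> int p dvd j \<and> \<not> int p dvd j - m \<and> \<not> int p dvd j - 2 * m \<and> \<not> E j \<simeq> E (j - 2 * m)"
  proof (rule ccontr)
    assume *: "\<not> ?thesis"
    have e: "E j \<simeq> E (j - 2 * m)" if "\<not> int p dvd j" "\<not> int p dvd j - 2 * m" for j
    proof (cases "int p dvd j - m")
      case True
      then have "E j = E m" "E (j - 2 * m) = E (- m)"
        by (intro E_cong; simp add: cong_iff_dvd_diff)+
      then show ?thesis using sym by simp
    qed (use * that in blast)
    have c: "E (int t * (2 * m)) \<simeq> E (2 * m)" if "0 < t" "t < p" for t
      using that
    proof (induction t)
      case (Suc t)
      show ?case
      proof (cases "t = 0")
        case False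
        have "\<not> int p dvd int t" "\<not> int p dvd int (Suc t)"
          using Suc.prems False by (auto simp del: of_nat_Suc dest: zdvd_imp_le dvd_imp_le)
        then have "\<not> int p dvd int t * (2 * m)" "\<not> int p dvd int (Suc t) * (2 * m)"
          using m2 prime_dvd_mult_iff[OF prime_int_p] by blast+
        then have "E (int (Suc t) * (2 * m)) \<simeq> E (int (Suc t) * (2 * m) - 2 * m)"
          by (intro e) (simp_all add: algebra_simps)
        also have "int (Suc t) * (2 * m) - 2 * m = int t * (2 * m)" by (simp add: algebra_simps)
        also have "E (int t * (2 * m)) \<simeq> E (2 * m)" using Suc False by simp
        finally show ?thesis .
      qed simp
    qed simp
    have "E i \<simeq> E (2 * m)" if i: "\<not> int p dvd i" for i
    proof -
      obtain x where x: "x * (2 * m) \<simeq> i"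
        using cong_solve[OF prime_p] m2 by (metis cong_0_iff)
      define t where "t = nat (x mod int p)"
      have t: "int t = x mod int p" using p_pos by (simp add: t_def)
      have ti: "int t * (2 * m) \<simeq> i"
        using x unfolding t by (metis cong_def mod_mult_left_eq)
      have "t \<noteq> 0"
      proof
        assume "t = 0"
        then show False using cong_sym[OF ti] i by (simp add: cong_0_iff)
      qed
      moreover have "t < p" using t p_pos by (metis of_nat_0_less_iff of_nat_less_iff pos_mod_bound)
      ultimately show ?thesis using c[of t] unfolding E_cong[OF ti] by blast
    qed
    then show False using E_nonconst by (metis cong_sym cong_trans)
  qed
  then obtain j where j: "\<not> int p dvd j" "\<not> int p dvd j - m" "\<not> int p dvd j - 2 * m"
      "\<not> E j \<simeq> E (j - 2 * m)" by blast
  have d: "\<not> int p dvd m - j" "\<not> int p dvd 2 * m - j" using j by (simp_all add: dvd_diff_commute)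
  have zj: "zm (E (m - j)) a = zm (E (j - m)) a" using zE[of "m - j"] by simp
  have "cm (cm b (zm (E (- m)) a)) (zm (E (- j)) a - zm (E (j - 2 * m)) a) \<in> coord0 D2"
    using cm_s[OF bb_diff_der_G[of j "2 * m - j"]] j d zj by (simp add: sec_bb_diff sec_bb)
  then have "cm (cm b (zm (E (- m)) a)) (zm (E j - E (j - 2 * m)) a) \<in> coord0 D2"
    using zE[of j] by (simp add: zm_diff)
  moreover have "cm (cm b (zm (E (- m)) a)) (b + zm (- E (- (2 * m))) a) \<in> coord0 D2"
    using cm_s[OF bb_diff_der_G[of 0 "2 * m"]] m m2 zE[of m]
    by (simp add: sec_bb_diff sec_bb zm_minus del: bb_0)
  moreover have "\<not> int p dvd E j - E (j - 2 * m)" using j by (simp add: cong_iff_dvd_diff)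
  moreover have "\<not> int p dvd E (- m)" using m sym[of m] by (metis cong_dvd_iff)
  ultimately show ?thesis by (intro gamma3_subset_coord0_if)
qed

lemma gamma3_subset_coord0: "gamma3 \<subseteq> coord0 D2"
  using gamma3_subset_coord0_nonsym gamma3_subset_coord0_sym by blast

section \<open>The second derived subgroup\<close>

text \<open>The direct power H^p, with tuples written as periodic functions on the integers.\<close>

definition periodic_in :: "'g set \<Rightarrow> (int \<Rightarrow> 'g) set" where
  "periodic_in H = {x. (\<forall>i. x i \<in> H) \<and> (\<forall>i. x (i + int p) = x i)}"

lemma subgrp_periodic_in: "subgrp H \<Longrightarrow> subgrp (periodic_in H)"
  by (rule subgrpI) (simp_all add: periodic_in_def subgrp_closed)

lemma sec_periodic_in: "g \<in> S \<Longrightarrow> (\<And>i. sec g i \<in> H) \<Longrightarrow> sec g \<in> periodic_in H"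
  by (simp add: periodic_in_def sec_periodic)

lemma T_cong_diff:
  assumes "x \<in> der G" "y \<in> der G" "T x \<simeq> T y"
  shows "x - y \<in> gamma3"
proof -
  have "T (x - y) \<simeq> T x - T y" by (rule hom_mod_diff[OF hom_mod_T_der_G assms(1,2)])
  also have "T x - T y \<simeq> 0" using assms(3) by (simp add: cong_diff_iff_cong_0)
  finally show ?thesis using subgrp_diff[OF subgrp_der] assms by (simp add: gamma3_def)
qed

lemma T_zm_c: "T (zm k (cm b a)) \<simeq> k"
proof -
  have "T (zm k (cm b a)) \<simeq> k * T (cm b a)" by (rule hom_mod_zm[OF hom_mod_T_der_G c_der_G])
  also have "k * T (cm b a) \<simeq> k * 1" by (intro cong_mult cong_refl T_c)
  finally show ?thesis by simp
qed

definition sec_T :: "'g \<Rightarrow> int \<Rightarrow> int" where "sec_T g i = T (sec g i)"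

lemma periodic_sec_T: "periodic p (sec_T g)" by (simp add: periodic_def sec_T_def sec_periodic)

lemma hom_mod_sec_T: "hom_mod (der S) (\<lambda>g. sec_T g i)"
  unfolding hom_mod_def sec_T_def
proof (intro conjI ballI subgrp_der)
  fix x y assume xy: "x \<in> der S" "y \<in> der S"
  then have "sec (x + y) i = sec x i + sec y i" by (intro sec_add) (auto simp: der_S_S S_St)
  then show "T (sec (x + y) i) \<simeq> T (sec x i) + T (sec y i)"
    using xy by (simp add: hom_mod_add[OF hom_mod_T_der_G] sec_der_S)
qed

lemma hom_mod_moment: "hom_mod (der S) (\<lambda>g. moment p s (sec_T g))"
  unfolding moment_def by (intro hom_mod_sum hom_mod_sec_T subgrp_der)

definition sec_code :: "(int \<Rightarrow> int) set" where
  "sec_code = {w. \<exists>g\<in>D2. \<forall>i. w i \<simeq> sec_T g i}"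

lemma D2_der_S: "g \<in> D2 \<Longrightarrow> g \<in> der S" using D2_subset_der_S by blast

lemma cyclic_code_sec_code: "cyclic_code p sec_code"
  unfolding cyclic_code_def
proof (intro conjI ballI allI impI)
  show "(\<lambda>i. 0) \<in> sec_code"
    unfolding sec_code_def using subgrp_0[OF subgrp_der] hom_mod_0[OF hom_mod_sec_T]
    by (auto intro!: bexI[of _ 0] intro: cong_sym)
  fix v w assume "v \<in> sec_code" "w \<in> sec_code"
  then obtain g h where g: "g \<in> D2" "\<And>i. v i \<simeq> sec_T g i"
    and h: "h \<in> D2" "\<And>i. w i \<simeq> sec_T h i" by (auto simp: sec_code_def)
  note gS = D2_der_S[OF g(1)] and hS = D2_der_S[OF h(1)]
  fix x y
  have "x * v i + y * w i \<simeq> sec_T (zm x g + zm y h) i" for i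
  proof -
    have "x * v i + y * w i \<simeq> x * sec_T g i + y * sec_T h i"
      by (intro cong_add cong_mult cong_refl g h)
    also have "x * sec_T g i + y * sec_T h i \<simeq> sec_T (zm x g) i + sec_T (zm y h) i"
      by (intro cong_add cong_sym[OF hom_mod_zm[OF hom_mod_sec_T]] gS hS)
    also have "sec_T (zm x g) i + sec_T (zm y h) i \<simeq> sec_T (zm x g + zm y h) i"
      by (intro cong_sym[OF hom_mod_add[OF hom_mod_sec_T]] zm_in[OF subgrp_der] gS hS)
    finally show ?thesis .
  qed
  moreover have "zm x g + zm y h \<in> D2" by (intro subgrp_add[OF subgrp_der] zm_in[OF subgrp_der] g h)
  ultimately show "(\<lambda>i. x * v i + y * w i) \<in> sec_code" unfolding sec_code_def by blast
next
  fix v assume "v \<in> sec_code"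
  then obtain g where g: "g \<in> D2" "\<And>i. v i \<simeq> sec_T g i" by (auto simp: sec_code_def)
  \<comment> \<open>Conjugation by the inverse of a shifts the coordinates by one, which makes the
    code cyclic.\<close>
  have "sec (- zm (- 1) a + g + zm (- 1) a) i = sec g (i + 1)" for i
    using conj_zm_a(2)[of g "- 1" i] g D2_S by (auto simp: S_St)
  then have "v (i + 1) \<simeq> sec_T (- zm (- 1) a + g + zm (- 1) a) i" for i
    using g(2) by (simp add: sec_T_def)
  moreover have "- zm (- 1) a + g + zm (- 1) a \<in> D2"
    by (intro normalizedD(2)[OF normalized_D2] g zm_in[OF subgrp_G] a_G)
  ultimately show "(\<lambda>i. v (i + 1)) \<in> sec_code" unfolding sec_code_def by blast
  fix w assume "\<forall>i. v i \<simeq> w i"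
  then have "w i \<simeq> sec_T g i" for i using g(2) cong_sym cong_trans by blast
  then show "w \<in> sec_code" using g unfolding sec_code_def by blast
qed

lemma sec_code_imp_D2:
  assumes x: "x \<in> periodic_in (der G)" and c: "(\<lambda>i. T (x i)) \<in> sec_code"
  shows "x \<in> sec ` D2"
proof -
  obtain g where g: "g \<in> D2" "\<And>i. T (x i) \<simeq> T (sec g i)" using c
    by (auto simp: sec_code_def sec_T_def)
  have "x i - sec g i \<in> coord0 D2" for i
    using x g(2) sec_der_S[OF D2_der_S[OF g(1)]] gamma3_subset_coord0
    by (auto simp: periodic_in_def intro!: subsetD[OF gamma3_subset_coord0] T_cong_diff)
  then obtain h where h: "h \<in> D2" "sec h = (\<lambda>i. x i - sec g i)"
    using coord0_all[OF normalized_D2 D2_S, of "\<lambda>i. x i - sec g i"] x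
    by (auto simp: periodic_in_def sec_periodic)
  have "sec (h + g) i = x i" for i
    using sec_add[OF S_St S_St, of h g i] subsetD[OF D2_S] g(1) h by simp
  then have "sec (h + g) = x" by blast
  moreover have "h + g \<in> D2" by (intro subgrp_add[OF subgrp_der] g h)
  ultimately show ?thesis by blast
qed

text \<open>The antisymmetric matrix through which moments of commutators depend on letter counts;
  see \<open>moment_cm\<close>.\<close>

definition form :: "nat \<Rightarrow> int \<Rightarrow> int \<Rightarrow> int" where
  "form s i k = i ^ s * E (i - k) - k ^ s * E (k - i)"

text \<open>\<open>T_cm\<close> is applied at each coordinate, with the exponents of a expanded by
  \<open>alpha_sec\<close>; exchanging the indices in the second double sum merges both into one
  form.\<close>

lemma moment_cm:
  assumes g: "g \<in> S" and h: "h \<in> S"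
  shows "moment p s (sec_T (cm g h)) \<simeq>
     (\<Sum>i\<in>Zp. \<Sum>k\<in>Zp. form s i k * kappa g i * kappa h k)"
proof -
  let ?u = "kappa g" and ?w = "kappa h"
  have "sec_T (cm g h) i \<simeq> (\<Sum>k\<in>Zp. E (i - k) * ?w k) * ?u i - (\<Sum>k\<in>Zp. E (i - k) * ?u k) * ?w i"
      for i
  proof -
    have "sec_T (cm g h) i = T (cm (sec g i) (sec h i))" by (simp add: sec_T_def sec_cm S_St g h)
    also have "\<dots> \<simeq> alpha (sec h i) * ?u i - alpha (sec g i) * ?w i"
      unfolding kappa_def by (rule T_cm) (intro sec_G g h)+
    also have "alpha (sec h i) * ?u i - alpha (sec g i) * ?w i
       \<simeq> (\<Sum>k\<in>Zp. E (i - k) * ?w k) * ?u i - (\<Sum>k\<in>Zp. E (i - k) * ?u k) * ?w i"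
      by (intro cong_diff cong_mult cong_refl alpha_sec g h)
    finally show ?thesis .
  qed
  from moment_cong[OF this, of s]
  have "moment p s (sec_T (cm g h)) \<simeq> moment p s (\<lambda>i. (\<Sum>k\<in>Zp. E (i - k) * ?w k) * ?u i
      - (\<Sum>k\<in>Zp. E (i - k) * ?u k) * ?w i)" .
  also have "moment p s (\<lambda>i. (\<Sum>k\<in>Zp. E (i - k) * ?w k) * ?u i - (\<Sum>k\<in>Zp. E (i - k) * ?u k) * ?w i)
      = (\<Sum>i\<in>Zp. \<Sum>k\<in>Zp. i ^ s * E (i - k) * ?u i * ?w k) - (\<Sum>i\<in>Zp. \<Sum>k\<in>Zp. i ^ s * E (i - k) * ?w i
          * ?u k)"
    by (simp add: moment_def right_diff_distrib sum_subtractf sum_distrib_left sum_distrib_right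
        mult_ac)
  also have "(\<Sum>i\<in>Zp. \<Sum>k\<in>Zp. i ^ s * E (i - k) * ?w i * ?u k) = (\<Sum>i\<in>Zp. \<Sum>k\<in>Zp. k ^ s * E (k - i)
      * ?u i * ?w k)"
    by (subst sum.swap) (simp add: mult_ac)
  also have "(\<Sum>i\<in>Zp. \<Sum>k\<in>Zp. i ^ s * E (i - k) * ?u i * ?w k) - \<dots>
      = (\<Sum>i\<in>Zp. \<Sum>k\<in>Zp. form s i k * ?u i * ?w k)"
    by (simp add: form_def left_diff_distrib sum_subtractf)
  finally show ?thesis .
qed

text \<open>Letter counts of elements of G' sum to 0, which annihilates every term depending on one
  index alone.\<close>

lemma moment_cm_separable:
  assumes g: "g \<in> der G" and h: "h \<in> der G"
    and q: "\<And>i k. form s i k \<simeq> A i + B k"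
  shows "moment p s (sec_T (cm g h)) \<simeq> 0"
proof -
  let ?u = "kappa g" and ?w = "kappa h"
  have z: "(\<Sum>i\<in>Zp. kappa x i) \<simeq> 0" if "x \<in> der G" for x
    using beta_kappa[OF der_G_S[OF that]] that
    by (auto simp: der_G_iff moment_def intro: cong_trans[OF cong_sym])
  have "moment p s (sec_T (cm g h)) \<simeq> (\<Sum>i\<in>Zp. \<Sum>k\<in>Zp. form s i k * ?u i * ?w k)"
    by (intro moment_cm der_G_S g h)
  also have "(\<Sum>i\<in>Zp. \<Sum>k\<in>Zp. form s i k * ?u i * ?w k) \<simeq> (\<Sum>i\<in>Zp. \<Sum>k\<in>Zp. (A i + B k) * ?u i * ?w k)"
    by (intro cong_sum cong_mult cong_refl q)
  also have "(\<Sum>i\<in>Zp. \<Sum>k\<in>Zp. (A i + B k) * ?u i * ?w k)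
      = (\<Sum>i\<in>Zp. A i * ?u i) * (\<Sum>k\<in>Zp. ?w k) + (\<Sum>i\<in>Zp. ?u i) * (\<Sum>k\<in>Zp. B k * ?w k)"
    unfolding sum_product sum.distrib[symmetric] by (intro sum.cong refl) (simp add: algebra_simps)
  also have "\<dots> \<simeq> (\<Sum>i\<in>Zp. A i * ?u i) * 0 + 0 * (\<Sum>k\<in>Zp. B k * ?w k)"
    by (intro cong_add cong_mult cong_refl z g h)
  finally show ?thesis by simp
qed

text \<open>The condition sym(e'') = 1, by \<open>odd_linear_iff\<close>, in the form that makes the
  matrix \<open>form 0\<close> separable.\<close>

definition odd_linear :: bool where "odd_linear \<longleftrightarrow> (\<exists>l. \<forall>m. E m - E (- m) \<simeq> l * m)"

text \<open>The condition con(e') = 1, by \<open>affine_exps_iff\<close>. Multiples of p are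
  excluded because E is 0 there by convention.\<close>

definition affine_exps :: bool where "affine_exps \<longleftrightarrow> (\<exists>l c. \<forall>m. \<not> int p dvd m \<longrightarrow> E m \<simeq> l * m + c)"

lemma E_dvd: "int p dvd m \<Longrightarrow> E m = 0"
  using E_cong[of m 0] E_0 by (simp add: cong_0_iff)

lemma affine_exps_odd_linear: "affine_exps \<Longrightarrow> odd_linear"
proof -
  assume affine_exps
  then obtain l c where l: "\<And>m. \<not> int p dvd m \<Longrightarrow> E m \<simeq> l * m + c" by (auto simp: affine_exps_def)
  have "E m - E (- m) \<simeq> (2 * l) * m" for m
  proof (cases "int p dvd m")
    case True
    then show ?thesis by (simp add: E_dvd cong_iff_dvd_diff)
  next
    case False
    then have "E m - E (- m) \<simeq> (l * m + c) - (l * (- m) + c)" by (intro cong_diff l) auto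
    then show ?thesis by (simp add: algebra_simps)
  qed
  then show odd_linear unfolding odd_linear_def by blast
qed

lemma D2_moment_if:
  assumes "\<And>g h. g \<in> der G \<Longrightarrow> h \<in> der G \<Longrightarrow> moment p s (sec_T (cm g h)) \<simeq> 0" and "g \<in> D2"
  shows "moment p s (sec_T g) \<simeq> 0"
proof -
  have "D2 \<subseteq> {g \<in> der S. moment p s (sec_T g) \<simeq> 0}"
    by (intro der_subsetI subgrp_hom_mod_ker hom_mod_moment) (use assms(1) in \<open>auto intro:
        D2_der_S cm_in_der\<close>)
  then show ?thesis using assms(2) by blast
qed

lemma D2_moment_0:
  assumes odd_linear "g \<in> D2"
  shows "moment p 0 (sec_T g) \<simeq> 0"
proof (rule D2_moment_if[OF _ assms(2)])
  obtain l where l: "\<And>m. E m - E (- m) \<simeq> l * m" using assms(1) by (auto simp: odd_linear_def)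
  have "form 0 i k \<simeq> l * i + (- l) * k" for i k
    using l[of "i - k"] by (simp add: form_def algebra_simps)
  then show "moment p 0 (sec_T (cm g h)) \<simeq> 0" if "g \<in> der G" "h \<in> der G" for g h
    by (rule moment_cm_separable[OF that])
qed

lemma D2_moment_1:
  assumes affine_exps "g \<in> D2"
  shows "moment p 1 (sec_T g) \<simeq> 0"
proof (rule D2_moment_if[OF _ assms(2)])
  obtain l c where l: "\<And>m. \<not> int p dvd m \<Longrightarrow> E m \<simeq> l * m + c" using assms(1)
    by (auto simp: affine_exps_def)
  \<comment> \<open>The mixed terms in i k cancel. On the diagonal, where E is 0 instead of c, both
    sides vanish modulo p.\<close>
  have "form 1 i k \<simeq> (l * i ^ 2 + c * i) + (- (l * k ^ 2 + c * k))" for i k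
  proof (cases "int p dvd i - k")
    case True
    then have "form 1 i k = 0" by (simp add: form_def E_dvd dvd_diff_commute)
    moreover have "(l * i ^ 2 + c * i) + (- (l * k ^ 2 + c * k)) = (i - k) * (l * (i + k) + c)"
      by (simp add: algebra_simps power2_eq_square)
    ultimately show ?thesis using True by (simp add: cong_iff_dvd_diff)
  next
    case False
    then have "form 1 i k \<simeq> i * (l * (i - k) + c) - k * (l * (k - i) + c)"
      unfolding form_def power_one_right
      by (intro cong_diff cong_mult cong_refl l) (auto simp: dvd_diff_commute)
    then show ?thesis by (simp add: algebra_simps power2_eq_square)
  qed
  then show "moment p 1 (sec_T (cm g h)) \<simeq> 0" if "g \<in> der G" "h \<in> der G" for g h
    by (rule moment_cm_separable[OF that])
qed

section \<open>Commutators in G'' with prescribed nonzero moments\<close>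

lemma sum_delta_cong:
  assumes "periodic p f"
  shows "(\<Sum>j\<in>Zp. f j * of_bool (int p dvd j - k)) \<simeq> f k"
proof -
  have "(\<Sum>j\<in>Zp. f j * of_bool (int p dvd j - k)) = (\<Sum>j\<in>{k mod int p}. f j)"
    using p_pos by (intro sum.mono_neutral_cong_right) (auto simp flip: mod_eq_dvd_iff)
  then show ?thesis using periodic_mod[OF assms, of k] by simp
qed

lemma kappa_bb_diff:
  "kappa (bb j - bb k) i \<simeq> of_bool (int p dvd i - j) - of_bool (int p dvd i - k)"
proof -
  have "kappa (bb j - bb k) i \<simeq> kappa (bb j) i - kappa (bb k) i"
    by (intro hom_mod_diff[OF hom_mod_kappa] bb_S)
  also have "kappa (bb j) i - kappa (bb k) i \<simeq> of_bool (int p dvd i - j) - of_bool (int p dvd i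
      - k)"
    by (intro cong_diff kappa_bb)
  finally show ?thesis .
qed

lemma periodic_form: "periodic p (\<lambda>i. form s i k)" "periodic p (form s i)"
proof -
  have 1: "periodic p (\<lambda>i. E (i - k))" for k using E_periodic
    by (simp add: periodic_def add_diff_eq[symmetric] add.commute[of _ "int p"] diff_add_eq)
  have 2: "periodic p (\<lambda>i. E (k - i))" for k
    unfolding periodic_def
  proof
    fix i
    have "E (k - (i + int p)) = E (k - i)" by (rule E_cong) (simp add: cong_iff_dvd_diff)
    then show "E (k - (i + int p)) \<simeq> E (k - i)" by simp
  qed
  show "periodic p (\<lambda>i. form s i k)" "periodic p (form s i)"
    unfolding form_def by (intro periodic_intros periodic_power 1 2)+
qed

text \<open>The letter counts are differences of neighbouring unit vectors, so the moment is a mixed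
  second difference of the matrix; such differences vanish on separable matrices.\<close>

lemma moment_cm_bb:
  "moment p s (sec_T (cm (bb j - bb (j + 1)) (bb 0 - bb 1)))
     \<simeq> form s j 0 - form s j 1 - (form s (j + 1) 0 - form s (j + 1) 1)"
proof -
  let ?g = "bb j - bb (j + 1)" and ?h = "bb 0 - bb 1"
  define d where "d k i = (of_bool (int p dvd i - k) :: int)" for k i
  have inner: "(\<Sum>k\<in>Zp. form s i k * kappa ?h k) \<simeq> form s i 0 - form s i 1" for i
  proof -
    have "(\<Sum>k\<in>Zp. form s i k * kappa ?h k) \<simeq> (\<Sum>k\<in>Zp. form s i k * (d 0 k - d 1 k))"
      unfolding d_def by (intro cong_sum cong_mult cong_refl kappa_bb_diff)
    also have "(\<Sum>k\<in>Zp. form s i k * (d 0 k - d 1 k)) = (\<Sum>k\<in>Zp. form s i k * d 0 k)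
        - (\<Sum>k\<in>Zp. form s i k * d 1 k)"
      by (simp add: right_diff_distrib sum_subtractf)
    also have "\<dots> \<simeq> form s i 0 - form s i 1"
      unfolding d_def by (intro cong_diff sum_delta_cong periodic_form)
    finally show ?thesis .
  qed
  let ?f = "\<lambda>i. form s i 0 - form s i 1"
  have per: "periodic p ?f" by (intro periodic_diff periodic_form)
  have "moment p s (sec_T (cm ?g ?h)) \<simeq> (\<Sum>i\<in>Zp. \<Sum>k\<in>Zp. form s i k * kappa ?g i * kappa ?h k)"
    by (intro moment_cm S_closed)
  also have "(\<Sum>i\<in>Zp. \<Sum>k\<in>Zp. form s i k * kappa ?g i * kappa ?h k)
      = (\<Sum>i\<in>Zp. (\<Sum>k\<in>Zp. form s i k * kappa ?h k) * kappa ?g i)"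
    unfolding sum_distrib_right by (intro sum.cong refl) (simp add: mult_ac)
  also have "\<dots> \<simeq> (\<Sum>i\<in>Zp. ?f i * (d j i - d (j + 1) i))"
    unfolding d_def by (intro cong_sum cong_mult inner kappa_bb_diff)
  also have "(\<Sum>i\<in>Zp. ?f i * (d j i - d (j + 1) i)) = (\<Sum>i\<in>Zp. ?f i * d j i) - (\<Sum>i\<in>Zp. ?f i * d (j
      + 1) i)"
    by (simp only: right_diff_distrib sum_subtractf)
  also have "\<dots> \<simeq> ?f j - ?f (j + 1)"
    unfolding d_def by (intro cong_diff sum_delta_cong per)
  finally show ?thesis .
qed

lemma cm_bb_D2: "cm (bb j - bb (j + 1)) (bb 0 - bb 1) \<in> D2"
  by (intro cm_in_der bb_diff_der_G)

lemma sec_T_in_code: "g \<in> D2 \<Longrightarrow> sec_T g \<in> sec_code"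
  unfolding sec_code_def using cong_refl by blast

lemma cong_all_residues:
  assumes "\<And>n. f (int n) \<simeq> h (int n)" "periodic p f" "periodic p h"
  shows "f m \<simeq> h m"
proof -
  have "f m \<simeq> f (m mod int p)" by (rule cong_sym[OF periodic_mod[OF assms(2)]])
  also have "m mod int p = int (nat (m mod int p))" using p_pos by simp
  also have "f (int (nat (m mod int p))) \<simeq> h (int (nat (m mod int p)))" by (rule assms(1))
  also have "int (nat (m mod int p)) = m mod int p" using p_pos by simp
  also have "h (m mod int p) \<simeq> h m" by (rule periodic_mod[OF assms(3)])
  finally show ?thesis .
qed

lemma periodic_E: "periodic p E" by (simp add: periodic_def E_periodic)

lemma periodic_E_neg: "periodic p (\<lambda>m. E (- m))"
  unfolding periodic_def
proof
  fix i have "E (- (i + int p)) = E (- i)" by (rule E_cong) (simp add: cong_iff_dvd_diff)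
  then show "E (- (i + int p)) \<simeq> E (- i)" by simp
qed

text \<open>If all these moments vanished, then the odd part f of E would satisfy f(j + 1) = 2 f(j)
  - f(j - 1) with f(0) = 0, hence be linear.\<close>

lemma not_odd_linear:
  assumes "\<not> odd_linear"
  obtains v where "v \<in> sec_code" "periodic p v" "\<not> moment p 0 v \<simeq> 0"
proof -
  have "\<exists>j. \<not> moment p 0 (sec_T (cm (bb j - bb (j + 1)) (bb 0 - bb 1))) \<simeq> 0"
  proof (rule ccontr)
    assume *: "\<not> ?thesis"
    define f where "f m = E m - E (- m)" for m
    have rec: "f (j + 1) \<simeq> 2 * f j - f (j - 1)" for j
    proof -
      have "form 0 j 0 - form 0 j 1 - (form 0 (j + 1) 0 - form 0 (j + 1) 1) \<simeq> 0"
        using * moment_cm_bb[of 0 j] by (blast intro: cong_trans[OF cong_sym])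
      moreover have "form 0 j 0 - form 0 j 1 - (form 0 (j + 1) 0 - form 0 (j + 1) 1) = (2 * f j - f (j - 1)) - f (j + 1)"
        by (simp add: form_def f_def)
      ultimately show ?thesis by (metis cong_diff_iff_cong_0 cong_sym)
    qed
    have "f (int n) \<simeq> int n * f 1 \<and> f (int (Suc n)) \<simeq> int (Suc n) * f 1" for n
    proof (induction n)
      case 0 then show ?case by (simp add: f_def)
    next
      case (Suc n)
      have "f (int (Suc n) + 1) \<simeq> 2 * f (int (Suc n)) - f (int (Suc n) - 1)" by (rule rec)
      also have "int (Suc n) - 1 = int n" by simp
      also have "2 * f (int (Suc n)) - f (int n) \<simeq> 2 * (int (Suc n) * f 1) - int n * f 1"
        using Suc by (intro cong_diff cong_mult cong_refl) auto
      also have "2 * (int (Suc n) * f 1) - int n * f 1 = int (Suc (Suc n)) * f 1"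
        by (simp add: algebra_simps)
      also have "int (Suc n) + 1 = int (Suc (Suc n))" by simp
      finally show ?case using Suc by blast
    qed
    then have "E m - E (- m) \<simeq> f 1 * m" for m
      using cong_all_residues[of f "\<lambda>m. f 1 * m" m]
      by (simp add: f_def[abs_def] mult.commute periodic_intros periodic_E periodic_E_neg)
    then show False using assms unfolding odd_linear_def by blast
  qed
  then show ?thesis using that sec_T_in_code[OF cm_bb_D2] periodic_sec_T by blast
qed

lemma odd_linear_not_affine:
  assumes odd_linear "\<not> affine_exps"
  obtains v where "v \<in> sec_code" "periodic p v" "moment p 0 v \<simeq> 0" "\<not> moment p 1 v \<simeq> 0"
proof -
  obtain l where l: "\<And>m. E m - E (- m) \<simeq> l * m" using assms(1) by (auto simp: odd_linear_def)
  have "\<exists>j. \<not> moment p 1 (sec_T (cm (bb j - bb (j + 1)) (bb 0 - bb 1))) \<simeq> 0"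
  proof (rule ccontr)
    assume *: "\<not> ?thesis"
    \<comment> \<open>The vanishing first moments say that m E(m) has constant second difference
      \<open>l\<close>. It is then quadratic without constant term, and dividing by 2m shows that E
      is affine.\<close>
    define h where "h m = m * E m" for m
    have rec: "h (j + 1) \<simeq> 2 * h j - h (j - 1) + l" for j
    proof -
      have "form 1 j 0 - form 1 j 1 - (form 1 (j + 1) 0 - form 1 (j + 1) 1) \<simeq> 0"
        using * moment_cm_bb[of 1 j] by (blast intro: cong_trans[OF cong_sym])
      moreover have "form 1 j 0 - form 1 j 1 - (form 1 (j + 1) 0 - form 1 (j + 1) 1)
          = (2 * h j - h (j - 1) + l - h (j + 1)) + ((E j - E (- j) - l * j) - (E (j - 1) - E (-
              (j - 1)) - l * (j - 1)))"
        by (simp add: form_def h_def algebra_simps)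
      moreover have "(E j - E (- j) - l * j) - (E (j - 1) - E (- (j - 1)) - l * (j - 1)) \<simeq> 0 - 0"
        using l by (intro cong_diff[of _ 0 _ _ 0]) (simp_all only: cong_diff_iff_cong_0)
      ultimately have "2 * h j - h (j - 1) + l - h (j + 1) \<simeq> 0"
        by (simp add: cong_0_iff dvd_add_left_iff)
      then show ?thesis by (metis cong_diff_iff_cong_0 cong_sym)
    qed
    have H: "2 * h (int n) \<simeq> l * (int n * (int n - 1)) + int n * (2 * E 1)
        \<and> 2 * h (int (Suc n)) \<simeq> l * (int (Suc n) * (int (Suc n) - 1)) + int (Suc n) * (2 * E
            1)" for n
    proof (induction n)
      case 0 then show ?case by (simp add: h_def)
    next
      case (Suc n)
      have "2 * h (int (Suc n) + 1) \<simeq> 2 * (2 * h (int (Suc n)) - h (int (Suc n) - 1) + l)"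
        by (intro cong_mult cong_refl rec)
      also have "2 * (2 * h (int (Suc n)) - h (int (Suc n) - 1) + l) = 2 * (2 * h (int (Suc n)))
          - 2 * h (int n) + 2 * l"
        by simp
      also have "\<dots> \<simeq> 2 * (l * (int (Suc n) * (int (Suc n) - 1)) + int (Suc n) * (2 * E 1))
          - (l * (int n * (int n - 1)) + int n * (2 * E 1)) + 2 * l"
        using Suc by (intro cong_add cong_diff cong_mult cong_refl) auto
      also have "2 * (l * (int (Suc n) * (int (Suc n) - 1)) + int (Suc n) * (2 * E 1))
          - (l * (int n * (int n - 1)) + int n * (2 * E 1)) + 2 * l
          = l * (int (Suc (Suc n)) * (int (Suc (Suc n)) - 1)) + int (Suc (Suc n)) * (2 * E 1)"
        by (simp add: algebra_simps)
      also have "int (Suc n) + 1 = int (Suc (Suc n))" by simp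
      finally show ?case using Suc by blast
    qed
    have H': "2 * (m * E m) \<simeq> l * (m * (m - 1)) + m * (2 * E 1)" for m
      using cong_all_residues[of "\<lambda>m. 2 * h m" "\<lambda>m. l * (m * (m - 1)) + m * (2 * E 1)" m] H
      by (simp add: h_def[abs_def] periodic_intros periodic_E)
    obtain l' where l': "l' * 2 \<simeq> l" using cong_solve[OF prime_p, of 2 l] not_dvd_2
      by (auto simp: cong_0_iff)
    have "E m \<simeq> l' * m + (E 1 - l')" if m: "\<not> int p dvd m" for m
    proof -
      have "2 * m * E m \<simeq> (l' * 2) * (m * (m - 1)) + m * (2 * E 1)"
        using cong_trans[OF H'[of m] cong_add[OF cong_mult[OF cong_sym[OF l'] cong_refl]
            cong_refl]] by (simp add: mult.assoc)
      also have "(l' * 2) * (m * (m - 1)) + m * (2 * E 1) = 2 * m * (l' * m + (E 1 - l'))"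
        by (simp add: algebra_simps)
      finally show ?thesis
        using m not_dvd_2 prime_int_p
        by (simp add: cong_iff_dvd_diff right_diff_distrib[symmetric] prime_dvd_mult_iff)
    qed
    then show False using assms(2) unfolding affine_exps_def by blast
  qed
  then show ?thesis using that sec_T_in_code[OF cm_bb_D2] periodic_sec_T D2_moment_0[OF assms(1) cm_bb_D2] by blast
qed

lemma affine_exps_moment_2:
  assumes affine_exps
  obtains v where "v \<in> sec_code" "periodic p v" "moment p 0 v \<simeq> 0" "moment p 1 v \<simeq> 0"
    "\<not> moment p 2 v \<simeq> 0"
proof -
  obtain l c where l: "\<And>m. \<not> int p dvd m \<Longrightarrow> E m \<simeq> l * m + c" using assms
    by (auto simp: affine_exps_def)
  have l0: "\<not> int p dvd l"
  proof
    assume "int p dvd l"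
    then have "E m \<simeq> 0 + c" if "\<not> int p dvd m" for m
      using cong_trans[OF l[OF that] cong_add[OF _ cong_refl, of "l * m" 0]]
      by (simp add: cong_0_iff)
    then show False using E_nonconst by (metis cong_sym cong_trans)
  qed
  \<comment> \<open>The choice j = 1 involves E only at 1, 2 and -1, none divisible by p, so the
    affine formula applies; the second moment becomes -2l.\<close>
  let ?v = "sec_T (cm (bb 1 - bb (1 + 1)) (bb 0 - bb 1))"
  have "moment p 2 ?v \<simeq> form 2 1 0 - form 2 1 1 - (form 2 (1 + 1) 0 - form 2 (1 + 1) 1)"
    by (rule moment_cm_bb)
  also have "form 2 1 0 - form 2 1 1 - (form 2 (1 + 1) 0 - form 2 (1 + 1) 1) = 5 * E 1 - 4 * E 2
      - E (- 1)"
    by (simp add: form_def E_0)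
  also have "\<dots> \<simeq> 5 * (l * 1 + c) - 4 * (l * 2 + c) - (l * (- 1) + c)"
    by (intro cong_diff cong_mult cong_refl l) (use not_dvd_1 not_dvd_2 in \<open>simp_all only:
        dvd_minus_iff not_False_eq_True\<close>)
  also have "5 * (l * 1 + c) - 4 * (l * 2 + c) - (l * (- 1) + c) = - (2 * l)" by simp
  finally have "\<not> moment p 2 ?v \<simeq> 0"
    using l0 not_dvd_2 prime_int_p
    by (metis cong_0_iff cong_dvd_iff dvd_minus_iff prime_dvd_mult_iff)
  then show ?thesis
    using that sec_T_in_code[OF cm_bb_D2] periodic_sec_T D2_moment_0[OF affine_exps_odd_linear[OF
        assms] cm_bb_D2] D2_moment_1[OF assms cm_bb_D2]
    by blast
qed

section \<open>The images of G'' and S' under psi\<close>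

definition tmoment :: "nat \<Rightarrow> (int \<Rightarrow> 'g) \<Rightarrow> int" where "tmoment s x = moment p s (\<lambda>i. T (x i))"

text \<open>Since \<open>affine_exps\<close> implies \<open>odd_linear\<close>, three cases remain;
  the code is the ideal generated by 1, x - 1 or (x - 1)^2.\<close>

lemma sec_D2: "sec ` D2 = {x \<in> periodic_in (der G). (odd_linear \<longrightarrow> tmoment 0 x \<simeq> 0) \<and> (affine_exps \<longrightarrow> tmoment 1 x \<simeq> 0)}"
proof (intro equalityI subsetI)
  fix x assume "x \<in> sec ` D2"
  then obtain g where g: "g \<in> D2" "x = sec g" by blast
  then have "x \<in> periodic_in (der G)" using D2_S by (auto intro: sec_periodic_in sec_der_S D2_der_S)
  then show "x \<in> {x \<in> periodic_in (der G). (odd_linear \<longrightarrow> tmoment 0 x \<simeq> 0) \<and> (affine_exps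
      \<longrightarrow> tmoment 1 x \<simeq> 0)}"
    using D2_moment_0[OF _ g(1)] D2_moment_1[OF _ g(1)]
    by (auto simp: tmoment_def g(2) sec_T_def[abs_def])
next
  fix x assume x: "x \<in> {x \<in> periodic_in (der G). (odd_linear \<longrightarrow> tmoment 0 x \<simeq> 0) \<and> (affine_exps \<longrightarrow> tmoment 1 x \<simeq> 0)}"
  then have P: "x \<in> periodic_in (der G)" by blast
  let ?w = "\<lambda>i. T (x i)"
  have per: "periodic p ?w" using P by (simp add: periodic_def periodic_in_def)
  have m: "odd_linear \<Longrightarrow> moment p 0 ?w \<simeq> 0" "affine_exps \<Longrightarrow> moment p 1 ?w \<simeq> 0"
    using x by (auto simp: tmoment_def)
  note V = cyclic_code_sec_code
  consider "\<not> odd_linear" | "odd_linear" "\<not> affine_exps" | "affine_exps" by blast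
  then have "?w \<in> sec_code"
  proof cases
    case 1
    show ?thesis by (rule not_odd_linear[OF 1]) (rule cyclic_code_full[OF prime_p V _ _ _ per])
  next
    case 2
    show ?thesis by (rule odd_linear_not_affine[OF 2]) (rule cyclic_code_moment_1[OF prime_p V _ _ _ _ per m(1)[OF 2(1)]])
  next
    case 3
    show ?thesis by (rule affine_exps_moment_2[OF 3])
        (rule cyclic_code_moment_2[OF prime_p odd_p V _ _ _ _ _ per m(1)[OF
            affine_exps_odd_linear[OF 3]] m(2)[OF 3]])
  qed
  then show "x \<in> sec ` D2" by (rule sec_code_imp_D2[OF P])
qed

definition sym_exps :: bool where "sym_exps \<longleftrightarrow> (\<forall>m. E m \<simeq> E (- m))"

lemma sym_exps_not_affine: "sym_exps \<Longrightarrow> \<not> affine_exps"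
proof
  assume s: sym_exps and affine_exps
  then obtain l c where l: "\<And>m. \<not> int p dvd m \<Longrightarrow> E m \<simeq> l * m + c" by (auto simp: affine_exps_def)
  have "l * 1 + c \<simeq> l * (- 1) + c"
    using l[of 1] l[of "- 1"] s not_dvd_1 unfolding sym_exps_def dvd_minus_iff
    by (metis cong_sym cong_trans)
  then have "int p dvd 2 * l" by (simp add: cong_iff_dvd_diff)
  then have "int p dvd l" using prime_int_p not_dvd_2 by (simp add: prime_dvd_mult_iff)
  then have "E m \<simeq> 0 + c" if "\<not> int p dvd m" for m
    using cong_trans[OF l[OF that] cong_add[OF _ cong_refl, of "l * m" 0]] by (simp add: cong_0_iff)
  then show False using E_nonconst by (metis cong_sym cong_trans)
qed

text \<open>A second code argument is avoided. For symmetric E the condition is that of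
  \<open>sec_D2\<close>, so psi(G'') already contains all the required tuples; otherwise
  \<open>der_G_subset_coord0\<close> gives all of G'^p.\<close>

lemma sec_der_S_image: "sec ` der S = {x \<in> periodic_in (der G). sym_exps \<longrightarrow> tmoment 0 x \<simeq> 0}"
proof (intro equalityI subsetI)
  fix x assume "x \<in> sec ` der S"
  then obtain g where g: "g \<in> der S" "x = sec g" by blast
  have "tmoment 0 x \<simeq> 0" if s: sym_exps
  proof -
    have "moment p 0 (sec_T (cm g h)) \<simeq> 0" if gh: "g \<in> S" "h \<in> S" for g h
    proof -
      have q: "form 0 i k \<simeq> 0" for i k
        using s[unfolded sym_exps_def, rule_format, of "i - k"] by (simp add:
            form_def cong_diff_iff_cong_0)
      have "moment p 0 (sec_T (cm g h)) \<simeq> (\<Sum>i\<in>Zp. \<Sum>k\<in>Zp. form 0 i k * kappa g i * kappa h k)"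
        by (rule moment_cm[OF gh])
      also have "(\<Sum>i\<in>Zp. \<Sum>k\<in>Zp. form 0 i k * kappa g i * kappa h k)
          \<simeq> (\<Sum>i\<in>Zp. \<Sum>k\<in>Zp. 0 * kappa g i * kappa h k)"
        by (intro cong_sum cong_mult cong_refl q)
      finally show ?thesis by simp
    qed
    then have "der S \<subseteq> {g \<in> der S. moment p 0 (sec_T g) \<simeq> 0}"
      by (intro der_subsetI subgrp_hom_mod_ker hom_mod_moment) (auto intro: cm_in_der)
    then show ?thesis using g by (auto simp: tmoment_def sec_T_def[abs_def])
  qed
  then show "x \<in> {x \<in> periodic_in (der G). sym_exps \<longrightarrow> tmoment 0 x \<simeq> 0}"
    using g by (auto intro: sec_periodic_in sec_der_S der_S_S)
next
  fix x assume x: "x \<in> {x \<in> periodic_in (der G). sym_exps \<longrightarrow> tmoment 0 x \<simeq> 0}"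
  show "x \<in> sec ` der S"
  proof (cases sym_exps)
    case True
    then have "x \<in> sec ` D2" using x sym_exps_not_affine unfolding sec_D2 by simp
    then show ?thesis using D2_subset_der_S by blast
  next
    case False
    then have "der G \<subseteq> coord0 (der S)" by (intro der_G_subset_coord0) (simp add: sym_exps_def)
    then show ?thesis using coord0_all[OF normalized_der_S der_S_subset_S, of x] x
      by (auto simp: periodic_in_def)
  qed
qed

text \<open>Since \<open>G' / \<gamma>\<^sub>3(G)\<close> is cyclic, \<open>G'' = [G', \<gamma>\<^sub>3(G)]\<close>; and \<open>\<gamma>\<^sub>3(G)\<close> sits in a single
  coordinate of \<open>G''\<close>, while every element of \<open>G'\<close> occurs as a coordinate of an element of \<open>G''\<close>.\<close>

lemma D2_subset_coord0: "D2 \<subseteq> coord0 (der D2)"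
proof -
  let ?N = "coord0 (der D2)"
  have n: "normalized G (der D2)" by (rule normalized_der[OF normalized_D2 subgrp_G])
  have s: "der D2 \<subseteq> S" using der_subset[OF subgrp_der] D2_S by blast
  have N: "normalized G ?N" by (rule normalized_coord0[OF n s])
  note N' = normalizedD(1)[OF N]
  have 1: "cm x y \<in> ?N" if x: "x \<in> der G" and y: "y \<in> gamma3" for x y
  proof -
    obtain h where h: "h \<in> D2" "sec h = single 0 y" using y gamma3_subset_coord0
      by (auto simp: coord0_def)
    define t where "t = T x"
    let ?c = "cm b a"
    \<comment> \<open>Its \<open>T\<close>-values t, -2t, t at coordinates 0, 1, 2 form a multiple
      of (x - 1)^2, so both moments vanish and z lies in psi(G'') whatever E is. Coordinates other
      than 0 are irrelevant in the commutator with \<open>h\<close>.\<close>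
    define z where "z i = (if int p dvd i then x else if int p dvd i - 1 then zm (- 2 * t) ?c
       else if int p dvd i - 2 then zm t ?c else 0)" for i
    have z: "z \<in> periodic_in (der G)"
      unfolding periodic_in_def z_def using x zm_in[OF subgrp_der c_der_G] subgrp_0[OF subgrp_der]
      by (auto simp: diff_add_eq[symmetric])
    have Tz: "T (z i) \<simeq> t * of_bool (int p dvd i - 0) + (- 2 * t) * of_bool (int p dvd i - 1) + t
        * of_bool (int p dvd i - 2)" for i
    proof -
      have "\<not> (int p dvd i \<and> int p dvd i - 1)" "\<not> (int p dvd i \<and> int p dvd i - 2)"
          "\<not> (int p dvd i - 1 \<and> int p dvd i - 2)"
        using not_dvd_1 not_dvd_2 dvd_diff[of "int p" i "i - 1"] dvd_diff[of "int p" i "i - 2"]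
          dvd_diff[of "int p" "i - 1" "i - 2"] by auto
      then show ?thesis using T_zm_c hom_mod_0[OF hom_mod_T] by (auto simp: z_def t_def)
    qed
    have m: "tmoment s z \<simeq> 0 ^ s * t + 1 ^ s * (- 2 * t) + 2 ^ s * t" for s
    proof -
      let ?d = "\<lambda>k i. of_bool (int p dvd i - k) :: int"
      have "tmoment s z \<simeq> moment p s (\<lambda>i. t * ?d 0 i + (- 2 * t) * ?d 1 i + t * ?d 2 i)"
        unfolding tmoment_def by (rule moment_cong[OF Tz])
      also have "moment p s (\<lambda>i. t * ?d 0 i + (- 2 * t) * ?d 1 i + t * ?d 2 i)
         = (\<Sum>i\<in>Zp. i ^ s * t * ?d 0 i) + (\<Sum>i\<in>Zp. i ^ s * (- 2 * t) * ?d 1 i) + (\<Sum>i\<in>Zp. i ^ s * t *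
             ?d 2 i)"
        by (simp only: moment_def distrib_left sum.distrib mult.assoc)
      also have "\<dots> \<simeq> 0 ^ s * t + 1 ^ s * (- 2 * t) + 2 ^ s * t"
        by (intro cong_add sum_delta_cong periodic_intros periodic_power)
      finally show ?thesis .
    qed
    have "z \<in> sec ` D2" unfolding sec_D2 using z m[of 0] m[of 1] by simp
    then obtain g where g: "g \<in> D2" "sec g = z" by auto
    have "sec (cm g h) i = single 0 (cm x y) i" for i
      using g h D2_S by (auto simp: sec_cm S_St single_def z_def subset_iff)
    then have "sec (cm g h) = single 0 (cm x y)" by blast
    then show ?thesis using cm_in_der[OF g(1) h(1)] unfolding coord0_def by blast
  qed
  \<comment> \<open>By \<open>der_G_decomp\<close>, elements of G' are multiples of [b, a] up to
    \<open>gamma3\<close>, which commutes with G' modulo \<open>?N\<close>.\<close>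
  have gen: "der G \<subseteq> {x \<in> G. cm x y \<in> ?N}" if c: "cm (cm b a) y \<in> ?N" and y: "y \<in> der G" for y
  proof
    fix x assume x: "x \<in> der G"
    let ?C = "{x \<in> G. cm x y \<in> ?N}"
    have C: "subgrp ?C" by (rule subgrp_centralizer[OF N subgrp_G])
    have "x - zm (T x) (cm b a) \<in> ?C"
      using der_G_decomp[OF x] 1[OF y] cm_swap_in[OF N'] der_G_G by (auto simp: gamma3_def)
    moreover have "zm (T x) (cm b a) \<in> ?C" by (rule zm_in[OF C]) (use c in \<open>simp add: G_closed\<close>)
    ultimately show "x \<in> ?C" using subgrp_add[OF C] by force
  qed
  \<comment> \<open>First use with y = [b, a], which commutes with itself; the result then feeds the
    use with arbitrary y.\<close>
  have "cm x (cm b a) \<in> ?N" if "x \<in> der G" for x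
    using gen[OF _ c_der_G] that subgrp_0[OF N'] by auto
  then have "cm (cm b a) x \<in> ?N" if "x \<in> der G" for x using that cm_swap_in[OF N'] by blast
  then show ?thesis using gen by (intro der_subsetI[OF N']) blast
qed

section \<open>The derived series beyond G''\<close>

definition D :: "nat \<Rightarrow> 'g set" where "D n = (der ^^ n) G"

lemma D_Suc: "D (Suc n) = der (D n)" and D_0: "D 0 = G" by (simp_all add: D_def)

lemma D_1: "D 1 = der G" and D_2: "D 2 = D2" by (simp_all add: D_def numeral_2_eq_2)

lemma normalized_D: "normalized G (D n)"
  by (induction n) (simp_all add: D_Suc D_0 normalized_G normalized_der subgrp_G)

lemma subgrp_D: "subgrp (D n)" using normalizedD(1)[OF normalized_D] .

lemma D_antimono: "m \<le> n \<Longrightarrow> D n \<subseteq> D m"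
  by (induction n rule: dec_induct) (auto simp: D_Suc dest: subsetD[OF der_subset[OF subgrp_D]])

lemma D_subset_S: "n \<ge> 1 \<Longrightarrow> D n \<subseteq> S"
  using D_antimono[of 1 n] D_1 der_G_S by auto

text \<open>Commutators of tuples are formed coordinatewise, so both inclusions pass from n to n +
  1. They start from \<open>sec_der_S\<close> and \<open>D2_subset_coord0\<close>.\<close>

lemma sec_D_Suc:
  assumes "n \<ge> 2"
  shows "sec ` D (Suc n) = periodic_in (D n)"
proof
  have 1: "sec g i \<in> D n" if "n \<ge> 1" "g \<in> D (Suc n)" for n g i
    using that
  proof (induction n arbitrary: g rule: dec_induct)
    case base
    then show ?case using sec_der_S[OF D2_der_S] by (simp add: D_Suc D_0)
  next
    case (step n)
    have n: "D (Suc n) \<subseteq> S" by (rule D_subset_S) simp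
    have "subgrp {g \<in> S. sec g i \<in> D (Suc n)}"
      by (rule subgrpI) (auto simp: S_closed sec_diff S_St subgrp_closed[OF subgrp_D])
    then have "der (D (Suc n)) \<subseteq> {g \<in> S. sec g i \<in> D (Suc n)}"
    proof (rule der_subsetI)
      fix x y assume xy: "x \<in> D (Suc n)" "y \<in> D (Suc n)"
      then have "sec (cm x y) i = cm (sec x i) (sec y i)" using n
        by (intro sec_cm) (auto simp: S_St)
      then show "cm x y \<in> {g \<in> S. sec g i \<in> D (Suc n)}"
        using xy n step.IH by (auto intro!: S_closed cm_in_der simp: D_Suc[of n])
    qed
    then show ?case using step.prems by (auto simp: D_Suc)
  qed
  show "sec ` D (Suc n) \<subseteq> periodic_in (D n)"
    using 1[of n] assms D_subset_S[of "Suc n"] by (auto intro!: sec_periodic_in)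
  have "D n \<subseteq> coord0 (D (Suc n))"
    using assms
  proof (induction n rule: dec_induct)
    case base
    show ?case using D2_subset_coord0 by (simp only: D_Suc D_2)
  next
    case (step n)
    have n: "D (Suc n) \<subseteq> S" "D (Suc (Suc n)) \<subseteq> S" by (intro D_subset_S; simp)+
    have "der (D n) \<subseteq> coord0 (D (Suc (Suc n)))"
    proof (rule der_subsetI[OF subgrp_coord0[OF subgrp_D n(2)]])
      fix x y assume "x \<in> D n" "y \<in> D n"
      then have "x \<in> coord0 (D (Suc n))" "y \<in> coord0 (D (Suc n))" using step.IH by blast+
      then obtain g h where gh: "g \<in> D (Suc n)" "sec g = single 0 x" "h \<in> D (Suc n)"
          "sec h = single 0 y"
        unfolding coord0_def by blast
      have "sec (cm g h) i = single 0 (cm x y) i" for i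
        using gh n by (auto simp: sec_cm S_St single_def subset_iff)
      then have "sec (cm g h) = single 0 (cm x y)" by blast
      moreover have "cm g h \<in> D (Suc (Suc n))" unfolding D_Suc[of "Suc n"] using gh
        by (intro cm_in_der)
      ultimately show "cm x y \<in> coord0 (D (Suc (Suc n)))" unfolding coord0_def by blast
    qed
    then show ?case by (simp add: D_Suc[of n])
  qed
  then show "periodic_in (D n) \<subseteq> sec ` D (Suc n)"
    using coord0_all[OF normalized_D D_subset_S[of "Suc n"]]
    by (auto simp: periodic_in_def subset_iff image_iff) metis
qed

section \<open>Indices\<close>

lemma mod_in: "k mod int p \<in> Zp" using p_pos by simp

lemma hom_mod_index:
  assumes f: "hom_mod H f" and x: "x \<in> H" "y \<in> H"
  shows "f x mod int p = f y mod int p \<longleftrightarrow> f (x - y) \<simeq> 0"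
proof -
  have "f (x - y) \<simeq> f x - f y" by (rule hom_mod_diff[OF f x])
  then have "f (x - y) \<simeq> 0 \<longleftrightarrow> f x - f y \<simeq> 0" by (metis cong_sym cong_trans)
  then show ?thesis by (simp add: cong_def[of "f x" "f y", symmetric] cong_diff_iff_cong_0)
qed

lemma restrict_eq_iff: "restrict f A = restrict g A \<longleftrightarrow> (\<forall>x\<in>A. f x = g x)"
  by (metis restrict_apply' restrict_ext)

lemma subgrp_G_diff: "x \<in> G \<Longrightarrow> y \<in> G \<Longrightarrow> x - y \<in> G" by (rule G_closed)

lemma index_G_der_G: "index G (der G) = p ^ 2"
proof -
  let ?f = "\<lambda>g. (alpha g mod int p, beta g mod int p)"
  have "index G (der G) = card (?f ` G)"
    by (rule index_eq_card[OF subgrp_der])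
      (simp add: hom_mod_index[OF hom_mod_alpha] hom_mod_index[OF hom_mod_beta] der_G_iff
          subgrp_G_diff)
  also have "?f ` G = Zp \<times> Zp"
  proof
    show "?f ` G \<subseteq> Zp \<times> Zp" using mod_in by blast
    show "Zp \<times> Zp \<subseteq> ?f ` G"
    proof clarify
      fix i k assume ik: "i \<in> Zp" "k \<in> Zp"
      let ?g = "ev (replicate (nat k) 0) + zm i a"
      have "alpha ?g mod int p = i" "beta ?g mod int p = k"
        using alpha_ev[of "replicate (nat k) 0" i] beta_ev[of "replicate (nat k) 0" i] ik
        by (simp_all add: cong_def)
      then show "(i, k) \<in> ?f ` G" by (intro image_eqI[of _ _ ?g]) (simp_all add: G_closed ev_G)
    qed
  qed
  finally show ?thesis by (simp add: card_cartesian_product power2_eq_square)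
qed

lemma index_G_S: "index G S = p"
proof -
  let ?f = "\<lambda>g. alpha g mod int p"
  have "index G S = card (?f ` G)"
    by (rule index_eq_card[OF subgrp_S]) (simp add: hom_mod_index[OF hom_mod_alpha] S_alpha
        subgrp_G_diff)
  also have "?f ` G = Zp"
  proof
    show "Zp \<subseteq> ?f ` G"
    proof
      fix i assume i: "i \<in> Zp"
      then have "alpha (zm i a) mod int p = i" using alpha_a[of i] by (simp add: cong_def)
      then show "i \<in> ?f ` G" by (intro image_eqI[of _ _ "zm i a"]) (simp_all add: G_closed)
    qed
  qed (use mod_in in blast)
  finally show ?thesis by simp
qed

lemma index_S_der_S: "index S (der S) = p ^ p"
proof -
  let ?f = "\<lambda>g. \<lambda>j\<in>Zp. kappa g j mod int p"
  have "index S (der S) = card (?f ` S)"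
  proof (rule index_eq_card[OF subgrp_der])
    fix x y assume xy: "x \<in> S" "y \<in> S"
    have "?f x = ?f y \<longleftrightarrow> (\<forall>j\<in>Zp. kappa x j mod int p = kappa y j mod int p)"
      by (rule restrict_eq_iff)
    also have "\<dots> \<longleftrightarrow> (\<forall>j\<in>Zp. kappa (x - y) j \<simeq> 0)"
      by (simp add: hom_mod_index[OF hom_mod_kappa xy])
    also have "\<dots> \<longleftrightarrow> (\<forall>j. kappa (x - y) j \<simeq> 0)"
      using mod_in periodic_mod[OF periodic_kappa] by (metis cong_sym cong_trans)
    also have "\<dots> \<longleftrightarrow> x - y \<in> der S" using xy by (simp add: der_S_iff S_closed)
    finally show "?f x = ?f y \<longleftrightarrow> x - y \<in> der S" .
  qed
  also have "?f ` S = (\<Pi>\<^sub>E j\<in>Zp. Zp)"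
  proof
    show "?f ` S \<subseteq> (\<Pi>\<^sub>E j\<in>Zp. Zp)" using mod_in by auto
    show "(\<Pi>\<^sub>E j\<in>Zp. Zp) \<subseteq> ?f ` S"
    proof
      fix w assume w: "w \<in> (\<Pi>\<^sub>E j\<in>Zp. Zp)"
      \<comment> \<open>The letter counts are prescribed one residue at a time, by appending a
        multiple of the next letter.\<close>
      have "\<exists>g\<in>S. \<forall>j\<in>Zp. kappa g j \<simeq> (if j < int n then w j else 0)" if "n \<le> p" for n
        using that
      proof (induction n)
        case 0
        then show ?case using hom_mod_0[OF hom_mod_kappa] subgrp_0[OF subgrp_S]
          by (intro bexI[of _ 0]) auto
      next
        case (Suc n)
        then obtain g where g: "g \<in> S" "\<And>j. j \<in> Zp \<Longrightarrow> kappa g j \<simeq> (if j < int n then w j else 0)"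
          by auto
        let ?h = "zm (w (int n)) (bb (int n))"
        have "kappa (g + ?h) j \<simeq> (if j < int (Suc n) then w j else 0)" if j: "j \<in> Zp" for j
        proof -
          have "kappa (g + ?h) j \<simeq> kappa g j + kappa ?h j"
            by (intro hom_mod_add[OF hom_mod_kappa] g S_closed)
          also have "kappa g j + kappa ?h j \<simeq> (if j < int n then w j else 0) + w (int n)
              * kappa (bb (int n)) j"
            by (intro cong_add g j hom_mod_zm[OF hom_mod_kappa] bb_S)
          also have "(if j < int n then w j else 0) + w (int n) * kappa (bb (int n)) j
              \<simeq> (if j < int n then w j else 0) + w (int n) * of_bool (int p dvd j - int n)"
            by (intro cong_add cong_mult cong_refl kappa_bb)
          also have "int p dvd j - int n \<longleftrightarrow> j = int n"
            using j Suc.prems by (metis mod_eq_dvd_iff mod_pos_pos_trivial atLeastLessThan_iff of_nat_0_le_iff of_nat_less_iff Suc_le_lessD)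
          finally show ?thesis by (cases "j = int n") auto
        qed
        moreover have "g + ?h \<in> S" by (intro subgrp_add[OF subgrp_S] zm_in[OF subgrp_S] bb_S g)
        ultimately show ?case by (intro bexI[of _ "g + ?h"] ballI)
      qed
      from this[of p] obtain g where g: "g \<in> S" "\<And>j. j \<in> Zp \<Longrightarrow> kappa g j \<simeq> w j" by auto
      have "?f g j = w j" for j
      proof (cases "j \<in> Zp")
        case True
        then show ?thesis using g(2)[OF True] PiE_mem[OF w True] by (simp add: cong_def)
      qed (use PiE_arb[OF w] in auto)
      then have "?f g = w" by blast
      then show "w \<in> ?f ` S" using g(1) by blast
    qed
  qed
  finally show ?thesis by (simp add: card_PiE)
qed

lemma index_G_der_S: "index G (der S) = p ^ (p + 1)"
  using index_mult[OF subgrp_G subgrp_S subgrp_der der_subset[OF subgrp_S]] S_G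
  by (auto simp: index_G_S index_S_der_S)

lemma index_sec:
  assumes "subgrp H" "subgrp K" "K \<subseteq> H" "H \<subseteq> S"
  shows "index (sec ` H) (sec ` K) = index H K"
proof (rule index_image[OF assms(1-3)])
  fix x y assume "x \<in> H" "y \<in> H"
  then show "sec (x + y) = sec x + sec y" using assms(4) by (intro sec_add_fun) (auto simp: S_St)
next
  fix x assume "x \<in> H" "sec x = 0"
  then have "x = 0" using sec_eq_0[of x] assms(4) S_St by auto
  then show "x \<in> K" using subgrp_0[OF assms(2)] by simp
qed

lemma index_periodic_in:
  assumes H: "subgrp H" and K: "subgrp K"
  shows "index (periodic_in H) (periodic_in K) = index H K ^ p"
proof -
  define c where "c h = (\<lambda>k. k + h) ` K" for h
  have c: "c x = c y \<longleftrightarrow> x - y \<in> K" for x y unfolding c_def by (rule coset_eq_iff[OF K])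
  let ?f = "\<lambda>x. \<lambda>j\<in>Zp. c (x j)"
  have "index (periodic_in H) (periodic_in K) = card (?f ` periodic_in H)"
  proof (rule index_eq_card[OF subgrp_periodic_in[OF K]])
    fix x y assume xy: "x \<in> periodic_in H" "y \<in> periodic_in H"
    have per: "(x - y) (i + int p) = (x - y) i" for i using xy by (simp add: periodic_in_def)
    have "?f x = ?f y \<longleftrightarrow> (\<forall>j\<in>Zp. c (x j) = c (y j))"
      by (rule restrict_eq_iff)
    also have "\<dots> \<longleftrightarrow> (\<forall>j\<in>Zp. (x - y) j \<in> K)" by (simp add: c)
    also have "\<dots> \<longleftrightarrow> (\<forall>j. (x - y) j \<in> K)"
    proof
      assume *: "\<forall>j\<in>Zp. (x - y) j \<in> K"
      show "\<forall>j. (x - y) j \<in> K"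
      proof
        fix j
        have "(x - y) j = (x - y) (j mod int p)"
          by (rule int_periodic_exact[of "x - y", OF per]) (simp add: cong_def)
        then show "(x - y) j \<in> K" using * mod_in by metis
      qed
    qed blast
    also have "\<dots> \<longleftrightarrow> x - y \<in> periodic_in K" using per by (simp add: periodic_in_def)
    finally show "?f x = ?f y \<longleftrightarrow> x - y \<in> periodic_in K" .
  qed
  also have "?f ` periodic_in H = (\<Pi>\<^sub>E j\<in>Zp. c ` H)"
  proof
    show "?f ` periodic_in H \<subseteq> (\<Pi>\<^sub>E j\<in>Zp. c ` H)" by (auto simp: periodic_in_def)
    show "(\<Pi>\<^sub>E j\<in>Zp. c ` H) \<subseteq> ?f ` periodic_in H"
    proof
      fix w assume w: "w \<in> (\<Pi>\<^sub>E j\<in>Zp. c ` H)"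
      have "\<exists>h. h \<in> H \<and> w j = c h" if "j \<in> Zp" for j
        using PiE_mem[OF w that] by blast
      then obtain z where z: "\<And>j. j \<in> Zp \<Longrightarrow> z j \<in> H \<and> w j = c (z j)"
        using bchoice[of Zp "\<lambda>j h. h \<in> H \<and> w j = c h"] by blast
      let ?x = "\<lambda>i. z (i mod int p)"
      have "?x \<in> periodic_in H" using z mod_in by (simp add: periodic_in_def)
      moreover have "?f ?x j = w j" for j
      proof (cases "j \<in> Zp")
        case True
        then have "j mod int p = j" by simp
        then show ?thesis using conjunct2[OF z[OF True]] True
          by (simp only: restrict_apply' conj_assoc)
      next
        case False
        then show ?thesis using PiE_arb[OF w False] by (simp only: restrict_apply if_False)
      qed
      then have "w = ?f ?x" by blast
      ultimately show "w \<in> ?f ` periodic_in H" by (rule rev_image_eqI[of ?x "periodic_in H" w ?f])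
    qed
  qed
  finally show ?thesis by (simp add: card_PiE index_def c_def)
qed

lemma hom_T_periodic_in_diff:
  assumes "x \<in> periodic_in (der G)" "y \<in> periodic_in (der G)"
  shows "tmoment s x mod int p = tmoment s y mod int p \<longleftrightarrow> tmoment s (x - y) \<simeq> 0"
proof -
  have "tmoment s (x - y) \<simeq> moment p s (\<lambda>i. 1 * T (x i) + (- 1) * T (y i))"
    unfolding tmoment_def using assms
    by (intro moment_cong) (simp add: periodic_in_def hom_mod_diff[OF hom_mod_T_der_G])
  then have "tmoment s (x - y) \<simeq> tmoment s x - tmoment s y"
    by (simp only: moment_lin) (simp add: tmoment_def)
  then have "tmoment s (x - y) \<simeq> 0 \<longleftrightarrow> tmoment s x - tmoment s y \<simeq> 0" by (metis cong_sym cong_trans)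
  then show ?thesis by (simp add: cong_def[of "tmoment s x"
      "tmoment s y", symmetric] cong_diff_iff_cong_0)
qed

lemma periodic_in_moments:
  obtains x where "x \<in> periodic_in (der G)" "tmoment 0 x \<simeq> k + l" "tmoment 1 x \<simeq> l"
proof
  let ?c = "cm b a" and ?d = "\<lambda>k i. of_bool (int p dvd i - k) :: int"
  define x where "x i = (if int p dvd i then zm k ?c else if int p dvd i - 1 then zm l ?c else 0)"
      for i
  show "x \<in> periodic_in (der G)"
    unfolding periodic_in_def x_def using zm_in[OF subgrp_der c_der_G] subgrp_0[OF subgrp_der]
    by (auto simp: diff_add_eq[symmetric])
  have Tx: "T (x i) \<simeq> k * ?d 0 i + l * ?d 1 i" for i
    using T_zm_c hom_mod_0[OF hom_mod_T] not_dvd_1 dvd_diff[of "int p" i "i - 1"]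
    by (auto simp: x_def)
  have m: "tmoment s x \<simeq> 0 ^ s * k + 1 ^ s * l" for s
  proof -
    have "tmoment s x \<simeq> moment p s (\<lambda>i. k * ?d 0 i + l * ?d 1 i)"
      unfolding tmoment_def by (rule moment_cong[OF Tx])
    also have "moment p s (\<lambda>i. k * ?d 0 i + l * ?d 1 i)
       = (\<Sum>i\<in>Zp. i ^ s * k * ?d 0 i) + (\<Sum>i\<in>Zp. i ^ s * l * ?d 1 i)"
      by (simp only: moment_def distrib_left sum.distrib mult.assoc)
    also have "\<dots> \<simeq> 0 ^ s * k + 1 ^ s * l"
      by (intro cong_add sum_delta_cong periodic_intros periodic_power)
    finally show ?thesis .
  qed
  show "tmoment 0 x \<simeq> k + l" "tmoment 1 x \<simeq> l" using m[of 0] m[of 1] by simp_all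
qed

text \<open>The moments 0 and 1 are independent by \<open>periodic_in_moments\<close>, so each
  condition imposed costs a factor p.\<close>

lemma index_periodic_in_moments:
  assumes Q: "Q = {x \<in> periodic_in (der G). (P0 \<longrightarrow> tmoment 0 x \<simeq> 0) \<and> (P1 \<longrightarrow> tmoment 1 x \<simeq> 0)}"
    and "subgrp Q"
  shows "index (periodic_in (der G)) Q = p ^ (of_bool P0 + of_bool P1)"
proof -
  let ?f = "\<lambda>x. (if P0 then tmoment 0 x mod int p else 0, if P1 then tmoment 1 x mod int p else 0)"
  have "index (periodic_in (der G)) Q = card (?f ` periodic_in (der G))"
  proof (rule index_eq_card[OF assms(2)])
    fix x y assume xy: "x \<in> periodic_in (der G)" "y \<in> periodic_in (der G)"
    then have "x - y \<in> periodic_in (der G)"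
      by (rule subgrp_diff[OF subgrp_periodic_in[OF subgrp_der]])
    then show "?f x = ?f y \<longleftrightarrow> x - y \<in> Q" using hom_T_periodic_in_diff[OF xy] by (auto simp: Q)
  qed
  also have "?f ` periodic_in (der G) = (if P0 then Zp else {0}) \<times> (if P1 then Zp else {0})"
  proof
    show "?f ` periodic_in (der G) \<subseteq> (if P0 then Zp else {0}) \<times> (if P1 then Zp else {0})"
      using mod_in by auto
    show "(if P0 then Zp else {0}) \<times> (if P1 then Zp else {0}) \<subseteq> ?f ` periodic_in (der G)"
    proof clarify
      fix u v assume u: "u \<in> (if P0 then Zp else {0})" and v: "v \<in> (if P1 then Zp else {0})"
      \<comment> \<open>\<open>periodic_in_moments\<close> yields the moments k + l and l; here l =
        v and k = u - v.\<close>
      obtain x where x: "x \<in> periodic_in (der G)" "tmoment 0 x \<simeq> (u - v) + v" "tmoment 1 x \<simeq> v"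
        by (rule periodic_in_moments)
      then show "(u, v) \<in> ?f ` periodic_in (der G)"
        using u v by (intro image_eqI[of _ _ x]) (auto simp: cong_def split: if_splits)
    qed
  qed
  finally show ?thesis by (simp add: card_cartesian_product)
qed

lemma subgrp_sec_image:
  assumes "subgrp H" "H \<subseteq> S"
  shows "subgrp (sec ` H)"
proof (rule subgrpI)
  show "0 \<in> sec ` H" using subgrp_0[OF assms(1)] sec_zero_fun by (metis imageI)
  fix x y assume "x \<in> sec ` H" "y \<in> sec ` H"
  then obtain g h where gh: "g \<in> H" "h \<in> H" "x = sec g" "y = sec h" by blast
  then have "x - y = sec (g - h)" using assms(2) by (auto simp: fun_eq_iff sec_diff S_St subset_iff)
  then show "x - y \<in> sec ` H" using subgrp_diff[OF assms(1)] gh by blast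
qed

lemma index_periodic_in_D2: "index (periodic_in (der G)) (sec ` D2) = p ^ (of_bool odd_linear + of_bool affine_exps)"
  by (rule index_periodic_in_moments[OF sec_D2 subgrp_sec_image[OF subgrp_der D2_S]])

lemma index_periodic_in_der_S: "index (periodic_in (der G)) (sec ` der S) = p ^ of_bool sym_exps"
  using index_periodic_in_moments[of "sec ` der S" sym_exps False] sec_der_S_image
    subgrp_sec_image[OF subgrp_der der_S_subset_S] by simp

text \<open>The factor on the left is the index of psi(S') in G'^p, so indices below S' can be
  computed in the full direct power.\<close>

lemma index_der_S:
  assumes "subgrp K" "K \<subseteq> der S"
  shows "p ^ of_bool sym_exps * index (der S) K = index (periodic_in (der G)) (sec ` K)"
proof -
  have "sec ` der S \<subseteq> periodic_in (der G)" by (auto simp: sec_der_S_image)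
  then have "index (periodic_in (der G)) (sec ` K) = index (periodic_in (der G)) (sec ` der S)
      * index (sec ` der S) (sec ` K)"
    using assms der_S_subset_S by (intro index_mult subgrp_periodic_in subgrp_der subgrp_sec_image) auto
  then show ?thesis
    using index_sec[OF subgrp_der assms der_S_subset_S] by (simp add: index_periodic_in_der_S)
qed

lemma index_der_S_D2: "p ^ of_bool sym_exps * index (der S) D2 = p ^ (of_bool odd_linear + of_bool affine_exps)"
  using index_der_S[OF subgrp_der D2_subset_der_S] by (simp add: index_periodic_in_D2)

lemma index_der_S_D_Suc:
  assumes "n \<ge> 2"
  shows "p ^ of_bool sym_exps * index (der S) (D (Suc n)) = index (der G) (D n) ^ p"
proof -
  have "D (Suc n) \<subseteq> der S" using D_antimono[of 2 "Suc n"] D_2 D2_subset_der_S assms by auto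
  from index_der_S[OF subgrp_D this] show ?thesis
    by (simp add: sec_D_Suc[OF assms] index_periodic_in subgrp_der subgrp_D)
qed

lemma index_D_1: "index G (D 1) = p ^ 2"
  by (simp only: D_1 index_G_der_G)

text \<open>The exact exponent, with the contribution of symmetric tuples moved to the left so that no
  subtraction occurs.\<close>

lemma index_D:
  assumes "n \<ge> 2"
  shows "index G (D n) * p ^ (of_bool sym_exps * (\<Sum>k<n - 1. p ^ k))
     = p ^ (p ^ (n - 2) * (p + of_bool affine_exps + of_bool odd_linear) + 1)"
  using assms
proof (induction n rule: dec_induct)
  case base
  have "index G D2 = p ^ (p + 1) * index (der S) D2"
    using index_mult[OF subgrp_G subgrp_der subgrp_der D2_subset_der_S] der_S_der_G der_G_G
    by (auto simp: index_G_der_S)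
  then have "index G D2 * p ^ of_bool sym_exps = p ^ (p + 1) * (p ^ of_bool sym_exps
      * index (der S) D2)" by simp
  then show ?case unfolding index_der_S_D2 by (simp add: D_2 power_add mult_ac)
next
  case (step n)
  define q where "q = (of_bool sym_exps :: nat)"
  define A where "A = p ^ (n - 2) * (p + of_bool affine_exps + of_bool odd_linear)"
  define Q where "Q = (\<Sum>k<n - 1. p ^ k)"
  have A: "A \<ge> 1" unfolding A_def using p_pos by (simp add: Suc_le_eq)
  have "D n \<subseteq> der G" using D_antimono[of 1 n] step.hyps D_1 by simp
  then have "index G (D n) = p ^ 2 * index (der G) (D n)"
    using index_mult[OF subgrp_G subgrp_der[of G] subgrp_D[of n]] der_G_G
    by (auto simp: index_G_der_G)
  then have "p ^ 2 * (index (der G) (D n) * p ^ (q * Q)) = p ^ (A + 1)"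
    using step.IH by (simp add: A_def Q_def q_def mult_ac)
  \<comment> \<open>This isolates the factor |G : G'| = p^2 for cancellation; \<open>A\<close> >= 1
    keeps the subtraction of natural numbers exact.\<close>
  also have "A + 1 = 2 + (A - 1)" using A by simp
  finally have J: "index (der G) (D n) * p ^ (q * Q) = p ^ (A - 1)"
    unfolding power_add mult_cancel1 using p_pos by simp
  have Q': "(\<Sum>k<Suc n - 1. p ^ k) = 1 + p * Q"
  proof -
    obtain m where "n = Suc m" using step.hyps by (cases n) auto
    then show ?thesis unfolding Q_def by (simp add: sum.lessThan_Suc_shift sum_distrib_left del: sum.lessThan_Suc)
  qed
  have A': "p ^ (Suc n - 2) * (p + of_bool affine_exps + of_bool odd_linear) = p * A"
  proof -
    obtain m where "n = m + 2" using step.hyps by (metis add.commute le_iff_add)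
    then show ?thesis by (simp add: A_def mult.assoc)
  qed
  have "D (Suc n) \<subseteq> der S" using D_antimono[of 2 "Suc n"] D_2 D2_subset_der_S step.hyps by auto
  then have I: "index G (D (Suc n)) = p ^ (p + 1) * index (der S) (D (Suc n))"
    using index_mult[OF subgrp_G subgrp_der[of S] subgrp_D[of "Suc n"]] der_S_der_G der_G_G
    by (auto simp: index_G_der_S)
  have "index G (D (Suc n)) * p ^ (q * (1 + p * Q))
      = p ^ (p + 1) * (p ^ q * index (der S) (D (Suc n))) * p ^ (p * (q * Q))"
    unfolding I by (simp add: power_add mult_ac distrib_left)
  also have "\<dots> = p ^ (p + 1) * (index (der G) (D n) * p ^ (q * Q)) ^ p"
    unfolding q_def index_der_S_D_Suc[OF step.hyps(1)]
    by (simp add: power_mult_distrib mult.assoc power_mult[symmetric] mult.commute[of p])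
  also have "\<dots> = p ^ (p + 1 + p * (A - 1))" unfolding J
    by (simp add: power_add power_mult[symmetric] mult.commute)
  also have "p + 1 + p * (A - 1) = p * A + 1" using A by (simp add: diff_mult_distrib2)
  finally show ?case unfolding Q' A' q_def .
qed

end

section \<open>The tree\<close>

text \<open>The locale needs a type of class \<open>group_add\<close>, whereas the tree
  automorphisms are a carrier set. They are embedded into the permutations of all lists of naturals,
  fixing every list outside \<open>words p\<close>.\<close>

typedef 'a bijection = "{f :: 'a \<Rightarrow> 'a. bij f}" morphisms app Bijection
  by (rule exI[of _ id]) simp

lemma bij_app: "bij (app f)" using app[of f] by simp

lemma app_Bijection: "bij f \<Longrightarrow> app (Bijection f) = f" by (simp add: Bijection_inverse)

lemma bijection_eqI: "(\<And>x. app f x = app g x) \<Longrightarrow> f = g"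
  by (simp add: app_inject[symmetric] fun_eq_iff)

text \<open>Permutations act on the right: \<open>f + g\<close> applies \<open>f\<close> first.\<close>

instantiation bijection :: (type) group_add
begin

definition "0 = Bijection id"
definition "f + g = Bijection (app g \<circ> app f)"
definition "- f = Bijection (inv_into UNIV (app f))"
definition "f - g = f + - (g :: 'a bijection)"

lemma app_zero: "app 0 x = x" by (simp add: zero_bijection_def app_Bijection)

lemma app_plus: "app (f + g) x = app g (app f x)"
  by (simp add: plus_bijection_def app_Bijection bij_comp bij_app)

lemma app_uminus: "app (- f) (app f x) = x"
  by (simp add: uminus_bijection_def app_Bijection bij_imp_bij_inv bij_app inv_f_f bij_is_inj)

lemma app_uminus_right: "app f (app (- f) x) = x"
  by (simp add: uminus_bijection_def app_Bijection bij_imp_bij_inv bij_app surj_f_inv_f bij_is_surj)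

instance
  by standard (auto intro: bijection_eqI simp: app_zero app_plus app_uminus app_uminus_right
      minus_bijection_def)

end

lemma app_uminus_eq: "app f x = y \<Longrightarrow> app (- f) y = x"
  using app_uminus by metis

lemma app_inj: "app f x = app f y \<Longrightarrow> x = y"
  using app_uminus by metis

definition perm_of :: "nat \<Rightarrow> (nat list \<Rightarrow> nat list) \<Rightarrow> nat list bijection" where
  "perm_of p g = Bijection (\<lambda>u. if u \<in> words p then g u else u)"

lemma app_perm_of:
  assumes "g \<in> tree_auts p"
  shows "app (perm_of p g) u = (if u \<in> words p then g u else u)"
proof -
  note b = tree_auts_bij[OF assms]
  have "bij_betw (\<lambda>u. if u \<in> words p then g u else id u) (words p \<union> - words p) (words p \<union>
      - words p)"
    by (rule bij_betw_disjoint_Un[OF b]) (auto simp: bij_betw_def)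
  then have "bij (\<lambda>u. if u \<in> words p then g u else u)" by (simp add: Compl_partition cong: if_cong)
  then show ?thesis by (simp add: perm_of_def app_Bijection)
qed

lemma perm_of_hom: "perm_of p \<in> hom (tree_aut p) additive"
proof (rule homI)
  fix g h assume "g \<in> carrier (tree_aut p)" "h \<in> carrier (tree_aut p)"
  then have gh: "g \<in> tree_auts p" "h \<in> tree_auts p" by (auto simp: tree_aut_def)
  have "g \<otimes>\<^bsub>tree_aut p\<^esub> h \<in> carrier (tree_aut p)"
    using gh group.is_monoid[OF group_tree_aut]
    by (intro monoid.m_closed) (simp_all add: tree_aut_def)
  then have "compose (words p) h g \<in> tree_auts p" by (simp add: tree_aut_def)
  then have "perm_of p (compose (words p) h g) = perm_of p g + perm_of p h"
    using gh by (intro bijection_eqI) (simp add: app_plus app_perm_of tree_auts_words compose_def)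
  then show "perm_of p (g \<otimes>\<^bsub>tree_aut p\<^esub> h) = perm_of p g \<otimes>\<^bsub>additive\<^esub> perm_of p h"
    by (simp add: tree_aut_def)
qed simp

lemma inj_on_perm_of: "inj_on (perm_of p) (carrier (tree_aut p))"
proof (rule inj_onI)
  fix g h assume gh: "g \<in> carrier (tree_aut p)" "h \<in> carrier (tree_aut p)"
      "perm_of p g = perm_of p h"
  then have gh': "g \<in> tree_auts p" "h \<in> tree_auts p" by (auto simp: tree_aut_def)
  have "g u = h u" for u
  proof (cases "u \<in> words p")
    case True then show ?thesis using app_perm_of[OF gh'(1), of u] app_perm_of[OF gh'(2), of u] gh(3) by simp
  next
    case False then show ?thesis using tree_auts_ext[OF gh'(1)] tree_auts_ext[OF gh'(2)]
      by (simp add: extensional_def)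
  qed
  then show "g = h" by blast
qed

section \<open>The generators, the level stabilizer and sections as permutations\<close>

definition perm_a :: "nat \<Rightarrow> nat list bijection" where "perm_a p = perm_of p (ggs_a p)"

definition perm_b :: "nat \<Rightarrow> (nat \<Rightarrow> int) \<Rightarrow> nat list bijection" where
    "perm_b p e = perm_of p (ggs_b p e)"

text \<open>Not only tree automorphisms: fixing the first letter of every list is what makes the
  sections permutations.\<close>

definition perm_stab :: "nat \<Rightarrow> nat list bijection set" where
  "perm_stab p = {g. (\<forall>u. u \<notin> words p \<longrightarrow> app g u = u) \<and> app g [] = [] \<and> (\<forall>x v. \<exists>w. app g (x # v)
      = x # w)}"

definition perm_sec :: "nat \<Rightarrow> nat list bijection \<Rightarrow> int \<Rightarrow> nat list bijection" where
  "perm_sec p g i = Bijection (\<lambda>v. tl (app g (nat (i mod int p) # v)))"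

definition exps :: "nat \<Rightarrow> (nat \<Rightarrow> int) \<Rightarrow> int \<Rightarrow> int" where
  "exps p e i = (if int p dvd i then 0 else e (nat (i mod int p)))"

lemma perm_stab_D:
  assumes "g \<in> perm_stab p"
  shows "u \<notin> words p \<Longrightarrow> app g u = u" "app g [] = []" "\<exists>w. app g (x # v) = x # w"
  using assms by (auto simp: perm_stab_def)

lemma perm_stab_uminus: "g \<in> perm_stab p \<Longrightarrow> - g \<in> perm_stab p"
proof -
  assume g: "g \<in> perm_stab p"
  have "\<exists>w. app (- g) (x # v) = x # w" for x v
  proof (cases "app (- g) (x # v)")
    case Nil
    then show ?thesis using app_uminus_right[of g "x # v"] perm_stab_D(2)[OF g] by simp
  next
    case (Cons y w)
    then have "app g (y # w) = x # v" using app_uminus_right[of g "x # v"] by simp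
    then show ?thesis using perm_stab_D(3)[OF g, of y w] Cons by auto
  qed
  then show "- g \<in> perm_stab p" using perm_stab_D[OF g]
    by (auto simp: perm_stab_def intro: app_uminus_eq)
qed

lemma perm_stab_add: "g \<in> perm_stab p \<Longrightarrow> h \<in> perm_stab p \<Longrightarrow> g + h \<in> perm_stab p"
proof -
  assume g: "g \<in> perm_stab p" and h: "h \<in> perm_stab p"
  have "\<exists>w. app (g + h) (x # v) = x # w" for x v
    using perm_stab_D(3)[OF g, of x v] perm_stab_D(3)[OF h, of x] by (auto simp: app_plus)
  then show "g + h \<in> perm_stab p" using perm_stab_D[OF g] perm_stab_D[OF h]
    by (simp add: perm_stab_def app_plus)
qed

lemma subgrp_perm_stab: "subgrp (perm_stab p)"
proof (rule subgrpI)
  fix x y assume "x \<in> perm_stab p" "y \<in> perm_stab p"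
  then show "x - y \<in> perm_stab p" using perm_stab_add[OF _ perm_stab_uminus, of x p y] by simp
qed (simp add: perm_stab_def app_zero)

lemma app_perm_sec:
  assumes g: "g \<in> perm_stab p"
  shows "app g (nat (i mod int p) # v) = nat (i mod int p) # app (perm_sec p g i) v"
proof -
  let ?x = "nat (i mod int p)"
  let ?f = "\<lambda>v. tl (app g (?x # v))"
  have f: "app g (?x # v) = ?x # ?f v" for v using perm_stab_D(3)[OF g, of ?x v] by auto
  have "inj ?f"
  proof (rule injI)
    fix v w assume "?f v = ?f w"
    then have "?x # ?f v = ?x # ?f w" by (rule arg_cong)
    then have "app g (?x # v) = app g (?x # w)" by (rule trans[OF trans[OF f] f[symmetric]])
    then have "?x # v = ?x # w" by (rule app_inj)
    then show "v = w" by (rule list.inject[THEN iffD1, THEN conjunct2])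
  qed
  moreover have "surj ?f"
  proof (rule surjI)
    fix w
    obtain v where v: "app (- g) (?x # w) = ?x # v"
      using perm_stab_D(3)[OF perm_stab_uminus[OF g]] by blast
    then show "?f (tl (app (- g) (?x # w))) = w" using app_uminus_right[of g "?x # w"] by simp
  qed
  ultimately have "bij ?f" by (rule bijI)
  then have "app (perm_sec p g i) v = ?f v" by (simp add: perm_sec_def app_Bijection)
  then show ?thesis using f by simp
qed

lemma perm_sec_fix:
  assumes g: "g \<in> perm_stab p" and "v \<notin> words p"
  shows "app (perm_sec p g i) v = v"
  using app_perm_sec[OF g, of i v] perm_stab_D(1)[OF g, of "nat (i mod int p) # v"] assms(2) by simp

lemma perm_sec_add:
  assumes "g \<in> perm_stab p" "h \<in> perm_stab p"
  shows "perm_sec p (g + h) i = perm_sec p g i + perm_sec p h i"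
proof (rule bijection_eqI)
  fix v
  show "app (perm_sec p (g + h) i) v = app (perm_sec p g i + perm_sec p h i) v"
    using app_perm_sec[OF perm_stab_add[OF assms], of i v]
    by (simp add: app_plus app_perm_sec assms)
qed

lemma perm_sec_periodic: "perm_sec p g (i + int p) = perm_sec p g i" by (simp add: perm_sec_def)

lemma perm_stab_eqI:
  assumes "\<And>u. u \<notin> words p \<Longrightarrow> app g u = u" "app g [] = []"
    and "\<And>i v. app g (nat (i mod int p) # v) = nat (i mod int p) # app (f i) v"
  shows "g \<in> perm_stab p" "perm_sec p g i = f i"
proof -
  have "\<exists>w. app g (x # v) = x # w" for x v
  proof (cases "x < p")
    case True
    then show ?thesis using assms(3)[of "int x" v] by (simp add: nat_mod_as_int)
  next
    case False
    then show ?thesis using assms(1)[of "x # v"] by simp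
  qed
  then show g: "g \<in> perm_stab p" using assms(1,2) by (simp add: perm_stab_def)
  show "perm_sec p g i = f i"
    using app_perm_sec[OF g, of i] assms(3)[of i] by (intro bijection_eqI) simp
qed

lemma perm_sec_eq_0:
  assumes g: "g \<in> perm_stab p" and "\<And>i. perm_sec p g i = 0"
  shows "g = 0"
proof (rule bijection_eqI)
  fix u
  show "app g u = app 0 u"
  proof (cases u)
    case Nil then show ?thesis using perm_stab_D(2)[OF g] by (simp add: app_zero)
  next
    case (Cons x v)
    show ?thesis
    proof (cases "x < p")
      case True
      then show ?thesis using app_perm_sec[OF g, of "int x" v] Cons assms(2) by (simp add: app_zero)
    next
      case False
      then show ?thesis using perm_stab_D(1)[OF g, of u] Cons by (simp add: app_zero)
    qed
  qed
qed

lemma app_perm_a: "app (perm_a p) u = (if u \<in> words p then case u of [] \<Rightarrow> [] | x # v \<Rightarrow> ((x + 1) mod p) # v else u)"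
  using ggs_a_in[of p] by (simp add: perm_a_def app_perm_of tree_aut_def) (simp add: ggs_a_def)

lemma app_perm_a_Cons:
  assumes "p > 0"
  shows "app (perm_a p) (nat (i mod int p) # v) = (if v \<in> words p then nat ((i
      + 1) mod int p) else nat (i mod int p)) # v"
proof -
  have "nat (i mod int p) < p" using assms by (simp add: nat_less_iff)
  moreover have "(nat (i mod int p) + 1) mod p = nat ((i + 1) mod int p)"
    using assms by (simp add: nat_mod_as_int mod_add_right_eq add.commute)
  ultimately show ?thesis by (simp add: app_perm_a)
qed

lemma perm_stab_conj_perm_a:
  assumes p: "p > 0" and g: "g \<in> perm_stab p"
  shows "- perm_a p + g + perm_a p \<in> perm_stab p"
      "perm_sec p (- perm_a p + g + perm_a p) i = perm_sec p g (i - 1)"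
proof -
  let ?h = "- perm_a p + g + perm_a p"
  have fix1: "app ?h u = u" if "u \<notin> words p" for u
  proof -
    have "app (perm_a p) u = u" using that by (simp add: app_perm_a)
    then show ?thesis using app_uminus_eq[of "perm_a p" u u] perm_stab_D(1)[OF g that]
      by (simp add: app_plus)
  qed
  have nil: "app ?h [] = []"
  proof -
    have "app (perm_a p) [] = []" by (simp add: app_perm_a)
    then show ?thesis using app_uminus_eq[of "perm_a p" "[]" "[]"] perm_stab_D(2)[OF g]
      by (simp add: app_plus)
  qed
  have "app ?h (nat (i mod int p) # v) = nat (i mod int p) # app (perm_sec p g (i - 1)) v" for i v
  proof (cases "v \<in> words p")
    case True
    have "app (perm_a p) (nat ((i - 1) mod int p) # v) = nat (i mod int p) # v"
      using app_perm_a_Cons[OF p, of "i - 1" v] True by simp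
    then have 1: "app (- perm_a p) (nat (i mod int p) # v) = nat ((i - 1) mod int p) # v"
      by (rule app_uminus_eq)
    \<comment> \<open>\<open>perm_a\<close> moves words only, so the section must be known to keep
      \<open>v\<close> a word. A permutation fixing all non-words cannot map a word to one of
      them.\<close>
    have "app (perm_sec p g (i - 1)) v \<in> words p"
    proof (rule ccontr)
      let ?w = "app (perm_sec p g (i - 1)) v"
      assume "?w \<notin> words p"
      then have "app (perm_sec p g (i - 1)) ?w = ?w" by (rule perm_sec_fix[OF g])
      then have "?w = v" by (rule app_inj)
      then show False using \<open>?w \<notin> words p\<close> True by simp
    qed
    then show ?thesis
      using app_perm_a_Cons[OF p, of "i - 1" "app (perm_sec p g (i - 1)) v"]
      by (simp add: app_plus 1 app_perm_sec[OF g])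
  next
    case False
    then show ?thesis using fix1[of "nat (i mod int p) # v"] perm_sec_fix[OF g False] by simp
  qed
  from perm_stab_eqI[OF fix1 nil this]
  show "?h \<in> perm_stab p" "perm_sec p ?h i = perm_sec p g (i - 1)" by auto
qed

lemma app_zm_perm_a:
  assumes "x < p" "v \<in> words p"
  shows "app (zm (int n) (perm_a p)) (x # v) = ((x + n) mod p) # v"
  using assms
proof (induction n arbitrary: x)
  case (Suc n)
  then have "app (zm (int n) (perm_a p)) (((x + 1) mod p) # v) = (((x + 1) mod p + n) mod p) # v"
    by (intro Suc.IH) auto
  then show ?case using Suc.prems by (simp add: zm_add app_plus app_perm_a mod_add_left_eq mod_Suc_eq)
qed (simp add: app_zero)

lemma zm_fix:
  assumes "\<And>x. x \<in> X \<Longrightarrow> app g x = x" "x \<in> X"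
  shows "app (zm (int n) g) x = x"
  using assms by (induction n) (simp_all add: zm_add app_plus app_zero)

lemma zm_p_perm_a: "zm (int p) (perm_a p) = 0"
proof (rule bijection_eqI)
  fix u
  have nw: "app (perm_a p) u = u" if "u \<in> insert [] (- words p)" for u using that
    by (auto simp: app_perm_a)
  show "app (zm (int p) (perm_a p)) u = app 0 u"
  proof (cases "u \<in> insert [] (- words p)")
    case True then show ?thesis using zm_fix[OF nw True, of p] by (simp add: app_zero)
  next
    case False
    then obtain x v where "u = x # v" "x < p" "v \<in> words p" by (cases u) auto
    then show ?thesis by (simp add: app_zm_perm_a app_zero)
  qed
qed

lemma zm_perm_a_perm_stab:
  assumes p: "p > 0"
  shows "zm k (perm_a p) \<in> perm_stab p \<longleftrightarrow> int p dvd k"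
proof
  assume k: "zm k (perm_a p) \<in> perm_stab p"
  define n where "n = nat (k mod int p)"
  have n: "int n = k mod int p" using p by (simp add: n_def)
  have "zm k (perm_a p) = zm (int n) (perm_a p)" by (rule zm_cong[OF zm_p_perm_a]) (simp add: n)
  then have "app (zm k (perm_a p)) [0] = [n mod p]" using app_zm_perm_a[of 0 p "[]" n] p by simp
  then have "n mod p = 0" using perm_stab_D(3)[OF k, of 0 "[]"] by simp
  moreover have "n < p" using n p by (metis of_nat_0_less_iff of_nat_less_iff pos_mod_bound)
  ultimately show "int p dvd k" using n by auto
next
  assume "int p dvd k"
  then have "zm k (perm_a p) = zm 0 (perm_a p)"
    by (intro zm_cong[OF zm_p_perm_a]) (simp add: cong_0_iff)
  then show "zm k (perm_a p) \<in> perm_stab p" using subgrp_0[OF subgrp_perm_stab] by simp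
qed

lemma app_perm_b: "app (perm_b p e) u = (if u \<in> words p then ggs_b_rec p e u else u)"
  using ggs_b_in[of p e] by (simp add: perm_b_def app_perm_of tree_aut_def) (simp add: ggs_b_def)

lemma perm_of_a_pow: "perm_of p (ggs_a p [^]\<^bsub>tree_aut p\<^esub> (k :: int)) = zm k (perm_a p)"
  unfolding zm_def perm_a_def
  by (rule hom_int_pow[OF perm_of_hom ggs_a_in group_tree_aut additive.group_axioms])

lemma perm_b_perm_stab:
  assumes p: "p > 0"
  shows "perm_b p e \<in> perm_stab p" "perm_sec p (perm_b p e) i = (if int p dvd i then perm_b p e else zm (exps p e i) (perm_a p))"
proof -
  let ?f = "\<lambda>i. if int p dvd i then perm_b p e else zm (exps p e i) (perm_a p)"
  have "app (perm_b p e) (nat (i mod int p) # v) = nat (i mod int p) # app (?f i) v" for i v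
  proof (cases "v \<in> words p")
    case True
    have x: "nat (i mod int p) < p" using p by (simp add: nat_less_iff)
    have z: "nat (i mod int p) = 0 \<longleftrightarrow> int p dvd i" using p
      by (metis dvd_eq_mod_eq_0 nat_0_iff order_antisym of_nat_0_less_iff pos_mod_sign order_refl)
    show ?thesis
    proof (cases "int p dvd i")
      case False
      have "app (zm (e (nat (i mod int p))) (perm_a p)) v
          = (ggs_a p [^]\<^bsub>tree_aut p\<^esub> e (nat (i mod int p))) v"
        using True unfolding perm_of_a_pow[symmetric] by (simp add: app_perm_of[OF ggs_a_pow_in])
      then show ?thesis using True False x z by (simp add: app_perm_b exps_def)
    qed (use True x z in \<open>simp add: app_perm_b\<close>)
  next
    case False
    have nw: "app (perm_a p) u = u" if "u \<notin> words p" for u using that by (simp add: app_perm_a)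
    have "app (zm k (perm_a p)) v = v" for k
    proof -
      have k: "zm k (perm_a p) = zm (int (nat (k mod int p))) (perm_a p)"
        using p by (intro zm_cong[OF zm_p_perm_a]) simp
      show ?thesis unfolding k by (rule zm_fix[of "- words p"]) (use nw False in auto)
    qed
    then show ?thesis using False by (simp add: app_perm_b)
  qed
  from perm_stab_eqI[OF _ _ this]
  show "perm_b p e \<in> perm_stab p" "perm_sec p (perm_b p e) i = ?f i" by (auto simp: app_perm_b)
qed

text \<open>Induction on the list: the section of p b is p b itself at 0 and a multiple of p a,
  hence trivial, elsewhere.\<close>

lemma zm_p_perm_b:
  assumes p: "p > 0"
  shows "zm (int p) (perm_b p e) = 0"
proof (rule bijection_eqI)
  let ?g = "zm (int p) (perm_b p e)"
  have g: "?g \<in> perm_stab p" by (rule zm_in[OF subgrp_perm_stab perm_b_perm_stab(1)[OF p]])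
  have s: "perm_sec p ?g i = zm (int p) (perm_sec p (perm_b p e) i)" for i
    by (rule zm_hom[OF perm_sec_add subgrp_perm_stab perm_b_perm_stab(1)[OF p]])
  have a: "zm (int p) (zm k (perm_a p)) = 0" for k
    using zm_mult[of k "int p" "perm_a p"] zm_mult[of "int p" k "perm_a p"]
    by (simp add: zm_p_perm_a mult.commute)
  show "app ?g u = app 0 u" for u
  proof (induction u)
    case Nil then show ?case using perm_stab_D(2)[OF g] by (simp add: app_zero)
  next
    case (Cons x v)
    show ?case
    proof (cases "x < p")
      case True
      then have "app ?g (x # v) = x # app (perm_sec p ?g (int x)) v" using app_perm_sec[OF g, of
          "int x" v] by simp
      then show ?thesis using Cons.IH unfolding s perm_b_perm_stab(2)[OF p]
        by (auto simp: a app_zero)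
    next
      case False
      then show ?thesis using perm_stab_D(1)[OF g, of "x # v"] by (simp add: app_zero)
    qed
  qed
qed

section \<open>The periodic exponents and the transfer to the tree group\<close>

lemma exps_nat: "i \<in> {1..p - 1} \<Longrightarrow> exps p e (int i) = e i"
  by (auto simp: exps_def dest: dvd_imp_le)

lemma exps_neg_nat: "i \<in> {1..p - 1} \<Longrightarrow> exps p e (- int i) = e (p - i)"
proof -
  assume i: "i \<in> {1..p - 1}"
  have np: "\<not> p dvd i" using i by (auto dest: dvd_imp_le)
  then have "(- int i) mod int p = int (p - i)"
    using i by (auto simp: zmod_zminus1_eq_if of_nat_diff dvd_eq_mod_eq_0)
  moreover have "\<not> int p dvd - int i" using np by simp
  ultimately show ?thesis by (simp add: exps_def)
qed

lemma exps_range: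
  assumes "e \<in> {1..p-1} \<rightarrow> {0..<int p}" "p > 0"
  shows "exps p e m \<in> {0..<int p}"
proof (cases "int p dvd m")
  case False
  then have "nat (m mod int p) \<in> {1..p - 1}"
  proof -
    have "m mod int p \<noteq> 0" "0 \<le> m mod int p" "m mod int p < int p"
      using False assms(2) by (simp_all add: dvd_eq_mod_eq_0)
    then show ?thesis by auto
  qed
  then show ?thesis using assms(1) False by (auto simp: exps_def Pi_def)
qed (use assms in \<open>simp add: exps_def\<close>)

lemma ggs_tree:
  assumes "prime p" "odd p" "e \<in> {1..p-1} \<rightarrow> {0..<int p}" "\<not> constant_tuple 1 (p - 1) e"
  shows "ggs p (exps p e) (perm_a p) (perm_b p e) (perm_stab p) (perm_sec p)"
proof (rule ggs.intro)
  have p: "p > 0" using assms(1) prime_gt_0_nat by blast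
  show "prime p" "odd p" by fact+
  show "exps p e (i + int p) = exps p e i" "exps p e 0 = 0" for i by (simp_all add: exps_def)
  obtain i j where ij: "i \<in> {1..p - 1}" "j \<in> {1..p - 1}" "e i \<noteq> e j"
    using assms(4) by (auto simp: constant_tuple_def)
  then have "\<not> [exps p e (int i) = exps p e (int j)] (mod int p)"
    using exps_range[OF assms(3) p, of "int i"] exps_range[OF assms(3) p, of "int j"]
    unfolding exps_nat[OF ij(1)] exps_nat[OF ij(2)] cong_def by simp
  moreover have "\<not> int p dvd int i" "\<not> int p dvd int j" using ij by (auto dest: dvd_imp_le)
  ultimately show "\<exists>i j. \<not> int p dvd i \<and> \<not> int p dvd j \<and> \<not> [exps p e i = exps p e j] (mod int p)"
    by blast
  show "subgrp (perm_stab p)" by (rule subgrp_perm_stab)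
  show "perm_sec p g (i + int p) = perm_sec p g i" for g i by (rule perm_sec_periodic)
  show "zm k (perm_a p) \<in> perm_stab p \<longleftrightarrow> int p dvd k" for k by (rule zm_perm_a_perm_stab[OF p])
  show "zm (int p) (perm_a p) = 0" by (rule zm_p_perm_a)
  show "perm_b p e \<in> perm_stab p" by (rule perm_b_perm_stab[OF p])
  show "zm (int p) (perm_b p e) = 0" by (rule zm_p_perm_b[OF p])
  show "perm_sec p (perm_b p e) i = (if int p dvd i then perm_b p e else zm (exps p e i) (perm_a p))" for i by (rule perm_b_perm_stab[OF p])
  fix g h i assume g: "g \<in> perm_stab p"
  show "perm_sec p (g + h) i = perm_sec p g i + perm_sec p h i" if "h \<in> perm_stab p"
    by (rule perm_sec_add[OF g that])
  show "g = 0" if "\<And>i. perm_sec p g i = 0" by (rule perm_sec_eq_0[OF g that])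
  show "- perm_a p + g + perm_a p \<in> perm_stab p" by (rule perm_stab_conj_perm_a[OF p g])
  show "perm_sec p (- perm_a p + g + perm_a p) (i + 1) = perm_sec p g i"
    using perm_stab_conj_perm_a(2)[OF p g, of "i + 1"] by simp
qed

lemma card_rcosets_eq_index:
  assumes f: "f \<in> hom H additive" and H: "group H" and inj: "inj_on f (carrier H)" and K:
      "K \<subseteq> carrier H"
  shows "card (rcosets\<^bsub>H\<^esub> K) = index (f ` carrier H) (f ` K)"
proof -
  have c: "f ` (K #>\<^bsub>H\<^esub> x) = (\<lambda>k. k + f x) ` f ` K" if "x \<in> carrier H" for x
    using hom_mult[OF f] that K by (auto simp: r_coset_def image_image image_iff subset_iff)
  have sub: "C \<subseteq> carrier H" if "C \<in> rcosets\<^bsub>H\<^esub> K" for C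
    using that K by (auto simp: RCOSETS_def r_coset_def subset_iff intro!: monoid.m_closed[OF group.is_monoid[OF H]])
  have "inj_on ((`) f) (rcosets\<^bsub>H\<^esub> K)"
  proof (rule inj_onI)
    fix C C' assume "C \<in> rcosets\<^bsub>H\<^esub> K" "C' \<in> rcosets\<^bsub>H\<^esub> K" "f ` C = f ` C'"
    then show "C = C'" using inj_on_image_eq_iff[OF inj sub sub, of C C'] by simp
  qed
  then have "card (rcosets\<^bsub>H\<^esub> K) = card ((`) f ` (rcosets\<^bsub>H\<^esub> K))" by (simp add: card_image)
  also have "(`) f ` (rcosets\<^bsub>H\<^esub> K) = (\<lambda>h. (\<lambda>k. k + h) ` f ` K) ` f ` carrier H"
    unfolding RCOSETS_def using c by (auto simp: image_image image_UN)
  finally show ?thesis by (simp add: index_def)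
qed

text \<open>\<open>perm_of\<close> is an injective homomorphism, so it carries the derived series
  and its cosets to those of the locale.\<close>

lemma card_rcosets_ggs:
  assumes "ggs p (exps p e) (perm_a p) (perm_b p e) (perm_stab p) (perm_sec p)"
  shows "card (rcosets\<^bsub>ggs_group p e\<^esub> ((derived (ggs_group p e) ^^ n) (carrier (ggs_group p e))))
    = index (ggs.G (perm_a p) (perm_b p e)) (ggs.D (perm_a p) (perm_b p e) n)"
proof -
  let ?G = "ggs_group p e" and ?f = "perm_of p"
  interpret ggs p "exps p e" "perm_a p" "perm_b p e" "perm_stab p" "perm_sec p" by fact
  interpret t: group_hom "tree_aut p" additive ?f
    using group_tree_aut additive.group_axioms perm_of_hom
    by (simp add: group_hom_def group_hom_axioms_def)
  have sub: "carrier ?G \<subseteq> carrier (tree_aut p)"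
    unfolding carrier_ggs_group by (rule t.G.generate_in_carrier[THEN subsetI]) (use ggs_a_in ggs_b_in in auto)
  have f: "?f \<in> hom ?G additive"
    using hom_mult[OF perm_of_hom, of _ p] sub by (intro homI) (auto simp: ggs_group_def subset_iff)
  interpret s: group_hom ?G additive ?f
    using group_ggs_group additive.group_axioms f by (simp add: group_hom_def group_hom_axioms_def)
  have im: "?f ` carrier ?G = G"
    unfolding carrier_ggs_group G_def
    using t.generate_img[of "{ggs_a p, ggs_b p e}"] ggs_a_in ggs_b_in
    by (simp add: perm_a_def perm_b_def)
  have "?f ` ((derived ?G ^^ n) (carrier ?G)) = D n"
    unfolding D_def im[symmetric] using s.exp_of_derived_img[of "carrier ?G" n] by simp
  moreover have "(derived ?G ^^ n) (carrier ?G) \<subseteq> carrier ?G"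
    by (rule s.G.exp_of_derived_in_carrier) simp
  ultimately show ?thesis
    using card_rcosets_eq_index[OF f group_ggs_group inj_on_subset[OF inj_on_perm_of sub]] im
    by simp
qed

section \<open>Translation of the conditions on the tuples\<close>

lemma all_residues:
  assumes "p > 0" "\<And>m. m \<in> {0..<int p} \<Longrightarrow> P m" "\<And>m. P (m mod int p) \<Longrightarrow> P m"
  shows "P m"
  using assms(2)[of "m mod int p"] assms(1,3) by simp

lemma exps_mod: "exps p e (m mod int p) = exps p e m" "exps p e (- (m mod int p)) = exps p e (- m)"
proof -
  have "(- (m mod int p)) mod int p = (- m) mod int p" by (rule mod_minus_eq)
  moreover have "int p dvd - (m mod int p) \<longleftrightarrow> int p dvd - m" by (simp add: dvd_mod_iff)
  ultimately show "exps p e (- (m mod int p)) = exps p e (- m)" unfolding exps_def by simp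
  show "exps p e (m mod int p) = exps p e m" by (simp add: exps_def dvd_mod_iff)
qed

lemma dvd_range: "m \<in> {0..<int p} \<Longrightarrow> \<not> int p dvd m \<Longrightarrow> \<exists>i\<in>{1..p - 1}. m = int i"
  by (intro bexI[of _ "nat m"]) (auto simp: le_less Suc_le_eq)

context
  fixes p :: nat and e :: "nat \<Rightarrow> int"
  assumes p: "prime p" "odd p" and e: "e \<in> {1..p-1} \<rightarrow> {0..<int p}"
    and nc: "\<not> constant_tuple 1 (p - 1) e"
begin

interpretation ggs p "exps p e" "perm_a p" "perm_b p e" "perm_stab p" "perm_sec p"
  by (rule ggs_tree[OF p e nc])

lemma diff_tuple_cong: "[diff_tuple p d i = d (i - 1) - d i] (mod int p)"
  by (simp add: diff_tuple_def)

lemma diff_tuple_eq_iff: "diff_tuple p d i = diff_tuple p d j \<longleftrightarrow> [d (i - 1) - d i = d (j - 1) - d j] (mod int p)"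
  by (simp add: diff_tuple_def cong_def)

lemma sym_exps_iff: "sym_exps \<longleftrightarrow> symmetric_tuple 1 (p - 1) e"
proof -
  have "sym_exps \<longleftrightarrow> (\<forall>m. exps p e m = exps p e (- m))"
    unfolding sym_exps_def cong_def using exps_range[OF e p_pos] by simp
  also have "\<dots> \<longleftrightarrow> (\<forall>i\<in>{1..p - 1}. e i = e (p - i))"
  proof
    assume *: "\<forall>m. exps p e m = exps p e (- m)"
    show "\<forall>i\<in>{1..p - 1}. e i = e (p - i)" using * exps_nat[of _ p e] exps_neg_nat[of _ p e] by metis
  next
    assume *: "\<forall>i\<in>{1..p - 1}. e i = e (p - i)"
    show "\<forall>m. exps p e m = exps p e (- m)"
    proof
      fix m
      show "exps p e m = exps p e (- m)"
      proof (rule all_residues[OF p_pos, where P = "\<lambda>m. exps p e m = exps p e (- m)"])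
        fix m assume m: "m \<in> {0..<int p}"
        show "exps p e m = exps p e (- m)"
        proof (cases "int p dvd m")
          case False
          then obtain i where "i \<in> {1..p - 1}" "m = int i" using dvd_range m by blast
          then show ?thesis using * exps_nat[of i p e] exps_neg_nat[of i p e] by simp
        qed (simp add: exps_def)
      qed (simp add: exps_mod)
    qed
  qed
  also have "\<dots> \<longleftrightarrow> symmetric_tuple 1 (p - 1) e"
    unfolding symmetric_tuple_def using p_pos by simp
  finally show ?thesis .
qed

lemma affine_exps_iff: "affine_exps \<longleftrightarrow> constant_tuple 2 (p - 1) (diff_tuple p e)"
proof
  assume affine_exps
  then obtain l c where l: "\<And>m. \<not> int p dvd m \<Longrightarrow> [exps p e m = l * m + c] (mod int p)"
    by (auto simp: affine_exps_def)
  have l': "[e i = l * int i + c] (mod int p)" if "i \<in> {1..p - 1}" for i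
  proof -
    have "\<not> p dvd i" using that by (auto dest: dvd_imp_le)
    then show ?thesis using l[of "int i"] exps_nat[OF that, of e] by simp
  qed
  have "[e (i - 1) - e i = - l] (mod int p)" if "i \<in> {2..p - 1}" for i
  proof -
    have "[e (i - 1) - e i = (l * int (i - 1) + c) - (l * int i + c)] (mod int p)"
      using that by (intro cong_diff l') auto
    also have "(l * int (i - 1) + c) - (l * int i + c) = - l" using that
      by (simp add: of_nat_diff algebra_simps)
    finally show ?thesis .
  qed
  then show "constant_tuple 2 (p - 1) (diff_tuple p e)"
    unfolding constant_tuple_def diff_tuple_eq_iff by (metis cong_sym cong_trans)
next
  assume *: "constant_tuple 2 (p - 1) (diff_tuple p e)"
  \<comment> \<open>Since e'_i is e_(i-1) - e_i, the slope is -d; the intercept e_1 + d is fixed by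
    the value at 1.\<close>
  define d where "d = diff_tuple p e 2"
  have d: "[e (i - 1) - e i = d] (mod int p)" if "i \<in> {2..p - 1}" for i
  proof -
    have "diff_tuple p e i = d"
      unfolding d_def using * that unfolding constant_tuple_def
      by (meson atLeastAtMost_iff order_refl order_trans)
    then show ?thesis using diff_tuple_cong[of e i] cong_sym by simp
  qed
  have ei: "[e i = - d * int i + (e 1 + d)] (mod int p)" if "1 \<le> i" "i \<le> p - 1" for i
    using that
  proof (induction i rule: dec_induct)
    case base then show ?case by simp
  next
    case (step i)
    have "[e i - (e i - e (Suc i)) = (- d * int i + (e 1 + d)) - d] (mod int p)"
      using d[of "Suc i"] step by (intro cong_diff) auto
    then show ?case by (simp add: algebra_simps)
  qed
  have "[exps p e m = - d * m + (e 1 + d)] (mod int p)" if "\<not> int p dvd m" for m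
  proof -
    have "\<not> int p dvd m mod int p" using that by (simp add: dvd_mod_iff)
    then obtain i where i: "i \<in> {1..p - 1}" "m mod int p = int i" using dvd_range[of
        "m mod int p" p] p_pos by auto
    have "exps p e m = e i" using exps_mod(1)[of p e m] exps_nat[OF i(1), of e] i(2) by simp
    moreover have "[- d * int i + (e 1 + d) = - d * m + (e 1 + d)] (mod int p)"
      unfolding i(2)[symmetric] by (intro cong_add cong_mult cong_refl) simp
    ultimately show ?thesis using ei[of i] i(1) cong_trans by auto
  qed
  then show affine_exps unfolding affine_exps_def by blast
qed

text \<open>Reflecting the index of e'' turns its entry at i into the second difference of e at p -
  i, p - i + 1, p - i + 2. Symmetry thus says that the second differences of the odd part f vanish,
  so f is affine on 1, ..., p - 1; oddness makes it linear.\<close>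

lemma odd_linear_iff: "odd_linear \<longleftrightarrow> symmetric_tuple 3 (p - 1) (diff_tuple p (diff_tuple p e))"
proof -
  define f where "f m = exps p e m - exps p e (- m)" for m
  have f0: "f 0 = 0" by (simp add: f_def)
  have per: "periodic p f" unfolding f_def by (intro periodic_diff periodic_E periodic_E_neg)
  have fi: "f (int i) = e i - e (p - i)" if "i \<in> {1..p - 1}" for i
    using exps_nat[OF that] exps_neg_nat[OF that] by (simp add: f_def)
  have sd: "[diff_tuple p (diff_tuple p e) i = e (i - 2) - 2 * e (i - 1) + e i] (mod int p)" if
      "i \<in> {3..p - 1}" for i
  proof -
    have "[diff_tuple p (diff_tuple p e) i = diff_tuple p e (i - 1) - diff_tuple p e i] (mod int p)"
      by (rule diff_tuple_cong)
    also have "[diff_tuple p e (i - 1) - diff_tuple p e i = (e (i - 1 - 1) - e (i - 1)) - (e (i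
        - 1) - e i)] (mod int p)"
      by (intro cong_diff diff_tuple_cong)
    also have "i - 1 - 1 = i - 2" by simp
    finally show ?thesis by (simp add: algebra_simps)
  qed
  have eq: "diff_tuple p (diff_tuple p e) i = diff_tuple p (diff_tuple p e) (3 + (p - 1) - i)
      \<longleftrightarrow> [f (int i) = 2 * f (int (i - 1)) - f (int (i - 2))] (mod int p)" if i: "i \<in> {3..p -
          1}" for i
  proof -
    let ?d = "diff_tuple p (diff_tuple p e)"
    let ?j = "3 + (p - 1) - i"
    have j: "?j \<in> {3..p - 1}" "?j = p + 2 - i" using i by auto
    have "?d i = ?d ?j \<longleftrightarrow> [?d i = ?d ?j] (mod int p)" by (simp add: diff_tuple_def cong_def)
    also have "\<dots> \<longleftrightarrow> [e (i - 2) - 2 * e (i - 1) + e i = e (?j - 2) - 2 * e (?j - 1)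
        + e ?j] (mod int p)"
      using sd[OF i] sd[OF j(1)] unfolding cong_def by (simp only:)
    also have "e (?j - 2) = e (p - i)" by (rule arg_cong[of _ _ e]) (use i in auto)
    also have "e (?j - 1) = e (p - (i - 1))" by (rule arg_cong[of _ _ e]) (use i in auto)
    also have "e ?j = e (p - (i - 2))" by (rule arg_cong[of _ _ e]) (use i in auto)
    also have "[e (i - 2) - 2 * e (i - 1) + e i = e (p - i) - 2 * e (p - (i - 1)) + e (p - (i
        - 2))] (mod int p)
      \<longleftrightarrow> [f (int i) = 2 * f (int (i - 1)) - f (int (i - 2))] (mod int p)"
    proof -
      have r: "i \<in> {1..p - 1}" "i - 1 \<in> {1..p - 1}" "i - 2 \<in> {1..p - 1}" using i by auto
      show ?thesis unfolding fi[OF r(1)] fi[OF r(2)] fi[OF r(3)] cong_iff_dvd_diff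
        by (simp add: algebra_simps)
    qed
    finally show ?thesis .
  qed
  show ?thesis
  proof
    assume odd_linear
    then obtain l where l: "\<And>m. [f m = l * m] (mod int p)" by (auto simp: odd_linear_def f_def)
    have "[f (int i) = 2 * f (int (i - 1)) - f (int (i - 2))] (mod int p)" if i: "i \<in> {3..p - 1}"
        for i
    proof -
      have "[2 * f (int (i - 1)) - f (int (i - 2)) = 2 * (l * int (i - 1)) - l * int (i
          - 2)] (mod int p)"
        by (intro cong_diff cong_mult cong_refl l)
      also have "2 * (l * int (i - 1)) - l * int (i - 2) = l * int i" using i
        by (simp add: of_nat_diff algebra_simps)
      finally show ?thesis using l[of "int i"] by (metis cong_sym cong_trans)
    qed
    then show "symmetric_tuple 3 (p - 1) (diff_tuple p (diff_tuple p e))"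
      unfolding symmetric_tuple_def using eq by simp
  next
    assume s: "symmetric_tuple 3 (p - 1) (diff_tuple p (diff_tuple p e))"
    have rec: "[f (int i) = 2 * f (int (i - 1)) - f (int (i - 2))] (mod int p)" if
        "i \<in> {3..p - 1}" for i
      using s that eq[OF that] unfolding symmetric_tuple_def by blast
    define d where "d = f 2 - f 1"
    have aff: "[f (int i) = f 1 + d * (int i - 1)] (mod int p) \<and> [f (int (Suc i)) = f 1 + d
        * (int (Suc i) - 1)] (mod int p)"
      if "1 \<le> i" "i \<le> p - 2" for i
      using that
    proof (induction i rule: dec_induct)
      case base then show ?case by (simp add: d_def)
    next
      case (step i)
      have "[f (int (Suc (Suc i))) = 2 * f (int (Suc i)) - f (int i)] (mod int p)"
        using rec[of "Suc (Suc i)"] step by simp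
      also have "[2 * f (int (Suc i)) - f (int i) = 2 * (f 1 + d * (int (Suc i) - 1)) - (f 1 + d
          * (int i - 1))] (mod int p)"
        using step by (intro cong_diff cong_mult cong_refl) auto
      also have "2 * (f 1 + d * (int (Suc i) - 1)) - (f 1 + d * (int i - 1)) = f 1 + d
          * (int (Suc (Suc i)) - 1)"
        by (simp add: algebra_simps)
      finally show ?case using step by auto
    qed
    \<comment> \<open>Comparing this with the affine formula gives 2(d - f(1)) = 0 modulo p, so the
      constant term vanishes. For p = 3, where e'' is empty, this alone determines f.\<close>
    have "f (int (p - 1)) = - f 1"
    proof -
      have "f (int (p - 1)) = e (p - 1) - e (p - (p - 1))" using p_gt_2 by (intro fi) auto
      moreover have "f (int 1) = e 1 - e (p - 1)" using p_gt_2 by (intro fi) auto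
      ultimately show ?thesis using p_pos by simp
    qed
    moreover have "[f (int (Suc (p - 2))) = f 1 + d * (int (Suc (p - 2)) - 1)] (mod int p)"
      using aff[of "p - 2"] p_gt_2 by auto
    moreover have "Suc (p - 2) = p - 1" "int (p - 1) = int p - 1" using p_gt_2 by auto
    ultimately have "[- f 1 = f 1 + d * (int p - 1 - 1)] (mod int p)" by simp
    then have "int p dvd - f 1 - (f 1 + d * (int p - 1 - 1))" by (simp only: cong_iff_dvd_diff)
    moreover have "- f 1 - (f 1 + d * (int p - 1 - 1)) = 2 * (d - f 1) - int p * d"
      by (simp add: algebra_simps)
    ultimately have "int p dvd 2 * (d - f 1)"
      by (metis dvd_diff_commute dvd_triv_left dvd_diff diff_add_cancel dvd_add)
    then have "int p dvd d - f 1" using prime_dvd_mult_iff[OF prime_int_p, of 2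
        "d - f 1"] not_dvd_2 by blast
    then have d1: "[f 1 = d] (mod int p)" by (simp add: cong_iff_dvd_diff dvd_diff_commute)
    have fl: "[f (int i) = d * int i] (mod int p)" if "i \<in> {1..p - 1}" for i
    proof -
      have "[f (int i) = f 1 + d * (int i - 1)] (mod int p)"
      proof (cases "i \<le> p - 2")
        case True then show ?thesis using aff[of i] that by auto
      next
        case False
        then have "i = Suc (p - 2)" using that p_gt_2 by auto
        then show ?thesis using aff[of "p - 2"] p_gt_2 by auto
      qed
      also have "[f 1 + d * (int i - 1) = d + d * (int i - 1)] (mod int p)"
        by (intro cong_add d1 cong_refl)
      finally show ?thesis by (simp add: algebra_simps)
    qed
    have "[f m = d * m] (mod int p)" for m
    proof -
      have "[f (m mod int p) = d * (m mod int p)] (mod int p)"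
      proof (cases "int p dvd m")
        case True then show ?thesis by (simp add: f0 dvd_eq_mod_eq_0)
      next
        case False
        then have "\<not> int p dvd m mod int p" by (simp add: dvd_mod_iff)
        then obtain i where "i \<in> {1..p - 1}" "m mod int p = int i" using dvd_range[of
            "m mod int p" p] p_pos by auto
        then show ?thesis using fl by simp
      qed
      also have "[d * (m mod int p) = d * m] (mod int p)" by (intro cong_mult cong_refl) simp
      finally show ?thesis using periodic_mod[OF per, of m] by (metis cong_sym cong_trans)
    qed
    then show odd_linear unfolding odd_linear_def f_def by blast
  qed
qed

lemma card_rcosets_derived_1:
  "card (rcosets\<^bsub>ggs_group p e\<^esub> ((derived (ggs_group p e) ^^ 1) (carrier (ggs_group p e)))) = p ^ 2"
  unfolding card_rcosets_ggs[OF ggs_axioms] by (rule index_D_1)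

lemma card_rcosets_derived:
  assumes "n \<ge> 2"
  shows "card (rcosets\<^bsub>ggs_group p e\<^esub> ((derived (ggs_group p e) ^^ n) (carrier (ggs_group p e))))
    * p ^ (of_bool (symmetric_tuple 1 (p - 1) e) * (\<Sum>k<n - 1. p ^ k))
    = p ^ (p ^ (n - 2) * (p + of_bool (constant_tuple 2 (p - 1) (diff_tuple p e))
        + of_bool (symmetric_tuple 3 (p - 1) (diff_tuple p (diff_tuple p e)))) + 1)"
  using index_D[OF assms] unfolding card_rcosets_ggs[OF ggs_axioms] sym_exps_iff affine_exps_iff odd_linear_iff .

end

theorem theorem1p1:
  fixes p n :: nat and e :: "nat \<Rightarrow> int"
  defines "G \<equiv> ggs_group p e"
  defines "e' \<equiv> diff_tuple p e"
  defines "e'' \<equiv> diff_tuple p e'"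
  assumes "Factorial_Ring.prime p" and "odd p"
    and "e \<in> {1..p-1} \<rightarrow> {0..<int p}"
    and "\<not> constant_tuple 1 (p - 1) e"
    and "n \<ge> 1"
  shows "finite (rcosets\<^bsub>G\<^esub> ((derived G ^^ n) (carrier G))) \<and>
    log (real p) (real (card (rcosets\<^bsub>G\<^esub> ((derived G ^^ n) (carrier G)))))
      = (if n \<ge> 2 then
           real p ^ (n - 2) * (real p + tuple_con 2 (p - 1) e' + tuple_sym 3 (p - 1) e'')
             - (real p ^ (n - 1) - 1) / (real p - 1) * tuple_sym 1 (p - 1) e + 1
         else 2)"
proof -
  let ?N = "card (rcosets\<^bsub>G\<^esub> ((derived G ^^ n) (carrier G)))"
  have p: "p > 1" using assms(4) by (rule prime_gt_1_nat)
  note h = assms(4-7)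
  show ?thesis
  proof (cases "n \<ge> 2")
    case False
    then have n: "n = 1" using assms(8) by simp
    have N: "?N = p ^ 2" unfolding G_def n by (rule card_rcosets_derived_1[OF h])
    then have "finite (rcosets\<^bsub>G\<^esub> ((derived G ^^ n) (carrier G)))" using p
      by (intro card_ge_0_finite) simp
    moreover have "log (real p) (real ?N) = 2" using p by (simp add: N log_nat_power)
    ultimately show ?thesis using n by simp
  next
    case True
    define c s q where "c = (of_bool (constant_tuple 2 (p - 1) e') :: nat)"
      and "s = (of_bool (symmetric_tuple 3 (p - 1) e'') :: nat)"
      and "q = (of_bool (symmetric_tuple 1 (p - 1) e) :: nat)"
    define Q where "Q = (\<Sum>k<n - 1. p ^ k)"
    have N: "?N * p ^ (q * Q) = p ^ (p ^ (n - 2) * (p + c + s) + 1)"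
      using card_rcosets_derived[OF h True] unfolding G_def c_def s_def q_def Q_def e'_def e''_def .
    \<comment> \<open>An infinite set of cosets would have cardinality 0, contradicting the power of
      p on the right; this gives finiteness and permits taking logarithms.\<close>
    have N0: "?N > 0"
    proof (rule ccontr)
      assume "\<not> ?N > 0"
      then have "p ^ (p ^ (n - 2) * (p + c + s) + 1) = 0" using N by simp
      then show False using p by simp
    qed
    have "log (real p) (real ?N) + real (q * Q) = log (real p) (real (?N * p ^ (q * Q)))"
      using p N0 by (simp add: log_mult log_nat_power)
    also have "\<dots> = real (p ^ (n - 2) * (p + c + s) + 1)"
      unfolding N using p by (simp only: of_nat_power) (rule log_nat_power[of
          "real p", THEN trans], simp_all)
    finally have L: "log (real p) (real ?N) = real p ^ (n - 2) * (real p + real c + real s) + 1 - real q * real Q" by simp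
    have "real Q = (real p ^ (n - 1) - 1) / (real p - 1)"
      using p by (simp add: Q_def geometric_sum)
    then show ?thesis
      using card_ge_0_finite[OF N0] True
      by (simp add: L tuple_con_def tuple_sym_def c_def s_def q_def algebra_simps)
  qed
qed

end
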